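(* Write $\mathcal O=\mathcal O_{\overline{\mathrm{Spec}\,\mathbb Z}}$. Let $D,D'$ be Arakelov divisors on $\overline{\mathrm{Spec}\,\mathbb Z}$ with $D_\infty=a\{\infty\}$, $D'_\infty=a'\{\infty\}$. (i) The multiplication rule $$\mathcal O(D)\wedge_{\mathcal O}\mathcal O(D')\simeq\mathcal O(D+D')$$ holds for the $\mathcal O$-modules $\mathcal O(D)$ and $\mathcal O(D')$ except when $\lambda=e^a$ and $\lambda'=e^{a'}$ are both irrational while their product $\lambda\lambda'$ is rational. In that case one has $$\mathcal O(D)\wedge_{\mathcal O}\mathcal O(D')\simeq\mathcal O_\epsilon\wedge_{\mathcal O}\mathcal O(D+D')\simeq\mathcal O(D+D')\wedge_{\mathcal O}\mathcal O_\epsilon .$$ (ii) The Arakelov divisors $D,D'$ are equivalent modulo principal divisors if and only if the sheaves $\mathcal O(D)$ and $\mathcal O(D')$ are isomorphic as abstract sheaves of $\mathcal O$-modules.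
   Context: $\mathbb S$-algebras: let $k_+=\{0,\dots,k\}$ pointed by $0$ and $\Gamma^{\rm op}$ the full subcategory of finite pointed sets on the objects $k_+$ (functors are evaluated on all finite pointed sets via the evident equivalence). A $\Gamma$-set is a functor $\Gamma^{\rm op}\to\mathrm{Sets}_*$ sending $0_+$ to a point. Their smash product is the Day convolution $(F_1\wedge F_2)(Z)=\varinjlim_{v:X\wedge Y\to Z}F_1(X)\wedge F_2(Y)$; the unit is the inclusion functor $\mathbb S$. An $\mathbb S$-algebra $\mathcal A$ is a monoid in $(\Gamma\text{-sets},\wedge,\mathbb S)$, and modules are modules over this monoid. For a right $\mathcal A$-module $M$ and a left $\mathcal A$-module $N$, $M\wedge_{\mathcal A}N$ is the coequalizer of the two action maps $M\wedge\mathcal A\wedge N\rightrightarrows M\wedge N$. For a semiring $R$, $HR$ is the $\mathbb S$-algebra $HR(X)=R^{X\setminus\{*\}}$ with $HR(f)(\phi)(y)=\sum_{x\in f^{-1}(y)}\phi(x)$ for $y\ne *$, product $(\phi\psi)(x,y)=\phi(x)\psi(y)$ and unit $x\mapsto\delta_x$; for an $R$-module $E$, $HE$ is defined by the same formulas. For a subring $R\subset\mathbb Q$, an $R$-submodule $E\subset\mathbb Q$ and $\lambda>0$, let $\Vert HE\Vert_\lambda(X)=\{\phi\in HE(X):\sum_{x\neq *}|\phi(x)|\le\lambda\}$ and $\Vert HE\Vert_{<\lambda}(X)=\{\phi\in HE(X):\sum_{x\ne *}|\phi(x)|<\lambda\}$, with $|\cdot|$ the usual absolute value. $\Vert HR\Vert_1$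 is a sub-$\mathbb S$-algebra of $HR$ and $\Vert HE\Vert_\lambda,\Vert HE\Vert_{<\lambda}$ are modules over it. $\overline{\mathrm{Spec}\,\mathbb Z}=\mathrm{Spec}\,\mathbb Z\cup\{\infty\}$, with non-empty open sets the complements of finite sets of primes, possibly also removing $\infty$. $\mathcal O_{\mathrm{Spec}\,\mathbb Z}$ is viewed as a subsheaf of the constant sheaf $\mathbb Q$. The structure sheaf is the sheaf of $\mathbb S$-algebras (subsheaf of $H\mathbb Q$) with $\mathcal O(U)=H\mathcal O_{\mathrm{Spec}\,\mathbb Z}(U)$ if $\infty\notin U$ and $\mathcal O(U)=\Vert H\mathcal O_{\mathrm{Spec}\,\mathbb Z}(U\cap\mathrm{Spec}\,\mathbb Z)\Vert_1$ if $\infty\in U$. An Arakelov divisor is a pair $D=(D_{\rm fin},D_\infty)$ with $D_{\rm fin}=\sum_p n_p\{p\}$ a divisor on $\mathrm{Spec}\,\mathbb Z$ and $D_\infty=a\{\infty\}$, $a\in\mathbb R$; addition is componentwise. The principal divisor of $q\in\mathbb Q^\times$ is $(q)=(q)_{\rm fin}-\log|q|\,\{\infty\}$, with $(q)_{\rm fin}=\sum_p v_p(q)\{p\}$. $\mathcal O(D_{\rm fin})\subset\mathbb Q$ is the usual sheaf: $\mathcal O(D_{\rm fin})(V)=\{q: q=0\text{ or }v_p(q)+n_p\ge0\ \forall p\in V\}$ for non-empty open $V$. The sheaf of $\mathcal O$-modules $\mathcal O(D)$ is $\mathcal O(D)(U)=H\mathcal O(D_{\rm fin})(U)$ if $\infty\notin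 U$, and $\mathcal O(D)(U)=\Vert H\mathcal O(D_{\rm fin})(U\cap\mathrm{Spec}\,\mathbb Z)\Vert_{e^a}$ if $\infty\in U$. The sheaf of $\mathcal O$-modules $\mathcal O_\epsilon$ is $\mathcal O_\epsilon(U)=\Vert H\mathcal O_{\mathrm{Spec}\,\mathbb Z}(U\cap\mathrm{Spec}\,\mathbb Z)\Vert_{<1}$ if $\infty\in U$, and $\mathcal O_\epsilon(U)=H\mathcal O_{\mathrm{Spec}\,\mathbb Z}(U)$ if $\infty\notin U$. On the empty set all these sheaves take the one-point value. For sheaves of $\mathcal O$-modules $\mathcal M,\mathcal N$, $\mathcal M\wedge_{\mathcal O}\mathcal N$ is the sheaf associated to the presheaf $U\mapsto\mathcal M(U)\wedge_{\mathcal O(U)}\mathcal N(U)$; the symbol $\simeq$ denotes isomorphism of sheaves of $\mathcal O$-modules. *)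

theory Defs
  imports Complex_Main "HOL-Library.FuncSet" "HOL-Computational_Algebra.Primes"
begin

section \<open>Finite pointed sets\<close>

text \<open>The object \<open>k\<^sub>+ = {0..k}\<close>, pointed by \<open>0\<close>, is represented by the number \<open>k\<close>. Pointed
  maps are extensional functions, so that equality of morphisms is equality in HOL.\<close>

definition pmaps :: "nat \<Rightarrow> nat \<Rightarrow> (nat \<Rightarrow> nat) set" where
  "pmaps k l = {f \<in> {0..k} \<rightarrow>\<^sub>E {0..l}. f 0 = 0}"

definition pid :: "nat \<Rightarrow> nat \<Rightarrow> nat" where
  "pid k = restrict id {0..k}"

definition pcomp :: "nat \<Rightarrow> (nat \<Rightarrow> nat) \<Rightarrow> (nat \<Rightarrow> nat) \<Rightarrow> nat \<Rightarrow> nat" where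
  "pcomp k g f = compose {0..k} g f"

text \<open>The smash product \<open>k\<^sub>+ \<and> l\<^sub>+\<close> is identified with \<open>(k * l)\<^sub>+\<close> by the lexicographic
  enumeration of \<open>{1..k} \<times> {1..l}\<close>: the point \<open>(i, j)\<close> becomes \<open>sm_pair l i j\<close>, with inverse
  given by \<open>sm_fst l\<close> and \<open>sm_snd l\<close>. With this choice the smash product is strictly associative,
  so no associator appears below.\<close>

definition sm_pair :: "nat \<Rightarrow> nat \<Rightarrow> nat \<Rightarrow> nat" where
  "sm_pair l i j = (if i = 0 \<or> j = 0 then 0 else (i - 1) * l + j)"

definition sm_fst :: "nat \<Rightarrow> nat \<Rightarrow> nat" where
  "sm_fst l z = (if z = 0 then 0 else (z - 1) div l + 1)"

definition sm_snd :: "nat \<Rightarrow> nat \<Rightarrow> nat" where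
  "sm_snd l z = (if z = 0 then 0 else (z - 1) mod l + 1)"

text \<open>\<open>psmash k l l' f g\<close> is \<open>f \<and> g\<close>, for \<open>f\<close> on \<open>k\<^sub>+\<close> and \<open>g : l\<^sub>+ \<rightarrow> l'\<^sub>+\<close>.\<close>

definition psmash :: "nat \<Rightarrow> nat \<Rightarrow> nat \<Rightarrow> (nat \<Rightarrow> nat) \<Rightarrow> (nat \<Rightarrow> nat) \<Rightarrow> nat \<Rightarrow> nat" where
  "psmash k l l' f g = (\<lambda>z\<in>{0..k * l}. sm_pair l' (f (sm_fst l z)) (g (sm_snd l z)))"

definition pswap :: "nat \<Rightarrow> nat \<Rightarrow> nat \<Rightarrow> nat" where
  "pswap k l = (\<lambda>z\<in>{0..k * l}. sm_pair k (sm_snd l z) (sm_fst l z))"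

lemma sm_pair_fst_snd: "z \<le> k * l \<Longrightarrow> sm_pair l (sm_fst l z) (sm_snd l z) = z"
  by (cases "z = 0") (auto simp: sm_pair_def sm_fst_def sm_snd_def)

lemma sm_fst_pair: "\<lbrakk>0 < i; 0 < j; j \<le> l\<rbrakk> \<Longrightarrow> sm_fst l (sm_pair l i j) = i"
  by (cases j) (auto simp: sm_pair_def sm_fst_def)

lemma sm_snd_pair: "\<lbrakk>0 < i; 0 < j; j \<le> l\<rbrakk> \<Longrightarrow> sm_snd l (sm_pair l i j) = j"
  by (cases j) (auto simp: sm_pair_def sm_snd_def)

lemma sm_fst_le: "z \<le> k * l \<Longrightarrow> sm_fst l z \<le> k"
proof (cases "z = 0")
  case False
  assume "z \<le> k * l"
  with False have "z - 1 < k * l" by simp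
  then have "(z - 1) div l < k" by (simp add: less_mult_imp_div_less)
  then show ?thesis by (simp add: sm_fst_def)
qed (simp add: sm_fst_def)

lemma sm_snd_le: "z \<le> k * l \<Longrightarrow> sm_snd l z \<le> l"
proof (cases "z = 0")
  case False
  assume "z \<le> k * l"
  with False have "l > 0" by (cases l) auto
  then have "(z - 1) mod l < l" by simp
  then show ?thesis by (simp add: sm_snd_def)
qed (simp add: sm_snd_def)

lemma sm_pair_le:
  assumes "i \<le> k" "j \<le> l" shows "sm_pair l i j \<le> k * l"
proof (cases "i = 0 \<or> j = 0")
  case False
  then have "(i - 1) * l + j \<le> (i - 1) * l + l" using assms by simp
  also have "\<dots> = i * l" using False by (cases i) auto
  also have "\<dots> \<le> k * l" using assms by simp
  finally show ?thesis using False by (simp add: sm_pair_def)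
qed (auto simp: sm_pair_def)

lemma sm_pair_assoc: "sm_pair (l * m) i (sm_pair m j h) = sm_pair m (sm_pair l i j) h"
proof (cases "i = 0 \<or> j = 0 \<or> h = 0")
  case False
  then obtain i' j' where [simp]: "i = Suc i'" "j = Suc j'" by (metis not0_implies_Suc)
  show ?thesis using False by (simp add: sm_pair_def algebra_simps)
qed (auto simp: sm_pair_def)


section \<open>Gamma-sets, S-algebras and modules\<close>

text \<open>The records carry the data of a functor from finite pointed sets to pointed sets; the
  predicates \<open>gamma_set\<close>, \<open>s_algebra\<close>, \<open>s_module\<close> collect the corresponding axioms.
  \<open>mp F k l f\<close> is the value of \<open>F\<close> at the pointed map \<open>f : k\<^sub>+ \<rightarrow> l\<^sub>+\<close>.\<close>

record 'a gamma =
  el :: "nat \<Rightarrow> 'a set"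
  pt :: "nat \<Rightarrow> 'a"
  mp :: "nat \<Rightarrow> nat \<Rightarrow> (nat \<Rightarrow> nat) \<Rightarrow> 'a \<Rightarrow> 'a"

text \<open>By the universal property of the Day convolution, a map \<open>F \<and> G \<rightarrow> H\<close> is a family of pointed maps
  \<open>F(k\<^sub>+) \<and> G(l\<^sub>+) \<rightarrow> H(k\<^sub>+ \<and> l\<^sub>+)\<close> natural in \<open>k\<close> and \<open>l\<close>; the product of an algebra and the
  action on a module are given in this form, and the unit \<open>\<S> \<rightarrow> A\<close> as the maps
  \<open>k\<^sub>+ \<rightarrow> A(k\<^sub>+)\<close>.\<close>

record 'r s_alg = "'r gamma" +
  amult :: "nat \<Rightarrow> nat \<Rightarrow> 'r \<Rightarrow> 'r \<Rightarrow> 'r"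
  aunit :: "nat \<Rightarrow> nat \<Rightarrow> 'r"

record ('r, 'a) s_mod = "'a gamma" +
  lact :: "nat \<Rightarrow> nat \<Rightarrow> 'r \<Rightarrow> 'a \<Rightarrow> 'a"

definition gamma_set :: "('a, 'z) gamma_scheme \<Rightarrow> bool" where
  "gamma_set F \<longleftrightarrow>
     (\<forall>k. pt F k \<in> el F k) \<and> el F 0 = {pt F 0} \<and>
     (\<forall>k l. \<forall>f\<in>pmaps k l. mp F k l f \<in> el F k \<rightarrow> el F l \<and> mp F k l f (pt F k) = pt F l) \<and>
     (\<forall>k. \<forall>x\<in>el F k. mp F k k (pid k) x = x) \<and>
     (\<forall>k l m. \<forall>f\<in>pmaps k l. \<forall>g\<in>pmaps l m. \<forall>x\<in>el F k.
        mp F k m (pcomp k g f) x = mp F l m g (mp F k l f x))"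

definition bi_natural :: "('a, 'x) gamma_scheme \<Rightarrow> ('b, 'y) gamma_scheme \<Rightarrow> ('c, 'z) gamma_scheme \<Rightarrow>
    (nat \<Rightarrow> nat \<Rightarrow> 'a \<Rightarrow> 'b \<Rightarrow> 'c) \<Rightarrow> bool" where
  "bi_natural F G H \<mu> \<longleftrightarrow>
     (\<forall>k l. \<forall>s\<in>el F k. \<forall>t\<in>el G l. \<mu> k l s t \<in> el H (k * l)) \<and>
     (\<forall>k l. \<forall>s\<in>el F k. \<mu> k l s (pt G l) = pt H (k * l)) \<and>
     (\<forall>k l. \<forall>t\<in>el G l. \<mu> k l (pt F k) t = pt H (k * l)) \<and>
     (\<forall>k l k' l'. \<forall>f\<in>pmaps k k'. \<forall>g\<in>pmaps l l'. \<forall>s\<in>el F k. \<forall>t\<in>el G l.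
        \<mu> k' l' (mp F k k' f s) (mp G l l' g t) = mp H (k * l) (k' * l') (psmash k l l' f g) (\<mu> k l s t))"

definition s_algebra :: "('r, 'z) s_alg_scheme \<Rightarrow> bool" where
  "s_algebra A \<longleftrightarrow>
     gamma_set A \<and> bi_natural A A A (amult A) \<and>
     (\<forall>k l m. \<forall>a\<in>el A k. \<forall>b\<in>el A l. \<forall>c\<in>el A m.
        amult A (k * l) m (amult A k l a b) c = amult A k (l * m) a (amult A l m b c)) \<and>
     (\<forall>k. aunit A k \<in> {0..k} \<rightarrow> el A k \<and> aunit A k 0 = pt A k) \<and>
     (\<forall>k l. \<forall>f\<in>pmaps k l. \<forall>i\<le>k. aunit A l (f i) = mp A k l f (aunit A k i)) \<and>
     (\<forall>k. \<forall>a\<in>el A k. amult A 1 k (aunit A 1 1) a = a \<and> amult A k 1 a (aunit A 1 1) = a)"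

definition s_comm :: "('r, 'z) s_alg_scheme \<Rightarrow> bool" where
  "s_comm A \<longleftrightarrow> (\<forall>k l. \<forall>a\<in>el A k. \<forall>b\<in>el A l.
     mp A (k * l) (l * k) (pswap k l) (amult A k l a b) = amult A l k b a)"

definition s_module :: "('r, 'z) s_alg_scheme \<Rightarrow> ('r, 'a) s_mod \<Rightarrow> bool" where
  "s_module A M \<longleftrightarrow>
     gamma_set M \<and> bi_natural A M M (lact M) \<and>
     (\<forall>k l m. \<forall>a\<in>el A k. \<forall>b\<in>el A l. \<forall>x\<in>el M m.
        lact M (k * l) m (amult A k l a b) x = lact M k (l * m) a (lact M l m b x)) \<and>
     (\<forall>k. \<forall>x\<in>el M k. lact M 1 k (aunit A 1 1) x = x)"

text \<open>All algebras considered here are commutative, so that a left module is also a right module.\<close>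

definition ract :: "('r, 'a) s_mod \<Rightarrow> nat \<Rightarrow> nat \<Rightarrow> 'a \<Rightarrow> 'r \<Rightarrow> 'a" where
  "ract M k l x a = mp M (l * k) (k * l) (pswap l k) (lact M l k a x)"


section \<open>Smash products\<close>

definition gen_equiv :: "('a \<times> 'a) set \<Rightarrow> ('a \<times> 'a) set" where
  "gen_equiv r = (r \<union> r\<inverse>)\<^sup>*"

text \<open>The Day convolution \<open>(F \<and> G)(n\<^sub>+)\<close>, the colimit over \<open>v : k\<^sub>+ \<and> l\<^sub>+ \<rightarrow> n\<^sub>+\<close> of the pointed
  sets \<open>F(k\<^sub>+) \<and> G(l\<^sub>+)\<close>, is the set of classes of tuples \<open>(k, l, v, s, t)\<close>.\<close>

type_synonym ('a, 'b) day_rep = "nat \<times> nat \<times> (nat \<Rightarrow> nat) \<times> 'a \<times> 'b"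

definition day_reps :: "('a, 'x) gamma_scheme \<Rightarrow> ('b, 'y) gamma_scheme \<Rightarrow> nat \<Rightarrow> ('a, 'b) day_rep set" where
  "day_reps F G n = {(k, l, v, s, t). v \<in> pmaps (k * l) n \<and> s \<in> el F k \<and> t \<in> el G l}"

definition day_gen :: "('a, 'x) gamma_scheme \<Rightarrow> ('b, 'y) gamma_scheme \<Rightarrow> nat \<Rightarrow> ('a, 'b) day_rep rel" where
  "day_gen F G n =
     {((k, l, pcomp (k * l) v (psmash k l l' f g), s, t), (k', l', v, mp F k k' f s, mp G l l' g t))
        | k l k' l' v f g s t.
        f \<in> pmaps k k' \<and> g \<in> pmaps l l' \<and> v \<in> pmaps (k' * l') n \<and> s \<in> el F k \<and> t \<in> el G l} \<union>
     {((k, l, v, s, t), (k', l', v', s', t')) | k l v s t k' l' v' s' t'.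
        (k, l, v, s, t) \<in> day_reps F G n \<and> (s = pt F k \<or> t = pt G l) \<and>
        (k', l', v', s', t') \<in> day_reps F G n \<and> (s' = pt F k' \<or> t' = pt G l')}"

definition day_class :: "('a, 'x) gamma_scheme \<Rightarrow> ('b, 'y) gamma_scheme \<Rightarrow> nat \<Rightarrow>
    ('a, 'b) day_rep \<Rightarrow> ('a, 'b) day_rep set" where
  "day_class F G n r = gen_equiv (day_gen F G n) `` {r}"

definition smash :: "('a, 'x) gamma_scheme \<Rightarrow> ('b, 'y) gamma_scheme \<Rightarrow> ('a, 'b) day_rep set gamma" where
  "smash F G = \<lparr>
     el = (\<lambda>n. day_reps F G n // gen_equiv (day_gen F G n)),
     pt = (\<lambda>n. day_class F G n (0, 0, pid 0, pt F 0, pt G 0)),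
     mp = (\<lambda>n m f C. \<Union>(k, l, v, s, t)\<in>C. day_class F G m (k, l, pcomp (k * l) f v, s, t)) \<rparr>"

text \<open>The threefold Day convolution \<open>F \<and> G \<and> H\<close>.\<close>

type_synonym ('a, 'b, 'c) day3_rep = "nat \<times> nat \<times> nat \<times> (nat \<Rightarrow> nat) \<times> 'a \<times> 'b \<times> 'c"

definition day3_reps :: "('a, 'x) gamma_scheme \<Rightarrow> ('b, 'y) gamma_scheme \<Rightarrow> ('c, 'z) gamma_scheme \<Rightarrow>
    nat \<Rightarrow> ('a, 'b, 'c) day3_rep set" where
  "day3_reps F G H n = {(k, l, m, v, s, t, u).
     v \<in> pmaps (k * l * m) n \<and> s \<in> el F k \<and> t \<in> el G l \<and> u \<in> el H m}"

definition day3_gen :: "('a, 'x) gamma_scheme \<Rightarrow> ('b, 'y) gamma_scheme \<Rightarrow> ('c, 'z) gamma_scheme \<Rightarrow>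
    nat \<Rightarrow> ('a, 'b, 'c) day3_rep rel" where
  "day3_gen F G H n =
     {((k, l, m, pcomp (k * l * m) v (psmash (k * l) m m' (psmash k l l' f g) h), s, t, u),
       (k', l', m', v, mp F k k' f s, mp G l l' g t, mp H m m' h u))
        | k l m k' l' m' v f g h s t u.
        f \<in> pmaps k k' \<and> g \<in> pmaps l l' \<and> h \<in> pmaps m m' \<and> v \<in> pmaps (k' * l' * m') n \<and>
        s \<in> el F k \<and> t \<in> el G l \<and> u \<in> el H m} \<union>
     {((k, l, m, v, s, t, u), (k', l', m', v', s', t', u')) | k l m v s t u k' l' m' v' s' t' u'.
        (k, l, m, v, s, t, u) \<in> day3_reps F G H n \<and> (s = pt F k \<or> t = pt G l \<or> u = pt H m) \<and>
        (k', l', m', v', s', t', u') \<in> day3_reps F G H n \<and>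
        (s' = pt F k' \<or> t' = pt G l' \<or> u' = pt H m')}"

definition day3_class :: "('a, 'x) gamma_scheme \<Rightarrow> ('b, 'y) gamma_scheme \<Rightarrow> ('c, 'z) gamma_scheme \<Rightarrow>
    nat \<Rightarrow> ('a, 'b, 'c) day3_rep \<Rightarrow> ('a, 'b, 'c) day3_rep set" where
  "day3_class F G H n r = gen_equiv (day3_gen F G H n) `` {r}"

definition smash3 :: "('a, 'x) gamma_scheme \<Rightarrow> ('b, 'y) gamma_scheme \<Rightarrow> ('c, 'z) gamma_scheme \<Rightarrow>
    ('a, 'b, 'c) day3_rep set gamma" where
  "smash3 F G H = \<lparr>
     el = (\<lambda>n. day3_reps F G H n // gen_equiv (day3_gen F G H n)),
     pt = (\<lambda>n. day3_class F G H n (0, 0, 0, pid 0, pt F 0, pt G 0, pt H 0)),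
     mp = (\<lambda>n n' f C. \<Union>(k, l, m, v, s, t, u)\<in>C.
             day3_class F G H n' (k, l, m, pcomp (k * l * m) f v, s, t, u)) \<rparr>"

text \<open>The two action maps \<open>M \<and> A \<and> N \<rightarrow> M \<and> N\<close>. As everywhere below, a map on a quotient is written as
  a union over representatives, all of which yield the same class.\<close>

definition act_left :: "('r, 'z) s_alg_scheme \<Rightarrow> ('r, 'a) s_mod \<Rightarrow> ('r, 'b) s_mod \<Rightarrow>
    nat \<Rightarrow> ('a, 'r, 'b) day3_rep set \<Rightarrow> ('a, 'b) day_rep set" where
  "act_left A M N n C =
     (\<Union>(k, l, m, v, x, a, y)\<in>C. day_class M N n (k * l, m, v, ract M k l x a, y))"

definition act_right :: "('r, 'z) s_alg_scheme \<Rightarrow> ('r, 'a) s_mod \<Rightarrow> ('r, 'b) s_mod \<Rightarrow>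
    nat \<Rightarrow> ('a, 'r, 'b) day3_rep set \<Rightarrow> ('a, 'b) day_rep set" where
  "act_right A M N n C =
     (\<Union>(k, l, m, v, x, a, y)\<in>C. day_class M N n (k, l * m, v, x, lact N l m a y))"

definition coeq_rel :: "('p, 'x) gamma_scheme \<Rightarrow>
    (nat \<Rightarrow> 'p \<Rightarrow> 'q) \<Rightarrow> (nat \<Rightarrow> 'p \<Rightarrow> 'q) \<Rightarrow> nat \<Rightarrow> 'q rel" where
  "coeq_rel P \<alpha> \<beta> n = gen_equiv ((\<lambda>p. (\<alpha> n p, \<beta> n p)) ` el P n)"

definition coequalizer :: "('p, 'x) gamma_scheme \<Rightarrow> ('q, 'y) gamma_scheme \<Rightarrow>
    (nat \<Rightarrow> 'p \<Rightarrow> 'q) \<Rightarrow> (nat \<Rightarrow> 'p \<Rightarrow> 'q) \<Rightarrow> 'q set gamma" where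
  "coequalizer P Q \<alpha> \<beta> = \<lparr>
     el = (\<lambda>n. el Q n // coeq_rel P \<alpha> \<beta> n),
     pt = (\<lambda>n. coeq_rel P \<alpha> \<beta> n `` {pt Q n}),
     mp = (\<lambda>n m f C. \<Union>q\<in>C. coeq_rel P \<alpha> \<beta> m `` {mp Q n m f q}) \<rparr>"

type_synonym ('a, 'b) smash_el = "('a, 'b) day_rep set set"

definition smash_class :: "('r, 'z) s_alg_scheme \<Rightarrow> ('r, 'a) s_mod \<Rightarrow> ('r, 'b) s_mod \<Rightarrow>
    nat \<Rightarrow> ('a, 'b) day_rep \<Rightarrow> ('a, 'b) smash_el" where
  "smash_class A M N n r =
     coeq_rel (smash3 M A N) (act_left A M N) (act_right A M N) n `` {day_class M N n r}"

text \<open>\<open>M \<and>\<^sub>A N\<close> for a commutative \<open>A\<close>, as an \<open>A\<close>-module through the first factor.\<close>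

definition smash_over :: "('r, 'z) s_alg_scheme \<Rightarrow> ('r, 'a) s_mod \<Rightarrow> ('r, 'b) s_mod \<Rightarrow>
    ('r, ('a, 'b) smash_el) s_mod" where
  "smash_over A M N =
     gamma.extend (coequalizer (smash3 M A N) (smash M N) (act_left A M N) (act_right A M N))
       (s_mod.fields (\<lambda>j n a C. \<Union>B\<in>C. \<Union>(k, l, v, x, y)\<in>B.
          smash_class A M N (j * n)
            (j * k, l, psmash j (k * l) n (pid j) v, lact M j k a x, y)))"


section \<open>The space\<close>

text \<open>\<open>Pt p\<close> is the point \<open>(p)\<close> of \<open>Spec \<int>\<close>; in particular \<open>Pt 0\<close> is the generic point.\<close>

datatype place = Pt nat | Infty

definition prime_places :: "place set" where
  "prime_places = {Pt p | p. prime p}"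

definition SpecZ :: "place set" where
  "SpecZ = insert (Pt 0) prime_places"

definition SpecZ_bar :: "place set" where
  "SpecZ_bar = insert Infty SpecZ"

definition is_open :: "place set \<Rightarrow> bool" where
  "is_open U \<longleftrightarrow> U = {} \<or>
     (\<exists>P. finite P \<and> P \<subseteq> prime_places \<and> (U = SpecZ_bar - P \<or> U = SpecZ_bar - P - {Infty}))"


section \<open>Sheaves of modules\<close>

text \<open>\<open>ares \<O> U V\<close> and \<open>mres M U V\<close> are the restrictions from \<open>U\<close> to \<open>V \<subseteq> U\<close>.\<close>

record 'r alg_presheaf =
  aval :: "place set \<Rightarrow> 'r s_alg"
  ares :: "place set \<Rightarrow> place set \<Rightarrow> nat \<Rightarrow> 'r \<Rightarrow> 'r"

record ('r, 'a) mod_presheaf =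
  mval :: "place set \<Rightarrow> ('r, 'a) s_mod"
  mres :: "place set \<Rightarrow> place set \<Rightarrow> nat \<Rightarrow> 'a \<Rightarrow> 'a"

definition smash_presheaf :: "'r alg_presheaf \<Rightarrow> ('r, 'a) mod_presheaf \<Rightarrow> ('r, 'b) mod_presheaf \<Rightarrow>
    ('r, ('a, 'b) smash_el) mod_presheaf" where
  "smash_presheaf \<O> M N = \<lparr>
     mval = (\<lambda>U. smash_over (aval \<O> U) (mval M U) (mval N U)),
     mres = (\<lambda>U V n C. \<Union>B\<in>C. \<Union>(k, l, v, x, y)\<in>B.
        smash_class (aval \<O> V) (mval M V) (mval N V) n (k, l, v, mres M U V k x, mres N U V l y)) \<rparr>"

text \<open>The associated sheaf is formed levelwise: a section over \<open>U\<close> at level \<open>n\<^sub>+\<close> is a family of germs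
  at the points of \<open>U\<close> which is locally induced by sections of the presheaf.\<close>

type_synonym 'a germ = "(place set \<times> 'a) set"

definition germ :: "('r, 'a) mod_presheaf \<Rightarrow> place \<Rightarrow> nat \<Rightarrow> place set \<Rightarrow> 'a \<Rightarrow> 'a germ" where
  "germ F x n U s = {(V, t). is_open V \<and> x \<in> V \<and> t \<in> el (mval F V) n \<and>
     (\<exists>W. is_open W \<and> x \<in> W \<and> W \<subseteq> U \<inter> V \<and> mres F U W n s = mres F V W n t)}"

definition sheafify :: "'r alg_presheaf \<Rightarrow> ('r, 'a) mod_presheaf \<Rightarrow>
    ('r, place \<Rightarrow> 'a germ) mod_presheaf" where
  "sheafify \<O> F = \<lparr>
     mval = (\<lambda>U. \<lparr>
       el = (\<lambda>n. {\<sigma> \<in> extensional U. \<forall>x\<in>U. \<exists>V s. is_open V \<and> x \<in> V \<and> V \<subseteq> U \<and>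
               s \<in> el (mval F V) n \<and> (\<forall>y\<in>V. \<sigma> y = germ F y n V s)}),
       pt = (\<lambda>n. \<lambda>x\<in>U. germ F x n U (pt (mval F U) n)),
       mp = (\<lambda>n m f \<sigma>. \<lambda>x\<in>U. \<Union>(V, s)\<in>\<sigma> x. germ F x m V (mp (mval F V) n m f s)),
       lact = (\<lambda>k n a \<sigma>. \<lambda>x\<in>U. \<Union>(V, s)\<in>\<sigma> x.
               germ F x (k * n) (U \<inter> V)
                 (lact (mval F (U \<inter> V)) k n (ares \<O> U (U \<inter> V) k a) (mres F V (U \<inter> V) n s))) \<rparr>),
     mres = (\<lambda>U V n \<sigma>. restrict \<sigma> V) \<rparr>"

definition smash_sheaf :: "'r alg_presheaf \<Rightarrow> ('r, 'a) mod_presheaf \<Rightarrow> ('r, 'b) mod_presheaf \<Rightarrow>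
    ('r, place \<Rightarrow> ('a, 'b) smash_el germ) mod_presheaf" where
  "smash_sheaf \<O> M N = sheafify \<O> (smash_presheaf \<O> M N)"

definition iso_modules :: "'r alg_presheaf \<Rightarrow> ('r, 'a) mod_presheaf \<Rightarrow> ('r, 'b) mod_presheaf \<Rightarrow> bool" where
  "iso_modules \<O> M N \<longleftrightarrow> (\<exists>\<phi> :: place set \<Rightarrow> nat \<Rightarrow> 'a \<Rightarrow> 'b. \<forall>U. is_open U \<longrightarrow>
     (\<forall>n. bij_betw (\<phi> U n) (el (mval M U) n) (el (mval N U) n) \<and>
          \<phi> U n (pt (mval M U) n) = pt (mval N U) n) \<and>
     (\<forall>n m. \<forall>f\<in>pmaps n m. \<forall>x\<in>el (mval M U) n.
          \<phi> U m (mp (mval M U) n m f x) = mp (mval N U) n m f (\<phi> U n x)) \<and>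
     (\<forall>k n. \<forall>a\<in>el (aval \<O> U) k. \<forall>x\<in>el (mval M U) n.
          \<phi> U (k * n) (lact (mval M U) k n a x) = lact (mval N U) k n a (\<phi> U n x)) \<and>
     (\<forall>V n. is_open V \<and> V \<subseteq> U \<longrightarrow> (\<forall>x\<in>el (mval M U) n.
          \<phi> V n (mres M U V n x) = mres N U V n (\<phi> U n x))))"


section \<open>The functor H and its normed variants\<close>

text \<open>A function from \<open>k\<^sub>+ - {0}\<close> to \<open>E\<close> is extended by \<open>0\<close> to a function on \<open>nat\<close>.\<close>

definition H_el :: "'a::semiring_1 set \<Rightarrow> nat \<Rightarrow> (nat \<Rightarrow> 'a) set" where
  "H_el E k = {\<phi>. (\<forall>x\<in>{1..k}. \<phi> x \<in> E) \<and> (\<forall>x. x \<notin> {1..k} \<longrightarrow> \<phi> x = 0)}"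

definition H_map :: "nat \<Rightarrow> nat \<Rightarrow> (nat \<Rightarrow> nat) \<Rightarrow> (nat \<Rightarrow> 'a::semiring_1) \<Rightarrow> nat \<Rightarrow> 'a" where
  "H_map k l f \<phi> = (\<lambda>y. if y \<in> {1..l} then \<Sum>x\<in>{x \<in> {1..k}. f x = y}. \<phi> x else 0)"

definition H_mult :: "nat \<Rightarrow> nat \<Rightarrow> (nat \<Rightarrow> 'a::semiring_1) \<Rightarrow> (nat \<Rightarrow> 'a) \<Rightarrow> nat \<Rightarrow> 'a" where
  "H_mult k l \<phi> \<psi> = (\<lambda>z. if z \<in> {1..k * l} then \<phi> (sm_fst l z) * \<psi> (sm_snd l z) else 0)"

definition H_unit :: "nat \<Rightarrow> nat \<Rightarrow> nat \<Rightarrow> 'a::semiring_1" where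
  "H_unit k x = (\<lambda>y. if y \<in> {1..k} \<and> y = x then 1 else 0)"

definition l1_norm :: "nat \<Rightarrow> (nat \<Rightarrow> rat) \<Rightarrow> real" where
  "l1_norm k \<phi> = (\<Sum>x\<in>{1..k}. \<bar>of_rat (\<phi> x)\<bar>)"

definition H_le :: "rat set \<Rightarrow> real \<Rightarrow> nat \<Rightarrow> (nat \<Rightarrow> rat) set" where
  "H_le E r k = {\<phi> \<in> H_el E k. l1_norm k \<phi> \<le> r}"

definition H_less :: "rat set \<Rightarrow> real \<Rightarrow> nat \<Rightarrow> (nat \<Rightarrow> rat) set" where
  "H_less E r k = {\<phi> \<in> H_el E k. l1_norm k \<phi> < r}"

text \<open>The algebra, resp. module, structure induced on a family \<open>S\<close> of subsets of the powers.\<close>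

definition H_alg :: "(nat \<Rightarrow> (nat \<Rightarrow> 'a::semiring_1) set) \<Rightarrow> (nat \<Rightarrow> 'a) s_alg" where
  "H_alg S = \<lparr> el = S, pt = (\<lambda>_ _. 0), mp = H_map, amult = H_mult, aunit = H_unit \<rparr>"

definition H_mod :: "(nat \<Rightarrow> (nat \<Rightarrow> 'a::semiring_1) set) \<Rightarrow> (nat \<Rightarrow> 'a, nat \<Rightarrow> 'a) s_mod" where
  "H_mod S = \<lparr> el = S, pt = (\<lambda>_ _. 0), mp = H_map, lact = H_mult \<rparr>"


section \<open>Arakelov divisors and their sheaves\<close>

text \<open>\<open>vp p q\<close> is the \<open>p\<close>-adic valuation of a non-zero rational \<open>q\<close>.\<close>

definition vp :: "nat \<Rightarrow> rat \<Rightarrow> int" where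
  "vp p q = (case quotient_of q of (a, b) \<Rightarrow>
     int (multiplicity (int p) a) - int (multiplicity (int p) b))"

text \<open>\<open>(n, a)\<close> stands for the divisor with finite part \<open>\<Sum>\<^sub>p n p {p}\<close> and infinite part \<open>a {\<infinity>}\<close>; the
  function \<open>n\<close> vanishes off the primes, so that equality of divisors is equality of pairs.\<close>

type_synonym arakelov = "(nat \<Rightarrow> int) \<times> real"

definition arakelov_divisor :: "arakelov \<Rightarrow> bool" where
  "arakelov_divisor D \<longleftrightarrow> finite {p. fst D p \<noteq> 0} \<and> (\<forall>p. fst D p \<noteq> 0 \<longrightarrow> prime p)"

definition div_add :: "arakelov \<Rightarrow> arakelov \<Rightarrow> arakelov" where
  "div_add D D' = (\<lambda>p. fst D p + fst D' p, snd D + snd D')"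

definition principal :: "rat \<Rightarrow> arakelov" where
  "principal q = (\<lambda>p. if prime p then vp p q else 0, - ln \<bar>of_rat q\<bar>)"

definition div_equiv :: "arakelov \<Rightarrow> arakelov \<Rightarrow> bool" where
  "div_equiv D D' \<longleftrightarrow> (\<exists>q. q \<noteq> 0 \<and> D = div_add D' (principal q))"

text \<open>Sections over a non-empty open subset \<open>V\<close> of \<open>Spec \<int>\<close>; for \<open>\<O>\<close> these are the fractions whose
  denominator is prime to all \<open>p\<close> in \<open>V\<close>.\<close>

definition O_SpecZ :: "place set \<Rightarrow> rat set" where
  "O_SpecZ V = {q. \<forall>p. prime p \<and> Pt p \<in> V \<longrightarrow> \<not> int p dvd snd (quotient_of q)}"

definition O_fin :: "(nat \<Rightarrow> int) \<Rightarrow> place set \<Rightarrow> rat set" where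
  "O_fin n V = {q. q = 0 \<or> (\<forall>p. prime p \<and> Pt p \<in> V \<longrightarrow> vp p q + n p \<ge> 0)}"

text \<open>\<open>HQ_subalg S\<close> and \<open>HQ_submod S\<close> are the subsheaves of the constant sheaf \<open>H\<rat>\<close> with sections
  \<open>S U\<close> over non-empty \<open>U\<close>; over the empty set they take the one-point value.\<close>

definition HQ_res :: "place set \<Rightarrow> place set \<Rightarrow> nat \<Rightarrow> (nat \<Rightarrow> rat) \<Rightarrow> nat \<Rightarrow> rat" where
  "HQ_res U V k \<phi> = (if V = {} then (\<lambda>_. 0) else \<phi>)"

definition HQ_subalg :: "(place set \<Rightarrow> nat \<Rightarrow> (nat \<Rightarrow> rat) set) \<Rightarrow> (nat \<Rightarrow> rat) alg_presheaf" where
  "HQ_subalg S = \<lparr>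
     aval = (\<lambda>U. if U = {} then H_alg (\<lambda>_. {\<lambda>_. 0})\<lparr>aunit := \<lambda>_ _ _. 0\<rparr> else H_alg (S U)),
     ares = HQ_res \<rparr>"

definition HQ_submod :: "(place set \<Rightarrow> nat \<Rightarrow> (nat \<Rightarrow> rat) set) \<Rightarrow>
    (nat \<Rightarrow> rat, nat \<Rightarrow> rat) mod_presheaf" where
  "HQ_submod S = \<lparr>
     mval = (\<lambda>U. if U = {} then H_mod (\<lambda>_. {\<lambda>_. 0}) else H_mod (S U)),
     mres = HQ_res \<rparr>"

definition O_bar :: "(nat \<Rightarrow> rat) alg_presheaf" where
  "O_bar = HQ_subalg (\<lambda>U. if Infty \<in> U then H_le (O_SpecZ (U \<inter> SpecZ)) 1 else H_el (O_SpecZ U))"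

definition O_div :: "arakelov \<Rightarrow> (nat \<Rightarrow> rat, nat \<Rightarrow> rat) mod_presheaf" where
  "O_div D = HQ_submod (\<lambda>U. if Infty \<in> U then H_le (O_fin (fst D) (U \<inter> SpecZ)) (exp (snd D))
                            else H_el (O_fin (fst D) U))"

definition O_eps :: "(nat \<Rightarrow> rat, nat \<Rightarrow> rat) mod_presheaf" where
  "O_eps = HQ_submod (\<lambda>U. if Infty \<in> U then H_less (O_SpecZ (U \<inter> SpecZ)) 1 else H_el (O_SpecZ U))"


section \<open>The axioms for the functor H\<close>

text \<open>The structures above satisfy the axioms of (commutative) algebras and of modules, for a
  semiring \<open>R\<close> of rationals and an \<open>R\<close>-module \<open>E\<close> of rationals; see \<open>s_module_H_el\<close>,
  \<open>s_algebra_H_le\<close>, \<open>s_module_H_le\<close>, \<open>s_module_H_less\<close> and \<open>s_comm_H_alg\<close> at the end.\<close>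

lemma pmaps_zero: "f \<in> pmaps k l \<Longrightarrow> f 0 = 0" by (auto simp: pmaps_def)
lemma pmaps_le: "f \<in> pmaps k l \<Longrightarrow> x \<le> k \<Longrightarrow> f x \<le> l" by (auto simp: pmaps_def)

lemma H_map_el:
  assumes "0 \<in> E" "\<And>x y. x \<in> E \<Longrightarrow> y \<in> E \<Longrightarrow> x + y \<in> E" "\<phi> \<in> H_el E k"
  shows "H_map k l f \<phi> \<in> H_el E l"
proof -
  have 0: "sum \<phi> A \<in> E" if "A \<subseteq> {1..k}" for A
    using finite_subset[OF that finite_atLeastAtMost] that
  proof (induction A)
    case empty then show ?case using assms by simp
  next
    case (insert x A)
    then have "\<phi> x \<in> E" using assms(3) by (auto simp: H_el_def)
    then show ?case using insert assms by auto
  qed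
  have 1: "sum \<phi> {x \<in> {1..k}. f x = y} \<in> E" for y by (rule 0) auto
  show ?thesis unfolding H_el_def H_map_def using 1 by simp
qed

lemma H_map_id: "\<phi> \<in> H_el E k \<Longrightarrow> H_map k k (pid k) \<phi> = \<phi>"
proof
  fix y assume a: "\<phi> \<in> H_el E k"
  have "{x \<in> {1..k}. pid k x = y} = (if y \<in> {1..k} then {y} else {})" by (auto simp: pid_def)
  then show "H_map k k (pid k) \<phi> y = \<phi> y" using a by (auto simp: H_map_def H_el_def)
qed

lemma H_map_comp:
  assumes f: "f \<in> pmaps k l" and g: "g \<in> pmaps l m"
  shows "H_map k m (pcomp k g f) \<phi> = H_map l m g (H_map k l f \<phi>)"
proof
  fix z
  show "H_map k m (pcomp k g f) \<phi> z = H_map l m g (H_map k l f \<phi>) z"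
  proof (cases "z \<in> {1..m}")
    case True
    let ?S = "{x \<in> {1..k}. g (f x) = z}" and ?T = "{y \<in> {1..l}. g y = z}"
    have "f ` ?S \<subseteq> ?T"
    proof
      fix y assume "y \<in> f ` ?S"
      then obtain x where x: "x \<in> ?S" "y = f x" by auto
      have "y = 0 \<Longrightarrow> z = 0" using x pmaps_zero[OF g] by simp
      then have "y \<noteq> 0" using True by force
      then show "y \<in> ?T" using x pmaps_le[OF f] by auto
    qed
    from sum.group[OF _ _ this, of \<phi>]
    have "sum \<phi> ?S = (\<Sum>y\<in>?T. \<Sum>x\<in>{x \<in> ?S. f x = y}. \<phi> x)" by simp
    also have "\<dots> = (\<Sum>y\<in>?T. \<Sum>x\<in>{x \<in> {1..k}. f x = y}. \<phi> x)"
      by (intro sum.cong) auto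
    finally have 1: "sum \<phi> ?S = (\<Sum>y\<in>?T. \<Sum>x\<in>{x \<in> {1..k}. f x = y}. \<phi> x)" .
    have 2: "{x \<in> {1..k}. pcomp k g f x = z} = ?S" by (auto simp: pcomp_def compose_def)
    have 3: "(\<Sum>y\<in>?T. H_map k l f \<phi> y) = (\<Sum>y\<in>?T. \<Sum>x\<in>{x \<in> {1..k}. f x = y}. \<phi> x)"
      by (intro sum.cong) (auto simp: H_map_def)
    show ?thesis using True unfolding H_map_def[of k m] H_map_def[of l m] 2 1 3 by simp
  next
    case False
    then show ?thesis unfolding H_map_def by presburger
  qed
qed

lemma sm_pairE:
  assumes "w \<in> {1..k*l}"
  obtains x y where "x \<in> {1..k}" "y \<in> {1..l}" "w = sm_pair l x y"
proof
  have w: "1 \<le> w" "w \<le> k * l" using assms by simp_all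
  show "w = sm_pair l (sm_fst l w) (sm_snd l w)" using sm_pair_fst_snd[OF w(2)] by simp
  show "sm_fst l w \<in> {1..k}" using sm_fst_le[OF w(2)] w(1) by (simp add: sm_fst_def)
  show "sm_snd l w \<in> {1..l}" using sm_snd_le[OF w(2)] w(1) by (simp add: sm_snd_def)
qed

lemma sm_pair_in: "x \<in> {1..k} \<Longrightarrow> y \<in> {1..l} \<Longrightarrow> sm_pair l x y \<in> {1..k*l}"
  using sm_pair_le[of x k y l] by (simp add: sm_pair_def)

lemma bij_sm_pair: "bij_betw (\<lambda>(i,j). sm_pair l i j) ({1..k} \<times> {1..l}) {1..k*l}"
proof (rule bij_betw_byWitness[where f' = "\<lambda>z. (sm_fst l z, sm_snd l z)"])
  show "\<forall>a\<in>{1..k} \<times> {1..l}. (\<lambda>z. (sm_fst l z, sm_snd l z)) ((\<lambda>(i, j). sm_pair l i j) a) = a"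
    by (auto simp: sm_fst_pair sm_snd_pair)
  show "\<forall>a'\<in>{1..k * l}. (\<lambda>(i, j). sm_pair l i j) (sm_fst l a', sm_snd l a') = a'"
    by (auto intro: sm_pair_fst_snd)
  show "(\<lambda>(i, j). sm_pair l i j) ` ({1..k} \<times> {1..l}) \<subseteq> {1..k * l}"
    using sm_pair_in by fast
  show "(\<lambda>z. (sm_fst l z, sm_snd l z)) ` {1..k * l} \<subseteq> {1..k} \<times> {1..l}"
  proof
    fix p assume "p \<in> (\<lambda>z. (sm_fst l z, sm_snd l z)) ` {1..k * l}"
    then obtain z where "z \<in> {1..k*l}" "p = (sm_fst l z, sm_snd l z)" by blast
    then show "p \<in> {1..k} \<times> {1..l}"
      by (elim sm_pairE) (simp add: sm_fst_pair sm_snd_pair)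
  qed
qed

lemma H_mult_natural:
  assumes f: "f \<in> pmaps k k'" and g: "g \<in> pmaps l l'"
  shows "H_mult k' l' (H_map k k' f \<phi>) (H_map l l' g \<psi>) =
         H_map (k*l) (k'*l') (psmash k l l' f g) (H_mult k l \<phi> (\<psi> :: nat \<Rightarrow> 'a::semiring_1))"
proof
  fix z
  show "H_mult k' l' (H_map k k' f \<phi>) (H_map l l' g \<psi>) z =
         H_map (k*l) (k'*l') (psmash k l l' f g) (H_mult k l \<phi> \<psi>) z"
  proof (cases "z \<in> {1..k'*l'}")
    case True
    define i j where "i = sm_fst l' z" and "j = sm_snd l' z"
    have ij: "i \<in> {1..k'}" "j \<in> {1..l'}" "z = sm_pair l' i j"
      using True sm_fst_le[of z k' l'] sm_snd_le[of z k' l'] sm_pair_fst_snd[of z k' l']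
      by (auto simp: i_def j_def) (auto simp: sm_fst_def sm_snd_def)
    let ?A = "{x \<in> {1..k}. f x = i}" and ?B = "{y \<in> {1..l}. g y = j}"
    let ?C = "{w \<in> {1..k*l}. psmash k l l' f g w = z}"
    have eq: "psmash k l l' f g (sm_pair l x y) = sm_pair l' (f x) (g y)"
      if "x \<in> {1..k}" "y \<in> {1..l}" for x y
      using that sm_pair_le[of x k y l] by (simp add: psmash_def sm_fst_pair sm_snd_pair)
    have eq2: "sm_pair l' (f x) (g y) = z \<longleftrightarrow> f x = i \<and> g y = j" 
      if "x \<in> {1..k}" "y \<in> {1..l}" for x y
    proof
      assume a: "sm_pair l' (f x) (g y) = z"
      have "f x = 0 \<or> g y = 0 \<Longrightarrow> z = 0" using a unfolding sm_pair_def by simp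
      then have "f x \<noteq> 0" "g y \<noteq> 0" using True by force+
      then show "f x = i \<and> g y = j" using a pmaps_le[OF g, of y] that
        by (auto simp: i_def j_def sm_fst_pair sm_snd_pair)
    qed (simp add: ij)
    have "bij_betw (\<lambda>(i,j). sm_pair l i j) (?A \<times> ?B) ?C"
    proof (rule bij_betw_subset[OF bij_sm_pair[of l k]])
      show "?A \<times> ?B \<subseteq> {1..k} \<times> {1..l}" by auto
      have "w \<in> (\<lambda>(i, j). sm_pair l i j) ` (?A \<times> ?B)" if "w \<in> ?C" for w
      proof -
        have "w \<in> {1..k*l}" using that by blast
        from sm_pairE[OF this] obtain x y where "x \<in> {1..k}" "y \<in> {1..l}" "w = sm_pair l x y" .
        then show ?thesis using that eq eq2 by auto
      qed
      moreover have "sm_pair l x y \<in> ?C" if "x \<in> ?A" "y \<in> ?B" for x y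
      proof -
        have "sm_pair l x y \<in> {1..k*l}" using sm_pair_in[of x k y l] that by simp
        then show ?thesis using eq eq2 that by auto
      qed
      ultimately show "(\<lambda>(i, j). sm_pair l i j) ` (?A \<times> ?B) = ?C" by auto
    qed
    then have "(\<Sum>w\<in>?C. H_mult k l \<phi> \<psi> w) = (\<Sum>(x,y)\<in>?A \<times> ?B. H_mult k l \<phi> \<psi> (sm_pair l x y))"
      by (subst sum.reindex_bij_betw[symmetric], assumption) (simp add: case_prod_beta)
    also have "\<dots> = (\<Sum>(x,y)\<in>?A \<times> ?B. \<phi> x * \<psi> y)"
    proof (intro sum.cong refl, clarify)
      fix x y assume "x \<in> {1..k}" "y \<in> {1..l}"
      moreover then have "sm_pair l x y \<in> {1..k*l}" using sm_pair_in[of x k y l] by simp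
      ultimately show "H_mult k l \<phi> \<psi> (sm_pair l x y) = \<phi> x * \<psi> y"
        by (auto simp: H_mult_def sm_fst_pair sm_snd_pair)
    qed
    also have "\<dots> = sum \<phi> ?A * sum \<psi> ?B" by (simp add: sum_product sum.cartesian_product)
    finally have 1: "(\<Sum>w\<in>?C. H_mult k l \<phi> \<psi> w) = sum \<phi> ?A * sum \<psi> ?B" .
    have 2: "H_map k k' f \<phi> i = sum \<phi> ?A" "H_map l l' g \<psi> j = sum \<psi> ?B"
      using ij(1,2) by (simp_all only: H_map_def if_True)
    have "H_mult k' l' (H_map k k' f \<phi>) (H_map l l' g \<psi>) z = H_map k k' f \<phi> i * H_map l l' g \<psi> j"
      using True by (simp only: H_mult_def if_True i_def j_def)
    moreover have "H_map (k*l) (k'*l') (psmash k l l' f g) (H_mult k l \<phi> \<psi>) z = (\<Sum>w\<in>?C. H_mult k l \<phi> \<psi> w)"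
      using True by (simp only: H_map_def if_True)
    ultimately show ?thesis using 1 2 by simp
  next
    case False then show ?thesis by (simp only: H_mult_def[of k' l'] H_map_def[of "k*l" "k'*l'"] if_False)
  qed
qed

lemma H_mult_assoc:
  "H_mult (k*l) m (H_mult k l a b) c = H_mult k (l*m) a (H_mult l m b (c::nat \<Rightarrow> 'a::semiring_1))"
proof
  fix z
  show "H_mult (k*l) m (H_mult k l a b) c z = H_mult k (l*m) a (H_mult l m b c) z"
  proof (cases "z \<in> {1..k*l*m}")
    case True
    obtain w h where w: "w \<in> {1..k*l}" "h \<in> {1..m}" "z = sm_pair m w h"
      using sm_pairE[OF True] .
    obtain i j where i: "i \<in> {1..k}" "j \<in> {1..l}" "w = sm_pair l i j"
      using sm_pairE[OF w(1)] .
    have v: "sm_pair m j h \<in> {1..l*m}" using sm_pair_in[of j l h m] i w by simp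
    have z: "z = sm_pair (l*m) i (sm_pair m j h)" using w i by (simp add: sm_pair_assoc)
    have "H_mult (k*l) m (H_mult k l a b) c z = a i * b j * c h" using True w i
      by (auto simp: H_mult_def sm_fst_pair sm_snd_pair)
    moreover have "H_mult k (l*m) a (H_mult l m b c) z = a i * (b j * c h)" 
    proof -
      have "sm_fst (l*m) z = i" "sm_snd (l*m) z = sm_pair m j h"
        using v i unfolding z by (simp_all add: sm_fst_pair sm_snd_pair)
      then show ?thesis using True v w i by (simp add: H_mult_def sm_fst_pair sm_snd_pair mult.assoc)
    qed
    ultimately show ?thesis by (simp add: mult.assoc)
  next
    case False
    then have "z \<notin> {1..k*(l*m)}" by (simp add: mult.assoc)
    with False show ?thesis by (simp only: H_mult_def[of "k*l"] H_mult_def[of k "l*m"] if_False)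
  qed
qed

lemma l1_norm_map: "f \<in> pmaps k l \<Longrightarrow> l1_norm l (H_map k l f \<phi>) \<le> l1_norm k \<phi>"
proof -
  assume f: "f \<in> pmaps k l"
  have "l1_norm l (H_map k l f \<phi>) \<le> (\<Sum>y\<in>{1..l}. \<Sum>x\<in>{x \<in> {1..k}. f x = y}. \<bar>of_rat (\<phi> x)\<bar>)"
    by (auto simp: l1_norm_def H_map_def of_rat_sum intro!: sum_mono order.trans[OF sum_abs])
  also have "\<dots> = (\<Sum>y\<in>{1..l}. \<Sum>x\<in>{x \<in> {x\<in>{1..k}. f x \<noteq> 0}. f x = y}. \<bar>of_rat (\<phi> x)\<bar>)"
    by (intro sum.cong) auto
  also have "\<dots> = (\<Sum>x\<in>{x\<in>{1..k}. f x \<noteq> 0}. \<bar>of_rat (\<phi> x)\<bar>)"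
    using pmaps_le[OF f] by (intro sum.group) (auto simp: Suc_le_eq)
  also have "\<dots> \<le> l1_norm k \<phi>" unfolding l1_norm_def by (intro sum_mono2) auto
  finally show ?thesis .
qed

lemma l1_norm_mult: "l1_norm (k*l) (H_mult k l \<phi> \<psi>) = l1_norm k \<phi> * l1_norm l \<psi>"
proof -
  have "l1_norm (k*l) (H_mult k l \<phi> \<psi>) = (\<Sum>w\<in>{1..k*l}. \<bar>of_rat (\<phi> (sm_fst l w))\<bar> * \<bar>of_rat (\<psi> (sm_snd l w))\<bar>)"
    by (auto simp: l1_norm_def H_mult_def of_rat_mult abs_mult)
  also have "\<dots> = (\<Sum>(x,y)\<in>{1..k} \<times> {1..l}. \<bar>of_rat (\<phi> x)\<bar> * \<bar>of_rat (\<psi> y)\<bar>)"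
    by (subst sum.reindex_bij_betw[OF bij_sm_pair[of l k], symmetric])
       (auto intro!: sum.cong simp: sm_fst_pair sm_snd_pair)
  finally show ?thesis by (simp add: l1_norm_def sum_product sum.cartesian_product)
qed

lemma gamma_set_H:
  assumes S0: "\<And>k. (\<lambda>_. 0) \<in> S k" "S 0 = {\<lambda>_. 0}"
    and Sel: "\<And>k. S k \<subseteq> H_el UNIV k"
    and Sm: "\<And>k l f \<phi>. f \<in> pmaps k l \<Longrightarrow> \<phi> \<in> S k \<Longrightarrow> H_map k l f \<phi> \<in> S l"
  shows "gamma_set \<lparr>el = S, pt = \<lambda>_ _. 0, mp = H_map, \<dots> = (z::'z)\<rparr>"
proof -
  have 1: "H_map k k (pid k) x = x" if "x \<in> S k" for k x using H_map_id[of x UNIV k] Sel that by blast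
  have 2: "H_map k l f (\<lambda>_. 0) = (\<lambda>_. 0)" for k l f by (auto simp: H_map_def)
  show ?thesis unfolding gamma_set_def using S0 Sm 1 2 by (auto simp: H_map_comp)
qed

lemma bi_natural_H:
  fixes F :: "(nat \<Rightarrow> 'a::semiring_1, 'x) gamma_scheme" and G :: "(nat \<Rightarrow> 'a, 'y) gamma_scheme"
  assumes "pt F = (\<lambda>_ _. 0)" "mp F = H_map" "pt G = (\<lambda>_ _. 0)" "mp G = H_map"
    and "\<And>k l a b. a \<in> el F k \<Longrightarrow> b \<in> el G l \<Longrightarrow> H_mult k l a b \<in> el G (k * l)"
  shows "bi_natural F G G H_mult"
proof -
  have "H_mult k l s (\<lambda>_. 0) = (\<lambda>_. 0)" "H_mult k l (\<lambda>_. 0) s = (\<lambda>_. 0)" for k l and s :: "nat \<Rightarrow> 'a"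
    by (auto simp: H_mult_def)
  then show ?thesis unfolding bi_natural_def using assms by (simp add: H_mult_natural)
qed

lemma H_unit_left: "\<phi> \<in> H_el UNIV k \<Longrightarrow> H_mult 1 k (H_unit 1 1) \<phi> = \<phi>"
proof
  fix z assume a: "\<phi> \<in> H_el UNIV k"
  have "z \<in> {1..k} \<Longrightarrow> sm_fst k z = 1 \<and> sm_snd k z = z"
  proof -
    assume z: "z \<in> {1..k}"
    then have "z = sm_pair k 1 z" by (simp add: sm_pair_def)
    then show ?thesis using sm_fst_pair[of 1 z k] sm_snd_pair[of 1 z k] z by simp
  qed
  then show "H_mult 1 k (H_unit 1 1) \<phi> z = \<phi> z" using a by (auto simp: H_mult_def H_unit_def H_el_def)
qed

lemma H_unit_right: "\<phi> \<in> H_el UNIV k \<Longrightarrow> H_mult k 1 \<phi> (H_unit 1 1) = \<phi>"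
proof
  fix z assume a: "\<phi> \<in> H_el UNIV k"
  have "z \<in> {1..k} \<Longrightarrow> sm_fst 1 z = z \<and> sm_snd 1 z = 1" by (simp add: sm_fst_def sm_snd_def)
  then show "H_mult k 1 \<phi> (H_unit 1 1) z = \<phi> z" using a by (auto simp: H_mult_def H_unit_def H_el_def)
qed

lemma s_module_H:
  assumes S0: "\<And>k. (\<lambda>_. 0) \<in> S k" "S 0 = {\<lambda>_. 0}"
    and Sel: "\<And>k. S k \<subseteq> H_el UNIV k"
    and Sm: "\<And>k l f \<phi>. f \<in> pmaps k l \<Longrightarrow> \<phi> \<in> S k \<Longrightarrow> H_map k l f \<phi> \<in> S l"
    and SS: "\<And>k l a b. a \<in> R k \<Longrightarrow> b \<in> S l \<Longrightarrow> H_mult k l a b \<in> S (k * l)"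
  shows "s_module (H_alg R) (H_mod S)"
  unfolding s_module_def
proof (intro conjI)
  show "gamma_set (H_mod S)" unfolding H_mod_def by (rule gamma_set_H; fact)
  show "bi_natural (H_alg R) (H_mod S) (H_mod S) (lact (H_mod S))"
    using bi_natural_H[of "H_alg R" "H_mod S"] SS by (simp add: H_alg_def H_mod_def)
qed (use H_unit_left[OF subsetD[OF Sel]] in \<open>auto simp: H_mult_assoc H_alg_def H_mod_def simp del: One_nat_def\<close>)

lemma s_algebra_H:
  fixes S :: "nat \<Rightarrow> (nat \<Rightarrow> 'a::semiring_1) set"
  assumes S0: "\<And>k. (\<lambda>_. 0) \<in> S k" "S 0 = {\<lambda>_. 0}"
    and Sel: "\<And>k. S k \<subseteq> H_el UNIV k"
    and Sm: "\<And>k l f \<phi>. f \<in> pmaps k l \<Longrightarrow> \<phi> \<in> S k \<Longrightarrow> H_map k l f \<phi> \<in> S l"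
    and SS: "\<And>k l a b. a \<in> S k \<Longrightarrow> b \<in> S l \<Longrightarrow> H_mult k l a b \<in> S (k * l)"
    and Su: "\<And>k i. i \<le> k \<Longrightarrow> H_unit k i \<in> S k"
  shows "s_algebra (H_alg S)"
  unfolding s_algebra_def
proof (intro conjI)
  show "gamma_set (H_alg S)" unfolding H_alg_def by (rule gamma_set_H; fact)
  show "bi_natural (H_alg S) (H_alg S) (H_alg S) (amult (H_alg S))"
    using bi_natural_H[of "H_alg S" "H_alg S"] SS by (simp add: H_alg_def)
  have "(H_unit l (f i) :: nat \<Rightarrow> 'a) = H_map k l f (H_unit k i)" if f: "f \<in> pmaps k l" "i \<le> k" for k l f i
  proof
    fix y
    show "(H_unit l (f i) y :: 'a) = H_map k l f (H_unit k i) y"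
    proof (cases "y \<in> {1..l}")
      case True
      have "(\<Sum>x\<in>{x \<in> {1..k}. f x = y}. H_unit k i x :: 'a) = (\<Sum>x\<in>{x \<in> {1..k}. f x = y}. if x = i then 1 else (0::'a))"
        by (intro sum.cong) (auto simp: H_unit_def)
      also have "\<dots> = (if i \<in> {1..k} \<and> f i = y then 1 else 0)" by (subst sum.delta) auto
      also have "\<dots> = H_unit l (f i) y" using True f pmaps_zero[OF f(1)] by (cases "i = 0") (auto simp: H_unit_def)
      finally show ?thesis using True by (simp add: H_map_def)
    next
      case False then show ?thesis unfolding H_map_def H_unit_def by presburger
    qed
  qed
  then show "\<forall>k l. \<forall>f\<in>pmaps k l. \<forall>i\<le>k. aunit (H_alg S) l (f i) = mp (H_alg S) k l f (aunit (H_alg S) k i)"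
    by (simp add: H_alg_def)
  have "H_unit k 0 = (\<lambda>_. 0 :: 'a)" for k by (auto simp: H_unit_def)
  then show "\<forall>k. aunit (H_alg S) k \<in> {0..k} \<rightarrow> el (H_alg S) k \<and> aunit (H_alg S) k 0 = pt (H_alg S) k"
    using Su by (simp add: H_alg_def)
qed (use H_unit_left[OF subsetD[OF Sel]] H_unit_right[OF subsetD[OF Sel]] in \<open>auto simp: H_mult_assoc H_alg_def simp del: One_nat_def\<close>)

lemma H_mult_swap:
  assumes "\<phi> \<in> H_el UNIV l" "\<psi> \<in> H_el UNIV (k::nat)"
  shows "H_map (l*k) (k*l) (pswap l k) (H_mult l k (\<phi>::nat\<Rightarrow>'a::comm_semiring_1) \<psi>) = H_mult k l \<psi> \<phi>"
proof
  fix z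
  show "H_map (l*k) (k*l) (pswap l k) (H_mult l k \<phi> \<psi>) z = H_mult k l \<psi> \<phi> z"
  proof (cases "z \<in> {1..k*l}")
    case True
    obtain i j where ij: "i \<in> {1..k}" "j \<in> {1..l}" "z = sm_pair l i j" using sm_pairE[OF True] .
    have "{x \<in> {1..l*k}. pswap l k x = z} = {sm_pair k j i}"
    proof (intro set_eqI iffI)
      fix x assume x: "x \<in> {x \<in> {1..l*k}. pswap l k x = z}"
      then have "x \<in> {1..l*k}" by simp
      from sm_pairE[OF this] obtain j' i' where w: "j' \<in> {1..l}" "i' \<in> {1..k}" "x = sm_pair k j' i'" .
      then have "sm_pair l i' j' = z" using x by (auto simp: pswap_def sm_fst_pair sm_snd_pair)
      then have "i' = i" "j' = j" using ij w sm_fst_pair[of i j l] sm_snd_pair[of i j l]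
         sm_fst_pair[of i' j' l] sm_snd_pair[of i' j' l] by auto
      then show "x \<in> {sm_pair k j i}" using w by simp
    next
      fix x assume "x \<in> {sm_pair k j i}"
      then show "x \<in> {x \<in> {1..l*k}. pswap l k x = z}" using ij sm_pair_in[of j l i k]
        by (auto simp: pswap_def sm_fst_pair sm_snd_pair)
    qed
    then have "H_map (l*k) (k*l) (pswap l k) (H_mult l k \<phi> \<psi>) z = H_mult l k \<phi> \<psi> (sm_pair k j i)"
      using True by (simp add: H_map_def)
    then show ?thesis using ij True sm_pair_in[of j l i k] 
      by (simp add: H_mult_def sm_fst_pair sm_snd_pair mult.commute)
  next
    case False then show ?thesis unfolding H_map_def H_mult_def by presburger
  qed
qed

lemma H_mult_el:
  assumes "\<And>x y. x \<in> R \<Longrightarrow> y \<in> E \<Longrightarrow> x * y \<in> E" "a \<in> H_el R k" "b \<in> H_el E l"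
  shows "H_mult k l a b \<in> H_el E (k * l)"
proof -
  have "H_mult k l a b z \<in> E" if z: "z \<in> {1..k*l}" for z
  proof -
    obtain i j where "i \<in> {1..k}" "j \<in> {1..l}" "z = sm_pair l i j" using sm_pairE[OF z] .
    then show ?thesis using assms z by (auto simp: H_mult_def H_el_def sm_fst_pair sm_snd_pair)
  qed
  then show ?thesis by (auto simp: H_el_def H_mult_def)
qed

lemma l1_norm_unit: "l1_norm k (H_unit k i) \<le> 1"
proof -
  have "l1_norm k (H_unit k i) = (\<Sum>x\<in>{1..k}. if x = i then 1 else 0)"
    unfolding l1_norm_def by (intro sum.cong) (auto simp: H_unit_def)
  then show ?thesis by (simp add: sum.delta)
qed

lemma l1_norm_nonneg: "0 \<le> l1_norm k \<phi>" unfolding l1_norm_def by (intro sum_nonneg) simp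

context
  fixes R E :: "rat set"
  assumes R: "0 \<in> R" "1 \<in> R" "\<And>x y. x \<in> R \<Longrightarrow> y \<in> R \<Longrightarrow> x + y \<in> R" "\<And>x y. x \<in> R \<Longrightarrow> y \<in> R \<Longrightarrow> x * y \<in> R"
    and E: "0 \<in> E" "\<And>x y. x \<in> E \<Longrightarrow> y \<in> E \<Longrightarrow> x + y \<in> E" "\<And>x y. x \<in> R \<Longrightarrow> y \<in> E \<Longrightarrow> x * y \<in> E"
begin

lemma s_module_H_el: "s_module (H_alg (H_el R)) (H_mod (H_el E))"
proof (rule s_module_H)
  show "H_map k l f \<phi> \<in> H_el E l" if "\<phi> \<in> H_el E k" for k l f \<phi>
    using that by (intro H_map_el E)
  show "H_mult k l a b \<in> H_el E (k * l)" if "a \<in> H_el R k" "b \<in> H_el E l" for k l a b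
    using that by (intro H_mult_el[of R E] E)
qed (use E in \<open>auto simp: H_el_def\<close>)

lemma s_algebra_H_le: "s_algebra (H_alg (H_le R 1))"
proof (rule s_algebra_H)
  show "H_map k l f \<phi> \<in> H_le R 1 l" if "f \<in> pmaps k l" "\<phi> \<in> H_le R 1 k" for k l f \<phi>
    using that R l1_norm_map[OF that(1), of \<phi>] by (auto simp: H_le_def intro: H_map_el)
  show "H_mult k l a b \<in> H_le R 1 (k * l)" if "a \<in> H_le R 1 k" "b \<in> H_le R 1 l" for k l a b
    using that R l1_norm_nonneg by (auto simp: H_le_def l1_norm_mult intro!: H_mult_el[of R R] mult_le_one)
  show "H_unit k i \<in> H_le R 1 k" for k i
    using l1_norm_unit R by (auto simp: H_le_def H_el_def H_unit_def)
qed (use R in \<open>auto simp: H_le_def H_el_def l1_norm_def\<close>)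

lemma s_module_H_le: "r > 0 \<Longrightarrow> s_module (H_alg (H_le R 1)) (H_mod (H_le E r))"
proof (rule s_module_H)
  show "H_map k l f \<phi> \<in> H_le E r l" if "f \<in> pmaps k l" "\<phi> \<in> H_le E r k" for k l f \<phi>
    using that E l1_norm_map[OF that(1), of \<phi>] by (auto simp: H_le_def intro: H_map_el)
  show "H_mult k l a b \<in> H_le E r (k * l)" if "a \<in> H_le R 1 k" "b \<in> H_le E r l" for k l a b
  proof -
    have "l1_norm k a * l1_norm l b \<le> 1 * l1_norm l b" 
      using that l1_norm_nonneg by (intro mult_right_mono) (auto simp: H_le_def)
    then show ?thesis using that E by (auto simp: H_le_def l1_norm_mult intro!: H_mult_el[of R E])
  qed
qed (use E in \<open>auto simp: H_le_def H_el_def l1_norm_def\<close>)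

lemma s_module_H_less: "r > 0 \<Longrightarrow> s_module (H_alg (H_le R 1)) (H_mod (H_less E r))"
proof (rule s_module_H)
  show "H_map k l f \<phi> \<in> H_less E r l" if "f \<in> pmaps k l" "\<phi> \<in> H_less E r k" for k l f \<phi>
    using that E l1_norm_map[OF that(1), of \<phi>] by (auto simp: H_less_def intro: H_map_el)
  show "H_mult k l a b \<in> H_less E r (k * l)" if "a \<in> H_le R 1 k" "b \<in> H_less E r l" for k l a b
  proof -
    have "l1_norm k a * l1_norm l b \<le> 1 * l1_norm l b" 
      using that l1_norm_nonneg by (intro mult_right_mono) (auto simp: H_le_def)
    then show ?thesis using that E by (auto simp: H_le_def H_less_def l1_norm_mult intro!: H_mult_el[of R E])
  qed
qed (use E in \<open>auto simp: H_less_def H_el_def l1_norm_def\<close>)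

end

lemma s_comm_H_alg:
  fixes S :: "nat \<Rightarrow> (nat \<Rightarrow> 'a::comm_semiring_1) set"
  assumes "\<And>k. S k \<subseteq> H_el UNIV k"
  shows "s_comm (H_alg S)"
  using assms H_mult_swap unfolding s_comm_def H_alg_def by fastforce

end

theory Submission
  imports Defs
begin

text \<open>
  Multiplication sends a class \<open>[v; x, y]\<close> of the presheaf smash product in (i) to the rational
  vector \<open>v\<^sub>*(x \<otimes> y)\<close>. This map is locally injective.
  Writing \<open>x\<close> as a scalar \<open>c\<close> times a section of the structure sheaf, one moves that section to the
  other factor and obtains \<open>[v; x, y] = [id; c, z / c]\<close> with \<open>z = v\<^sub>*(x \<otimes> y)\<close>. Away from \<open>\<infinity>\<close>, \<open>c\<close> can
  be a generator of the fractional ideal; near \<open>\<infinity>\<close> it is the norm of \<open>x\<close>, after inverting finitely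
  many primes, and \<open>[id; c, z / c]\<close> does not depend on \<open>c\<close> because for \<open>c \<le> c'\<close> the
  scalar \<open>c / c'\<close> lies in the unit ball. Hence the germs of the presheaf are the fibres of the
  multiplication map, and since all non-empty open sets contain the generic point, the associated
  sheaf consists of the vectors that are locally in its image. At \<open>\<infinity>\<close> these are the \<open>z\<close>
  whose norm is a product of two rationals bounded by \<open>\<lambda>\<close> and \<open>\<lambda>'\<close>; such a product can reach the
  bound \<open>\<lambda>\<lambda>'\<close>, when this is rational, only if \<open>\<lambda>\<close> and \<open>\<lambda>'\<close> are rational.

  For (ii), an isomorphism is multiplication by a fixed rational \<open>q\<close>, as it is linear over \<open>\<int>\<close> on
  open sets without \<open>\<infinity>\<close>; comparing sections over \<open>Spec \<int>\<close> and near \<open>\<infinity>\<close> identifies the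
  difference of the divisors with the principal divisor of \<open>q\<close>.
\<close>

section \<open>Pointed maps\<close>

text \<open>The bounds \<open>l\<close> and \<open>l'\<close> may differ because an extensional
  function does not record its codomain; targets such as \<open>k' * l' * m'\<close> and
  \<open>k' * (l' * m')\<close> agree only after rewriting.\<close>

lemma pmaps_eqI:
  assumes "f \<in> pmaps k l" "g \<in> pmaps k l'" "\<And>x. x \<le> k \<Longrightarrow> f x = g x"
  shows "f = g"
  using assms unfolding pmaps_def PiE_def by (auto intro: extensionalityI[of f "{0..k}"])

lemma pid_pmaps: "pid k \<in> pmaps k k"
  by (auto simp: pid_def pmaps_def)

lemma pid_apply: "x \<le> k \<Longrightarrow> pid k x = x"
  by (simp add: pid_def)

lemma pcomp_pmaps: "f \<in> pmaps k l \<Longrightarrow> g \<in> pmaps l m \<Longrightarrow> pcomp k g f \<in> pmaps k m"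
  unfolding pmaps_def pcomp_def compose_def by auto

lemma pcomp_apply: "x \<le> k \<Longrightarrow> pcomp k g f x = g (f x)"
  by (simp add: pcomp_def compose_def)

lemma pcomp_assoc:
  assumes "f \<in> pmaps k l" "g \<in> pmaps l m" "h \<in> pmaps m n"
  shows "pcomp k h (pcomp k g f) = pcomp k (pcomp l h g) f"
proof (rule pmaps_eqI)
  show "pcomp k h (pcomp k g f) \<in> pmaps k n"
    by (rule pcomp_pmaps[OF pcomp_pmaps]) fact+
  show "pcomp k (pcomp l h g) f \<in> pmaps k n"
    by (rule pcomp_pmaps[OF _ pcomp_pmaps]) fact+
qed (simp add: pcomp_apply pmaps_le[OF assms(1)])

lemma pcomp_pid: "f \<in> pmaps k l \<Longrightarrow> pcomp k (pid l) f = f"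
  by (rule pmaps_eqI[where k = k and l = l and l' = l])
     (auto simp: pcomp_apply pid_apply pmaps_le intro: pcomp_pmaps pid_pmaps)

lemma sm_pair_zero [simp]: "sm_pair l 0 j = 0" "sm_pair l i 0 = 0"
  by (simp_all add: sm_pair_def)

lemma sm_pair_exhaust:
  assumes "z \<le> k * l"
  obtains i j where "i \<le> k" "j \<le> l" "z = sm_pair l i j"
  using assms sm_fst_le sm_snd_le sm_pair_fst_snd by metis

text \<open>The base points i = 0 and j = 0 are included, so that computations with smash products
  of maps need no case distinction later.\<close>

lemma psmash_sm_pair:
  assumes "i \<le> k" "j \<le> l" "f 0 = 0" "g 0 = 0"
  shows "psmash k l l' f g (sm_pair l i j) = sm_pair l' (f i) (g j)"
proof (cases "i = 0 \<or> j = 0")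
  case True
  then show ?thesis using assms by (auto simp: psmash_def sm_fst_def)
next
  case False
  then show ?thesis using assms sm_pair_le[of i k j l]
    by (simp add: psmash_def sm_fst_pair sm_snd_pair)
qed

lemma psmash_pmaps:
  assumes f: "f \<in> pmaps k k'" and g: "g \<in> pmaps l l'"
  shows "psmash k l l' f g \<in> pmaps (k * l) (k' * l')"
proof -
  have "psmash k l l' f g z \<le> k' * l'" if z: "z \<le> k * l" for z
  proof -
    obtain i j where "i \<le> k" "j \<le> l" "z = sm_pair l i j" using sm_pair_exhaust[OF z] .
    then show ?thesis using f g
      by (simp add: psmash_sm_pair pmaps_zero pmaps_le sm_pair_le)
  qed
  moreover have "psmash k l l' f g 0 = 0"
    using f by (simp add: psmash_def sm_fst_def pmaps_zero)
  ultimately show ?thesis unfolding pmaps_def by (auto simp: psmash_def)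
qed

lemma psmash_assoc:
  assumes f: "f \<in> pmaps k k'" and g: "g \<in> pmaps l l'" and h: "h \<in> pmaps m m'"
  shows "psmash (k * l) m m' (psmash k l l' f g) h = psmash k (l * m) (l' * m') f (psmash l m m' g h)"
proof (rule pmaps_eqI)
  show "psmash (k * l) m m' (psmash k l l' f g) h \<in> pmaps (k * l * m) (k' * l' * m')"
    by (intro psmash_pmaps assms)
  show "psmash k (l * m) (l' * m') f (psmash l m m' g h) \<in> pmaps (k * l * m) (k' * (l' * m'))"
    using psmash_pmaps[OF f psmash_pmaps[OF g h]] by (simp add: mult.assoc)
  fix z assume "z \<le> k * l * m"
  then obtain w c where wc: "w \<le> k * l" "c \<le> m" "z = sm_pair m w c" using sm_pair_exhaust by blast
  then obtain a b where ab: "a \<le> k" "b \<le> l" "w = sm_pair l a b" using sm_pair_exhaust by blast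
  have z: "z = sm_pair (l * m) a (sm_pair m b c)" by (simp add: wc ab sm_pair_assoc)
  have 0: "f 0 = 0" "g 0 = 0" "h 0 = 0" "psmash k l l' f g 0 = 0" "psmash l m m' g h 0 = 0"
    using assms psmash_pmaps pmaps_zero by blast+
  have "psmash (k * l) m m' (psmash k l l' f g) h z = sm_pair m' (sm_pair l' (f a) (g b)) (h c)"
    using wc ab 0 by (simp add: psmash_sm_pair)
  moreover have "psmash k (l * m) (l' * m') f (psmash l m m' g h) z = sm_pair (l' * m') (f a) (sm_pair m' (g b) (h c))"
    unfolding z using wc ab 0 by (simp add: psmash_sm_pair sm_pair_le)
  ultimately show "psmash (k * l) m m' (psmash k l l' f g) h z = psmash k (l * m) (l' * m') f (psmash l m m' g h) z"
    by (simp add: sm_pair_assoc)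
qed

lemma psmash_pcomp:
  assumes f: "f \<in> pmaps k k'" "f' \<in> pmaps k' k''" and g: "g \<in> pmaps l l'" "g' \<in> pmaps l' l''"
  shows "psmash k l l'' (pcomp k f' f) (pcomp l g' g) = pcomp (k * l) (psmash k' l' l'' f' g') (psmash k l l' f g)"
proof (rule pmaps_eqI)
  show "psmash k l l'' (pcomp k f' f) (pcomp l g' g) \<in> pmaps (k * l) (k'' * l'')"
    by (intro psmash_pmaps pcomp_pmaps) fact+
  show "pcomp (k * l) (psmash k' l' l'' f' g') (psmash k l l' f g) \<in> pmaps (k * l) (k'' * l'')"
    by (rule pcomp_pmaps[OF psmash_pmaps psmash_pmaps]) fact+
  fix z assume z: "z \<le> k * l"
  then obtain i j where ij: "i \<le> k" "j \<le> l" "z = sm_pair l i j" using sm_pair_exhaust by blast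
  have 0: "f 0 = 0" "g 0 = 0" "f' 0 = 0" "g' 0 = 0" using assms pmaps_zero by blast+
  show "psmash k l l'' (pcomp k f' f) (pcomp l g' g) z = pcomp (k * l) (psmash k' l' l'' f' g') (psmash k l l' f g) z"
    using z pmaps_le[OF f(1) ij(1)] pmaps_le[OF g(1) ij(2)]
    by (simp add: ij(1,2) 0 pcomp_apply psmash_sm_pair sm_pair_le ij(3))
qed

text \<open>The enumeration sends (1, j) to j, so smashing with the object 1_+ changes nothing. This
  lets \<open>v\<close> enter a Day relation through the second factor alone.\<close>

lemma psmash_one_left:
  assumes v: "v \<in> pmaps l l'"
  shows "psmash 1 l l' (pid 1) v = v"
proof (rule pmaps_eqI[OF _ v])
  show "psmash 1 l l' (pid 1) v \<in> pmaps l (1 * l')"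
    using psmash_pmaps[OF pid_pmaps v, of 1] by simp
  have 1: "sm_pair m 1 i = i" for m i by (simp add: sm_pair_def)
  fix z assume "z \<le> l"
  then have "psmash 1 l l' (pid 1) v (sm_pair l 1 z) = sm_pair l' (pid 1 1) (v z)"
    by (intro psmash_sm_pair) (auto simp: pid_apply pmaps_zero[OF v])
  then show "psmash 1 l l' (pid 1) v z = v z" by (simp only: 1 pid_apply)
qed

lemma pswap_pmaps: "pswap k l \<in> pmaps (k * l) (l * k)"
proof -
  have "sm_pair k (sm_snd l z) (sm_fst l z) \<le> l * k" if "z \<le> k * l" for z
    using that by (intro sm_pair_le sm_fst_le sm_snd_le)
  then show ?thesis by (auto simp: pswap_def pmaps_def sm_fst_def sm_snd_def)
qed


section \<open>Smash products of submodules of free modules\<close>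

lemma gen_equiv_refl: "(r, r) \<in> gen_equiv S"
  by (simp add: gen_equiv_def)

lemma gen_equiv_incl: "(r, r') \<in> S \<Longrightarrow> (r, r') \<in> gen_equiv S"
  by (auto simp: gen_equiv_def)

lemma gen_equiv_sym: "(r, r') \<in> gen_equiv S \<Longrightarrow> (r', r) \<in> gen_equiv S"
  unfolding gen_equiv_def by (metis converse_Un converse_converse rtrancl_converseI sup_commute)

lemma gen_equiv_trans: "(r, r') \<in> gen_equiv S \<Longrightarrow> (r', r'') \<in> gen_equiv S \<Longrightarrow> (r, r'') \<in> gen_equiv S"
  unfolding gen_equiv_def by (rule rtrancl_trans)

lemma gen_equiv_class_eq: "(r, r') \<in> gen_equiv S \<Longrightarrow> gen_equiv S `` {r} = gen_equiv S `` {r'}"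
  using gen_equiv_trans gen_equiv_sym by fast

text \<open>Well-definedness on a quotient is reduced by this induction to a check on generating
  pairs.\<close>

lemma gen_equiv_invariant:
  assumes "(r, r') \<in> gen_equiv S" and "\<And>s s'. (s, s') \<in> S \<Longrightarrow> g s = g s'"
  shows "g r = g r'"
  using assms(1) unfolding gen_equiv_def by (induction rule: rtrancl_induct) (auto dest: assms(2))

text \<open>The multiplication map from the smash product to H, on representatives before passing to
  classes.\<close>

definition smash_value :: "nat \<Rightarrow> (nat \<Rightarrow> 'a, nat \<Rightarrow> 'a::comm_semiring_1) day_rep \<Rightarrow> nat \<Rightarrow> 'a" where
  "smash_value n = (\<lambda>(k, l, v, x, y). H_map (k * l) n v (H_mult k l x y))"

lemma H_mult_zero [simp]: "H_mult k l (\<lambda>_. 0) y = (\<lambda>_. 0)" "H_mult k l x (\<lambda>_. 0) = (\<lambda>_. 0)"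
  by (auto simp: H_mult_def)

lemma H_map_zero [simp]: "H_map k l f (\<lambda>_. 0) = (\<lambda>_. 0)"
  by (auto simp: H_map_def)

lemma H_mod_simps [simp]:
  "el (H_mod S) = S" "pt (H_mod S) = (\<lambda>_ _. 0)" "mp (H_mod S) = H_map" "lact (H_mod S) = H_mult"
  "el (H_alg S) = S" "pt (H_alg S) = (\<lambda>_ _. 0)" "mp (H_alg S) = H_map" "amult (H_alg S) = H_mult"
  by (simp_all add: H_mod_def H_alg_def)

text \<open>What the full modules and the balls of bounded norm have in common: stability under
  pushforward and under scalars. Addition is absent because balls are in general not stable under
  it.\<close>

locale H_smash =
  fixes R E F :: "nat \<Rightarrow> (nat \<Rightarrow> 'a::comm_semiring_1) set"
  assumes supp: "R k \<subseteq> H_el UNIV k" "E k \<subseteq> H_el UNIV k" "F k \<subseteq> H_el UNIV k"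
    and zero_mem: "(\<lambda>_. 0) \<in> E k" "(\<lambda>_. 0) \<in> F k"
    and map_mem: "f \<in> pmaps k l \<Longrightarrow> x \<in> E k \<Longrightarrow> H_map k l f x \<in> E l"
      "f \<in> pmaps k l \<Longrightarrow> x \<in> F k \<Longrightarrow> H_map k l f x \<in> F l"
    and scalar_map_mem: "f \<in> pmaps k l \<Longrightarrow> a \<in> R k \<Longrightarrow> H_map k l f a \<in> R l"
    and mult_mem: "a \<in> R k \<Longrightarrow> x \<in> E l \<Longrightarrow> H_mult k l a x \<in> E (k * l)"
      "a \<in> R k \<Longrightarrow> x \<in> F l \<Longrightarrow> H_mult k l a x \<in> F (k * l)"
begin

abbreviation reps where "reps \<equiv> day_reps (H_mod E) (H_mod F)"
abbreviation gens where "gens \<equiv> day_gen (H_mod E) (H_mod F)"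
abbreviation dcls where "dcls \<equiv> day_class (H_mod E) (H_mod F)"
abbreviation cls where "cls \<equiv> smash_class (H_alg R) (H_mod E) (H_mod F)"
abbreviation reps3 where "reps3 \<equiv> day3_reps (H_mod E) (H_alg R) (H_mod F)"
abbreviation gens3 where "gens3 \<equiv> day3_gen (H_mod E) (H_alg R) (H_mod F)"
abbreviation dcls3 where "dcls3 \<equiv> day3_class (H_mod E) (H_alg R) (H_mod F)"
abbreviation coeqr where "coeqr \<equiv> coeq_rel (smash3 (H_mod E) (H_alg R) (H_mod F))
  (act_left (H_alg R) (H_mod E) (H_mod F)) (act_right (H_alg R) (H_mod E) (H_mod F))"

text \<open>The swap in the definition of \<open>ract\<close> undoes the exchange of the two
  factors, by commutativity of the coefficients.\<close>

lemma ract_eq: "x \<in> E k \<Longrightarrow> a \<in> R l \<Longrightarrow> ract (H_mod E) k l x a = H_mult k l x a"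
  unfolding ract_def using supp by (simp add: H_mult_swap subset_iff)

lemma right_mult_mem: "x \<in> E k \<Longrightarrow> a \<in> R l \<Longrightarrow> H_mult k l x a \<in> E (k * l)"
  using map_mem(1)[OF pswap_pmaps mult_mem(1), of a l x k] ract_eq[of x k a l] by (simp add: ract_def)

lemma map_pid_scalar: "a \<in> R j \<Longrightarrow> H_map j j (pid j) a = a"
  using supp(1) by (blast intro: H_map_id)

lemma dcls_refl: "r \<in> dcls n r"
  by (simp add: day_class_def gen_equiv_refl)

lemma dcls_eq: "(r, r') \<in> gens n \<Longrightarrow> dcls n r = dcls n r'"
  unfolding day_class_def by (rule gen_equiv_class_eq[OF gen_equiv_incl])

lemma dcls_invariant:
  assumes "r' \<in> dcls n r" "\<And>s s'. (s, s') \<in> gens n \<Longrightarrow> g s = g s'"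
  shows "g r' = g r"
  using gen_equiv_invariant[of r r' "gens n" g] assms by (simp add: day_class_def)

text \<open>The two maps of the coequalizer diagram on representatives: the scalar is absorbed into
  the left factor here and into the right factor in \<open>rmove\<close>.\<close>

definition lmove where
  "lmove = (\<lambda>(k, l, m, v, x, a, y). (k * l :: nat, m :: nat, v :: nat \<Rightarrow> nat, ract (H_mod E) k l x a, y :: nat \<Rightarrow> 'a))"

definition rmove where
  "rmove = (\<lambda>(k, l, m, v, x, a, y). (k :: nat, l * m :: nat, v :: nat \<Rightarrow> nat, x :: nat \<Rightarrow> 'a, H_mult l m a y :: nat \<Rightarrow> 'a))"

lemma lmove_reps: "q \<in> reps3 n \<Longrightarrow> lmove q \<in> reps n"
  by (auto simp: day3_reps_def day_reps_def lmove_def ract_eq right_mult_mem)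

lemma rmove_reps: "q \<in> reps3 n \<Longrightarrow> rmove q \<in> reps n"
  by (auto simp: day3_reps_def day_reps_def rmove_def mult_mem mult.assoc)

lemma gens_mapI:
  assumes "f \<in> pmaps k k'" "g \<in> pmaps l l'" "v \<in> pmaps (k' * l') n" "s \<in> E k" "t \<in> F l"
  shows "((k, l, pcomp (k * l) v (psmash k l l' f g), s, t), (k', l', v, H_map k k' f s, H_map l l' g t)) \<in> gens n"
  using assms unfolding day_gen_def by fastforce

lemma gens_ptI:
  assumes "(k, l, v, s, t) \<in> reps n" "s = (\<lambda>_. 0) \<or> t = (\<lambda>_. 0)"
    "(k', l', v', s', t') \<in> reps n" "s' = (\<lambda>_. 0) \<or> t' = (\<lambda>_. 0)"
  shows "((k, l, v, s, t), (k', l', v', s', t')) \<in> gens n"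
  using assms unfolding day_gen_def by simp

lemma gensE:
  assumes "(r, r') \<in> gens n"
  obtains (map) k l k' l' v f g s t where
    "r = (k, l, pcomp (k * l) v (psmash k l l' f g), s, t)" "r' = (k', l', v, H_map k k' f s, H_map l l' g t)"
    "f \<in> pmaps k k'" "g \<in> pmaps l l'" "v \<in> pmaps (k' * l') n" "s \<in> E k" "t \<in> F l"
  | (pt) k l v s t k' l' v' s' t' where
    "r = (k, l, v, s, t)" "r' = (k', l', v', s', t')" "r \<in> reps n" "r' \<in> reps n"
    "s = (\<lambda>_. 0) \<or> t = (\<lambda>_. 0)" "s' = (\<lambda>_. 0) \<or> t' = (\<lambda>_. 0)"
  using assms unfolding day_gen_def H_mod_simps
  by (elim UnE CollectE exE conjE Pair_inject)
     ((rule map; assumption), (rule pt, assumption, assumption, simp_all))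

lemma gens3E:
  assumes "(q, q') \<in> gens3 n"
  obtains (map) k l m k' l' m' v f g h s t u where
    "q = (k, l, m, pcomp (k * l * m) v (psmash (k * l) m m' (psmash k l l' f g) h), s, t, u)"
    "q' = (k', l', m', v, H_map k k' f s, H_map l l' g t, H_map m m' h u)"
    "f \<in> pmaps k k'" "g \<in> pmaps l l'" "h \<in> pmaps m m'" "v \<in> pmaps (k' * l' * m') n"
    "s \<in> E k" "t \<in> R l" "u \<in> F m"
  | (pt) k l m v s t u k' l' m' v' s' t' u' where
    "q = (k, l, m, v, s, t, u)" "q' = (k', l', m', v', s', t', u')" "q \<in> reps3 n" "q' \<in> reps3 n"
    "s = (\<lambda>_. 0) \<or> t = (\<lambda>_. 0) \<or> u = (\<lambda>_. 0)" "s' = (\<lambda>_. 0) \<or> t' = (\<lambda>_. 0) \<or> u' = (\<lambda>_. 0)"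
  using assms unfolding day3_gen_def H_mod_simps
  by (elim UnE CollectE exE conjE Pair_inject)
     ((rule map; assumption), (rule pt, assumption, assumption, simp_all))

text \<open>By naturality of the product, the threefold relation given by f, g, h becomes the
  twofold relation given by the smash of f and g together with h.\<close>

lemma lmove_gens3: "(q, q') \<in> gens3 n \<Longrightarrow> (lmove q, lmove q') \<in> gens n"
proof (erule gens3E)
  fix k l m k' l' m' v f g h s t u
  assume q: "q = (k, l, m, pcomp (k * l * m) v (psmash (k * l) m m' (psmash k l l' f g) h), s, t, u)"
    "q' = (k', l', m', v, H_map k k' f s, H_map l l' g t, H_map m m' h u)"
    and h: "f \<in> pmaps k k'" "g \<in> pmaps l l'" "h \<in> pmaps m m'" "v \<in> pmaps (k' * l' * m') n"
    "s \<in> E k" "t \<in> R l" "u \<in> F m"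
  show ?thesis
    using gens_mapI[OF psmash_pmaps[OF h(1,2)] h(3,4) right_mult_mem[OF h(5,6)] h(7)] h
    by (simp add: q lmove_def ract_eq map_mem scalar_map_mem H_mult_natural)
next
  fix k l m v s t u k' l' m' v' s' t' u'
  assume q: "q = (k, l, m, v, s, t, u)" "q' = (k', l', m', v', s', t', u')" "q \<in> reps3 n" "q' \<in> reps3 n"
    "s = (\<lambda>_. 0) \<or> t = (\<lambda>_. 0) \<or> u = (\<lambda>_. 0)" "s' = (\<lambda>_. 0) \<or> t' = (\<lambda>_. 0) \<or> u' = (\<lambda>_. 0)"
  have "s \<in> E k" "t \<in> R l" "s' \<in> E k'" "t' \<in> R l'" using q by (simp_all add: day3_reps_def)
  then show ?thesis using lmove_reps[OF q(3)] lmove_reps[OF q(4)] q(5,6)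
    unfolding q lmove_def by (auto simp: ract_eq intro!: gens_ptI)
qed

text \<open>Now the scalar joins the third factor, and associativity of the smash product rebrackets
  the map to f and the smash of g and h.\<close>

lemma rmove_gens3: "(q, q') \<in> gens3 n \<Longrightarrow> (rmove q, rmove q') \<in> gens n"
proof (erule gens3E)
  fix k l m k' l' m' v f g h s t u
  assume q: "q = (k, l, m, pcomp (k * l * m) v (psmash (k * l) m m' (psmash k l l' f g) h), s, t, u)"
    "q' = (k', l', m', v, H_map k k' f s, H_map l l' g t, H_map m m' h u)"
    and h: "f \<in> pmaps k k'" "g \<in> pmaps l l'" "h \<in> pmaps m m'" "v \<in> pmaps (k' * l' * m') n"
    "s \<in> E k" "t \<in> R l" "u \<in> F m"
  have v: "v \<in> pmaps (k' * (l' * m')) n" using h(4) by (simp add: mult.assoc)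
  show ?thesis
    using gens_mapI[OF h(1) psmash_pmaps[OF h(2,3)] v h(5) mult_mem(2)[OF h(6,7)]] h
    by (simp add: q rmove_def H_mult_natural psmash_assoc mult.assoc)
next
  fix k l m v s t u k' l' m' v' s' t' u'
  assume q: "q = (k, l, m, v, s, t, u)" "q' = (k', l', m', v', s', t', u')" "q \<in> reps3 n" "q' \<in> reps3 n"
    "s = (\<lambda>_. 0) \<or> t = (\<lambda>_. 0) \<or> u = (\<lambda>_. 0)" "s' = (\<lambda>_. 0) \<or> t' = (\<lambda>_. 0) \<or> u' = (\<lambda>_. 0)"
  then show ?thesis using rmove_reps[OF q(3)] rmove_reps[OF q(4)] q(5,6)
    unfolding q rmove_def by (auto intro!: gens_ptI)
qed

text \<open>The unions defining the action maps run over constant families, because both moves send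
  generating pairs to generating pairs.\<close>

lemma
  shows act_left_class: "act_left (H_alg R) (H_mod E) (H_mod F) n (dcls3 n q) = dcls n (lmove q)"
    and act_right_class: "act_right (H_alg R) (H_mod E) (H_mod F) n (dcls3 n q) = dcls n (rmove q)"
proof -
  have "dcls n (lmove q') = dcls n (lmove q)" "dcls n (rmove q') = dcls n (rmove q)" if "q' \<in> dcls3 n q" for q'
    using that gen_equiv_invariant[of q q' "gens3 n" "\<lambda>q. dcls n (lmove q)"]
      gen_equiv_invariant[of q q' "gens3 n" "\<lambda>q. dcls n (rmove q)"]
    by (simp_all add: day3_class_def dcls_eq lmove_gens3 rmove_gens3)
  moreover have "q \<in> dcls3 n q" by (simp add: day3_class_def gen_equiv_refl)
  moreover have "act_left (H_alg R) (H_mod E) (H_mod F) n C = (\<Union>q\<in>C. dcls n (lmove q))"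
    "act_right (H_alg R) (H_mod E) (H_mod F) n C = (\<Union>q\<in>C. dcls n (rmove q))" for C
    by (simp_all add: act_left_def act_right_def lmove_def rmove_def case_prod_unfold)
  ultimately show "act_left (H_alg R) (H_mod E) (H_mod F) n (dcls3 n q) = dcls n (lmove q)"
    "act_right (H_alg R) (H_mod E) (H_mod F) n (dcls3 n q) = dcls n (rmove q)"
    by (metis (no_types, lifting) SUP_eq_const empty_iff)+
qed

lemma coeq_gens: "{(dcls n (lmove q), dcls n (rmove q)) | q. q \<in> reps3 n} =
  (\<lambda>p. (act_left (H_alg R) (H_mod E) (H_mod F) n p, act_right (H_alg R) (H_mod E) (H_mod F) n p)) `
     el (smash3 (H_mod E) (H_alg R) (H_mod F)) n"
proof -
  have "el (smash3 (H_mod E) (H_alg R) (H_mod F)) n = dcls3 n ` reps3 n"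
    by (auto simp: smash3_def quotient_def day3_class_def)
  then show ?thesis by (simp only: image_image act_left_class act_right_class setcompr_eq_image Collect_mem_eq)
qed

lemma coeqr_eq: "coeqr n = gen_equiv {(dcls n (lmove q), dcls n (rmove q)) | q. q \<in> reps3 n}"
  unfolding coeq_rel_def coeq_gens ..

section \<open>Classes in the coequalizer\<close>

lemma cls_eq: "cls n r = coeqr n `` {dcls n r}"
  by (simp add: smash_class_def)

lemma cls_gens: "(r, r') \<in> gens n \<Longrightarrow> cls n r = cls n r'"
  by (simp add: cls_eq dcls_eq)

lemma cls_move: "q \<in> reps3 n \<Longrightarrow> cls n (lmove q) = cls n (rmove q)"
  unfolding cls_eq coeqr_eq by (intro gen_equiv_class_eq gen_equiv_incl) blast

text \<open>This is the balancing relation of a tensor product over the algebra, from which all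
  normal forms below are derived.\<close>

lemma cls_scalar:
  assumes "v \<in> pmaps (k * l * m) n" "x \<in> E k" "a \<in> R l" "y \<in> F m"
  shows "cls n (k * l, m, v, H_mult k l x a, y) = cls n (k, l * m, v, x, H_mult l m a y)"
  using cls_move[of "(k, l, m, v, x, a, y)" n] assms
  by (simp add: day3_reps_def lmove_def rmove_def ract_eq)

lemma cls_refl: "dcls n r \<in> cls n r"
  by (simp add: cls_eq coeqr_eq gen_equiv_refl)

text \<open>The generated equivalence lives on arbitrary sets of representatives, so a class must be
  shown to contain only Day classes. Both ends of every generating pair are Day classes, hence the
  property propagates along chains.\<close>

lemma cls_members:
  assumes r: "r \<in> reps n" and B: "B \<in> cls n r"
  obtains r' where "r' \<in> reps n" "B = dcls n r'" "cls n r' = cls n r"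
proof -
  have "(dcls n r, B) \<in> coeqr n" using B by (simp add: cls_eq)
  then have "B \<in> dcls n ` reps n \<longleftrightarrow> dcls n r \<in> dcls n ` reps n"
    unfolding coeqr_eq
  proof (rule gen_equiv_invariant[symmetric])
    fix s s' assume "(s, s') \<in> {(dcls n (lmove q), dcls n (rmove q)) | q. q \<in> reps3 n}"
    then obtain q where "s = dcls n (lmove q)" "s' = dcls n (rmove q)" "q \<in> reps3 n" by blast
    then show "(s \<in> dcls n ` reps n) = (s' \<in> dcls n ` reps n)"
      using lmove_reps rmove_reps by simp
  qed
  then obtain r' where r': "r' \<in> reps n" "B = dcls n r'" using r by blast
  have "cls n r' = cls n r" using gen_equiv_class_eq[OF \<open>(dcls n r, B) \<in> coeqr n\<close>[unfolded coeqr_eq]] r'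
    by (simp only: cls_eq coeqr_eq)
  with r' show ?thesis using that by blast
qed

text \<open>A class has two layers, Day classes inside a coequalizer class. Compatibility with the
  Day relations settles the inner layer, compatibility with moving scalars the outer one.\<close>

lemma cls_invariant:
  assumes r: "r \<in> reps n" and B: "B \<in> cls n r" and r': "r' \<in> B"
    and gens: "\<And>s s'. (s, s') \<in> gens n \<Longrightarrow> g s = g s'"
    and scalar: "\<And>k l m v x a y. v \<in> pmaps (k * l * m) n \<Longrightarrow> x \<in> E k \<Longrightarrow> a \<in> R l \<Longrightarrow> y \<in> F m \<Longrightarrow>
      g (k * l, m, v, H_mult k l x a, y) = g (k, l * m, v, x, H_mult l m a y)"
  shows "g r' = g r"
proof -
  have dcls: "(\<forall>s'\<in>dcls n s. g s' = c) \<longleftrightarrow> g s = c" for s c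
    using dcls_invariant[of _ n s g] gens dcls_refl by metis
  have move: "g (lmove q) = g (rmove q)" if "q \<in> reps3 n" for q
    using that scalar by (auto simp: day3_reps_def lmove_def rmove_def ract_eq)
  \<comment> \<open>The statement carried along the coequalizer pairs is that \<open>g\<close> has
    the constant value \<open>g r\<close> on a whole Day class.\<close>
  have "(\<forall>s\<in>dcls n r. g s = g r) \<longleftrightarrow> (\<forall>s\<in>B. g s = g r)"
    using B unfolding cls_eq coeqr_eq Image_singleton_iff
  proof (elim gen_equiv_invariant)
    fix C C' assume "(C, C') \<in> {(dcls n (lmove q), dcls n (rmove q)) | q. q \<in> reps3 n}"
    then obtain q where "C = dcls n (lmove q)" "C' = dcls n (rmove q)" "q \<in> reps3 n" by blast
    then show "(\<forall>s\<in>C. g s = g r) \<longleftrightarrow> (\<forall>s\<in>C'. g s = g r)"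
      using move by (simp only: dcls)
  qed
  then show ?thesis using r' by (simp add: dcls)
qed

text \<open>Evaluates the nested unions in which the action on \<open>smash_over\<close> and the
  restrictions of \<open>smash_presheaf\<close> are written.\<close>

lemma cls_UN:
  assumes "r \<in> reps n"
    and "\<And>s s'. (s, s') \<in> gens n \<Longrightarrow> g s = g s'"
    and "\<And>k l m v x a y. v \<in> pmaps (k * l * m) n \<Longrightarrow> x \<in> E k \<Longrightarrow> a \<in> R l \<Longrightarrow> y \<in> F m \<Longrightarrow>
      g (k * l, m, v, H_mult k l x a, y) = g (k, l * m, v, x, H_mult l m a y)"
  shows "(\<Union>B\<in>cls n r. \<Union>s\<in>B. g s) = g r"
proof -
  have "g s = g r" if "B \<in> cls n r" "s \<in> B" for s B
    using cls_invariant[OF assms(1) that, of g] assms(2,3) by blast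
  then show ?thesis using cls_refl[of n r] dcls_refl[of r n] by blast
qed

section \<open>The module structure on the smash product over the algebra\<close>

abbreviation MN where "MN \<equiv> smash_over (H_alg R) (H_mod E) (H_mod F)"

lemma el_smash_over: "el MN n = cls n ` reps n"
  by (auto simp: smash_over_def gamma.defs s_mod.defs coequalizer_def smash_def quotient_def
      cls_eq day_class_def)

lemma pt_smash_over: "pt MN n = cls n (0, 0, pid 0, \<lambda>_. 0, \<lambda>_. 0)"
  by (simp add: smash_over_def gamma.defs s_mod.defs coequalizer_def smash_def cls_eq)

lemma mp_smash_over:
  assumes f: "f \<in> pmaps n m" and r: "(k, l, v, x, y) \<in> reps n"
  shows "mp MN n m f (cls n (k, l, v, x, y)) = cls m (k, l, pcomp (k * l) f v, x, y)"
proof -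
  define h where "h = (\<lambda>(k, l, v, x, y). (k :: nat, l :: nat, pcomp (k * l) f v, x :: nat \<Rightarrow> 'a, y :: nat \<Rightarrow> 'a))"
  have h_reps: "r \<in> reps n \<Longrightarrow> h r \<in> reps m" for r
    using f by (auto simp: h_def day_reps_def intro: pcomp_pmaps)
  have gens: "(h s, h s') \<in> gens m" if "(s, s') \<in> gens n" for s s'
    using that
  proof (cases rule: gensE)
    case (map k l k' l' v f' g' s t)
    \<comment> \<open>The map \<open>f\<close> is applied after \<open>v\<close>, so it does not
      interfere with the precomposition in a Day relation.\<close>
    have "pcomp (k * l) f (pcomp (k * l) v (psmash k l l' f' g')) = pcomp (k * l) (pcomp (k' * l') f v) (psmash k l l' f' g')"
      by (rule pcomp_assoc[OF psmash_pmaps]) fact+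
    then show ?thesis using map gens_mapI[OF map(3,4) pcomp_pmaps[OF map(5) f] map(6,7)] by (simp add: h_def)
  next
    case (pt k l v s t k' l' v' s' t')
    then show ?thesis using h_reps[OF pt(3)] h_reps[OF pt(4)] by (auto simp: h_def intro!: gens_ptI)
  qed
  have "mp (smash (H_mod E) (H_mod F)) n m f (dcls n s) = dcls m (h s)" if "s \<in> reps n" for s
  proof -
    have "dcls m (h s') = dcls m (h s)" if "s' \<in> dcls n s" for s'
      using dcls_invariant[OF that, of "\<lambda>s. dcls m (h s)"] dcls_eq gens by blast
    moreover have "mp (smash (H_mod E) (H_mod F)) n m f (dcls n s) = (\<Union>s'\<in>dcls n s. dcls m (h s'))"
      by (simp add: smash_def h_def case_prod_unfold)
    moreover have "dcls n s \<noteq> {}" using dcls_refl by blast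
    ultimately show ?thesis by simp
  qed
  then have step1: "coeqr m `` {mp (smash (H_mod E) (H_mod F)) n m f (dcls n s)} = cls m (h s)" if "s \<in> reps n" for s
    using that by (simp add: cls_eq)
  have step2: "cls m (h s') = cls m (h s)" if "s \<in> reps n" "s' \<in> reps n" "cls n s' = cls n s" for s s'
  proof -
    have "dcls n s' \<in> cls n s" using cls_refl[of n s'] that by simp
    then show ?thesis
    proof (rule cls_invariant[OF that(1) _ dcls_refl])
      show "cls m (h s) = cls m (h s')" if "(s, s') \<in> gens n" for s s'
        by (rule cls_gens[OF gens[OF that]])
      show "cls m (h (k * l, j, v, H_mult k l x a, y)) = cls m (h (k, l * j, v, x, H_mult l j a y))"
        if "v \<in> pmaps (k * l * j) n" "x \<in> E k" "a \<in> R l" "y \<in> F j" for k l j v x a y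
        using cls_scalar[OF pcomp_pmaps[OF that(1) f] that(2-)] by (simp add: h_def mult.assoc)
    qed
  qed
  have const: "coeqr m `` {mp (smash (H_mod E) (H_mod F)) n m f B} = cls m (h (k, l, v, x, y))"
    if B: "B \<in> cls n (k, l, v, x, y)" for B
  proof -
    obtain s where "s \<in> reps n" "B = dcls n s" "cls n s = cls n (k, l, v, x, y)"
      by (rule cls_members[OF r B])
    with step1 step2[OF r] show ?thesis by simp
  qed
  have "mp MN n m f (cls n (k, l, v, x, y)) =
    (\<Union>B\<in>cls n (k, l, v, x, y). coeqr m `` {mp (smash (H_mod E) (H_mod F)) n m f B})"
    by (simp add: smash_over_def gamma.defs s_mod.defs coequalizer_def)
  also have "\<dots> = (\<Union>B\<in>cls n (k, l, v, x, y). cls m (h (k, l, v, x, y)))"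
    by (intro SUP_cong refl const)
  also have "\<dots> = cls m (h (k, l, v, x, y))" by (rule UN_constant_eq[OF cls_refl]) simp
  finally show ?thesis by (simp add: h_def)
qed

text \<open>The new scalar enters the first factor from the left, whereas the balancing relation
  moves scalars on its right; associativity makes the two compatible.\<close>

lemma lact_smash_over:
  assumes a: "a \<in> R j" and r: "(k, l, v, x, y) \<in> reps n"
  shows "lact MN j n a (cls n (k, l, v, x, y)) =
    cls (j * n) (j * k, l, psmash j (k * l) n (pid j) v, H_mult j k a x, y)"
proof -
  define h where "h = (\<lambda>(k, l, v, x, y). (j * k, l, psmash j (k * l) n (pid j) v, H_mult j k a x, y :: nat \<Rightarrow> 'a))"
  have h_reps: "r \<in> reps n \<Longrightarrow> h r \<in> reps (j * n)" for r
    using psmash_pmaps[OF pid_pmaps, of _ _ n j] a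
    by (auto simp: h_def day_reps_def mult_mem mult.assoc)
  have "lact MN j n a C = (\<Union>B\<in>C. \<Union>s\<in>B. cls (j * n) (h s))" for C
    by (simp add: smash_over_def gamma.defs s_mod.defs h_def case_prod_unfold)
  moreover have "(\<Union>B\<in>cls n (k, l, v, x, y). \<Union>s\<in>B. cls (j * n) (h s)) = cls (j * n) (h (k, l, v, x, y))"
  proof (rule cls_UN[OF r])
    show "cls (j * n) (h s) = cls (j * n) (h s')" if "(s, s') \<in> gens n" for s s'
      using that
    proof (cases rule: gensE)
      case (map k l k' l' v f g s t)
      let ?f = "psmash j k k' (pid j) f" and ?v = "psmash j (k' * l') n (pid j) v"
      have f: "?f \<in> pmaps (j * k) (j * k')" by (intro psmash_pmaps pid_pmaps map)
      have v: "?v \<in> pmaps (j * k' * l') (j * n)"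
        using psmash_pmaps[OF pid_pmaps map(5), of j] by (simp add: mult.assoc)
      \<comment> \<open>Writing the identity as a composite of two identities makes the interchange
        law \<open>psmash_pcomp\<close> applicable.\<close>
      have "psmash j (k * l) n (pid j) (pcomp (k * l) v (psmash k l l' f g)) =
        psmash j (k * l) n (pcomp j (pid j) (pid j)) (pcomp (k * l) v (psmash k l l' f g))"
        by (simp add: pcomp_pid[OF pid_pmaps])
      also have "\<dots> = pcomp (j * (k * l)) ?v (psmash j (k * l) (k' * l') (pid j) (psmash k l l' f g))"
        by (rule psmash_pcomp[OF pid_pmaps pid_pmaps psmash_pmaps]) (fact map)+
      also have "\<dots> = pcomp (j * k * l) ?v (psmash (j * k) l l' ?f g)"
        by (subst psmash_assoc[OF pid_pmaps map(3,4)]) (simp add: mult.assoc)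
      finally have "h (k, l, pcomp (k * l) v (psmash k l l' f g), s, t) =
          (j * k, l, pcomp (j * k * l) ?v (psmash (j * k) l l' ?f g), H_mult j k a s, t)"
        by (simp add: h_def)
      moreover have "H_mult j k' a (H_map k k' f s) = H_map (j * k) (j * k') ?f (H_mult j k a s)"
        using H_mult_natural[OF pid_pmaps map(3), of j a s] map_pid_scalar[OF a] by simp
      ultimately show ?thesis
        using cls_gens[OF gens_mapI[OF f map(4) v mult_mem(1)[OF a map(6)] map(7)]]
        by (simp add: map h_def)
    next
      case (pt k l v s t k' l' v' s' t')
      then show ?thesis using h_reps[OF pt(3)] h_reps[OF pt(4)]
        by (auto simp: h_def intro!: cls_gens gens_ptI)
    qed
    show "cls (j * n) (h (k * l, m, v, H_mult k l x b, y)) = cls (j * n) (h (k, l * m, v, x, H_mult l m b y))"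
      if "v \<in> pmaps (k * l * m) n" "x \<in> E k" "b \<in> R l" "y \<in> F m" for k l m v x b y
    proof -
      have v: "psmash j (k * l * m) n (pid j) v \<in> pmaps (j * k * l * m) (j * n)"
        using psmash_pmaps[OF pid_pmaps that(1), of j] by (simp add: mult.assoc)
      show ?thesis using cls_scalar[OF v mult_mem(1)[OF a that(2)] that(3,4)]
        by (simp add: h_def mult.assoc H_mult_assoc)
    qed
  qed
  ultimately show ?thesis by (simp add: h_def)
qed

text \<open>Naturality of the product yields invariance under the Day relations, its associativity
  invariance under moving scalars.\<close>

lemma smash_value_invariant:
  assumes "r \<in> reps n" "r' \<in> reps n" "cls n r' = cls n r"
  shows "smash_value n r' = smash_value n r"
proof -
  have "dcls n r' \<in> cls n r" using cls_refl[of n r'] assms by simp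
  then show ?thesis
  proof (rule cls_invariant[OF assms(1) _ dcls_refl])
    show "smash_value n s = smash_value n s'" if "(s, s') \<in> gens n" for s s'
      using that
    proof (cases rule: gensE)
      case (map k l k' l' v f g s t)
      then show ?thesis
        by (simp add: smash_value_def H_mult_natural H_map_comp[OF psmash_pmaps])
    qed (auto simp: smash_value_def)
  qed (simp add: smash_value_def H_mult_assoc mult.assoc)
qed

lemma smash_value_map:
  assumes "f \<in> pmaps n m" "(k, l, v, x, y) \<in> reps n"
  shows "smash_value m (k, l, pcomp (k * l) f v, x, y) = H_map n m f (smash_value n (k, l, v, x, y))"
  using assms by (simp add: smash_value_def day_reps_def H_map_comp)

lemma smash_value_lact:
  assumes "a \<in> R j" "(k, l, v, x, y) \<in> reps n"
  shows "smash_value (j * n) (j * k, l, psmash j (k * l) n (pid j) v, H_mult j k a x, y) =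
    H_mult j n a (smash_value n (k, l, v, x, y))"
proof -
  have "v \<in> pmaps (k * l) n" using assms by (simp add: day_reps_def)
  from H_mult_natural[OF pid_pmaps this, of j a "H_mult k l x y"] show ?thesis
    using map_pid_scalar[OF assms(1)] by (simp add: smash_value_def H_mult_assoc mult.assoc)
qed

end


section \<open>Valuations\<close>

text \<open>Cross-multiplication with the reduced fraction frees the valuation from lowest
  terms.\<close>

lemma vp_divide:
  assumes p: "prime p" and a: "a \<noteq> 0" and b: "b \<noteq> 0" and q: "q = of_int a / of_int b"
  shows "vp p q = int (multiplicity (int p) a) - int (multiplicity (int p) b)"
proof -
  obtain c d where cd: "quotient_of q = (c, d)" by force
  have d: "d > 0" by (rule quotient_of_denom_pos[OF cd])
  have "of_int a / of_int b = (of_int c / of_int d :: rat)" using quotient_of_div[OF cd] q by simp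
  then have "(of_int (a * d) :: rat) = of_int (c * b)" using b d by (simp add: field_simps)
  then have eq: "a * d = c * b" by (simp only: of_int_eq_iff)
  then have c: "c \<noteq> 0" using a d by auto
  have P: "prime_elem (int p)" using p by simp
  have "multiplicity (int p) a + multiplicity (int p) d = multiplicity (int p) c + multiplicity (int p) b"
    using arg_cong[OF eq, of "multiplicity (int p)"] a b c d
    by (simp add: prime_elem_multiplicity_mult_distrib[OF P])
  then show ?thesis by (simp add: vp_def cd)
qed

lemma rat_fractionE:
  fixes q :: rat
  assumes "q \<noteq> 0"
  obtains a b where "a \<noteq> 0" "b \<noteq> 0" "q = of_int a / of_int b"
proof -
  obtain a b where ab: "quotient_of q = (a, b)" by force
  have "b > 0" "q = of_int a / of_int b" using quotient_of_denom_pos[OF ab] quotient_of_div[OF ab] .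
  with assms show ?thesis by (intro that[of a b]) auto
qed

lemma vp_mult:
  assumes p: "prime p" and "x \<noteq> 0" "y \<noteq> 0"
  shows "vp p (x * y) = vp p x + vp p y"
proof -
  obtain a b where x: "a \<noteq> 0" "b \<noteq> 0" "x = of_int a / of_int b" using rat_fractionE[OF assms(2)] .
  obtain c d where y: "c \<noteq> 0" "d \<noteq> 0" "y = of_int c / of_int d" using rat_fractionE[OF assms(3)] .
  have P: "prime_elem (int p)" using p by simp
  have "vp p (x * y) = int (multiplicity (int p) (a * c)) - int (multiplicity (int p) (b * d))"
    using x y by (intro vp_divide[OF p]) auto
  then show ?thesis unfolding vp_divide[OF p x] vp_divide[OF p y] using x(1,2) y(1,2)
    by (simp add: prime_elem_multiplicity_mult_distrib[OF P])
qed

lemma vp_one: "prime p \<Longrightarrow> vp p 1 = 0"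
  using vp_divide[of p 1 1 1] by simp

lemma vp_inverse: "prime p \<Longrightarrow> x \<noteq> 0 \<Longrightarrow> vp p (inverse x) = - vp p x"
  using vp_mult[of p x "inverse x"] by (simp add: vp_one)

lemma vp_quotient: "prime p \<Longrightarrow> x \<noteq> 0 \<Longrightarrow> y \<noteq> 0 \<Longrightarrow> vp p (x / y) = vp p x - vp p y"
  by (simp add: divide_inverse vp_mult vp_inverse)

lemma vp_of_int: "prime p \<Longrightarrow> a \<noteq> 0 \<Longrightarrow> vp p (of_int a) = int (multiplicity (int p) a)"
  using vp_divide[of p a 1 "of_int a"] by simp

lemma vp_add:
  assumes p: "prime p" and "x \<noteq> 0" "y \<noteq> 0" "x + y \<noteq> 0" and m: "vp p x \<ge> m" "vp p y \<ge> m"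
  shows "vp p (x + y) \<ge> m"
proof -
  obtain a b where x: "a \<noteq> 0" "b \<noteq> 0" "x = of_int a / of_int b" using rat_fractionE[OF assms(2)] .
  obtain c d where y: "c \<noteq> 0" "d \<noteq> 0" "y = of_int c / of_int d" using rat_fractionE[OF assms(3)] .
  have P: "prime_elem (int p)" using p by simp
  have nz: "a * d + c * b \<noteq> 0"
  proof
    assume "a * d + c * b = 0"
    moreover have "x + y = of_int (a * d + c * b) / of_int (b * d)" using x y by (simp add: field_simps)
    ultimately show False using assms(4) by simp
  qed
  let ?v = "multiplicity (int p)"
  \<comment> \<open>Over the common denominator \<open>b * d\<close> both numerators are divisible
    by this power of p. Truncation by \<open>nat\<close> is harmless: p ^ 0 divides everything, and
    \<open>int e\<close> is still at least the wanted exponent.\<close>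
  define e where "e = nat (m + int (?v (b * d)))"
  have bd: "?v (b * d) = ?v b + ?v d" "?v (a * d) = ?v a + ?v d" "?v (c * b) = ?v c + ?v b"
    using x y by (simp_all add: prime_elem_multiplicity_mult_distrib[OF P])
  have "e \<le> ?v (a * d)" "e \<le> ?v (c * b)"
    using m unfolding e_def bd vp_divide[OF p x] vp_divide[OF p y] by linarith+
  then have "int p ^ e dvd a * d + c * b" by (intro dvd_add multiplicity_dvd')
  then have "e \<le> ?v (a * d + c * b)" using nz p
    by (intro multiplicity_geI) (auto simp: prime_nat_iff)
  moreover have "vp p (x + y) = int (?v (a * d + c * b)) - int (?v (b * d))"
    using x y nz by (intro vp_divide[OF p]) (auto simp: field_simps)
  ultimately show ?thesis unfolding e_def by linarith
qed

lemma vp_prod: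
  assumes p: "prime p" and "finite S" "\<And>s. s \<in> S \<Longrightarrow> f s \<noteq> 0"
  shows "vp p (prod f S) = (\<Sum>s\<in>S. vp p (f s))"
  using assms(2,3) by (induction S) (auto simp: vp_one p vp_mult)

lemma vp_power: "prime p \<Longrightarrow> x \<noteq> 0 \<Longrightarrow> vp p (x ^ k) = int k * vp p x"
  by (induction k) (simp_all add: vp_one vp_mult algebra_simps)

lemma vp_power_int: "prime p \<Longrightarrow> x \<noteq> 0 \<Longrightarrow> vp p (x powi k) = k * vp p x"
  by (simp add: power_int_def vp_power vp_inverse)

lemma vp_prime:
  assumes p: "prime p" and q: "prime q"
  shows "vp p (of_nat q) = (if p = q then 1 else 0)"
proof -
  have "multiplicity (int p) (int q) = (if p = q then 1 else 0)"
  proof (cases "p = q")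
    case True
    then show ?thesis using p by (auto simp: prime_nat_iff intro!: multiplicity_self)
  next
    case False
    then have "\<not> int p dvd int q" using primes_dvd_imp_eq[OF p q] by auto
    then show ?thesis using False by (simp add: not_dvd_imp_multiplicity_0)
  qed
  then show ?thesis using vp_of_int[OF p, of "int q"] q by auto
qed

text \<open>Such a prime divides the numerator or the denominator of a chosen fraction a / b, so it
  is at most the absolute value of a b.\<close>

lemma finite_vp_support:
  assumes "x \<noteq> 0" shows "finite {p. prime p \<and> vp p x \<noteq> 0}"
proof -
  obtain a b where x: "a \<noteq> 0" "b \<noteq> 0" "x = of_int a / of_int b" using rat_fractionE[OF assms] .
  have "p \<le> nat \<bar>a * b\<bar>" if p: "prime p" "vp p x \<noteq> 0" for p
  proof -
    have "multiplicity (int p) a \<noteq> 0 \<or> multiplicity (int p) b \<noteq> 0"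
      using p vp_divide[OF p(1) x] by auto
    then have "int p dvd a * b" using not_dvd_imp_multiplicity_0 by (metis dvd_mult dvd_mult2)
    then have "int p \<le> \<bar>a * b\<bar>" using x dvd_imp_le_int[of "a * b" "int p"] by simp
    then show ?thesis by linarith
  qed
  then have "{p. prime p \<and> vp p x \<noteq> 0} \<subseteq> {..nat \<bar>a * b\<bar>}" by auto
  then show ?thesis using finite_subset by blast
qed

text \<open>The class number of \<open>\<int>\<close> is one.\<close>

lemma ex_generator:
  assumes fin: "finite {p. n p \<noteq> 0}" and pr: "\<And>p. n p \<noteq> 0 \<Longrightarrow> prime p"
  obtains c where "c \<noteq> 0" "\<And>p. prime p \<Longrightarrow> vp p c = - n p"
proof
  let ?S = "{p. n p \<noteq> 0}" and ?f = "\<lambda>p. (of_nat p :: rat) powi (- n p)"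
  have n0: "n 0 = 0" using pr[of 0] by (cases "n 0 = 0") simp_all
  have nz: "?f p \<noteq> 0" if "p \<in> ?S" for p using pr[of p] prime_gt_0_nat[of p] that by (auto simp: power_int_eq_0_iff)
  show "prod ?f ?S \<noteq> 0" using fin nz n0 by simp
  fix p :: nat assume p: "prime p"
  have "vp p (prod ?f ?S) = (\<Sum>s\<in>?S. vp p (?f s))" by (rule vp_prod[OF p fin nz])
  also have "\<dots> = (\<Sum>s\<in>?S. if s = p then - n p else 0)"
    by (intro sum.cong refl) (auto simp: vp_power_int p vp_prime pr prime_gt_0_nat n0)
  also have "\<dots> = - n p" using fin by (simp add: sum.delta')
  finally show "vp p (prod ?f ?S) = - n p" .
qed

text \<open>In lowest terms a prime cannot divide both numerator and denominator, so it divides the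
  denominator exactly when the valuation is negative. This brings the structure sheaf under the
  treatment of divisors.\<close>

lemma O_SpecZ_eq: "O_SpecZ V = O_fin (\<lambda>_. 0) V"
proof -
  have "\<not> int p dvd snd (quotient_of q) \<longleftrightarrow> q = 0 \<or> vp p q \<ge> 0" if p: "prime p" for p q
  proof (cases "q = 0")
    case True
    then show ?thesis using p by (auto simp: prime_nat_iff)
  next
    case False
    obtain a b where ab: "quotient_of q = (a, b)" by force
    then have cop: "coprime a b" and b: "b > 0" using quotient_of_coprime quotient_of_denom_pos by blast+
    have np: "\<not> is_unit (int p)" using p by (auto simp: prime_nat_iff)
    have a: "a \<noteq> 0" using quotient_of_div[OF ab] False by auto
    show ?thesis
    proof (cases "int p dvd b")
      case True
      then have "\<not> int p dvd a" using cop np coprime_common_divisor by blast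
      then have "multiplicity (int p) a = 0" by (rule not_dvd_imp_multiplicity_0)
      moreover have "multiplicity (int p) b > 0"
        using True b np by (simp add: multiplicity_gt_zero_iff)
      ultimately show ?thesis using True False by (simp add: vp_def ab)
    next
      case nb: False
      then have "multiplicity (int p) b = 0" by (rule not_dvd_imp_multiplicity_0)
      then show ?thesis using nb False by (simp add: vp_def ab)
    qed
  qed
  then show ?thesis unfolding O_SpecZ_def O_fin_def by auto
qed

lemma O_fin_SpecZ: "O_fin n (V \<inter> SpecZ) = O_fin n V"
  by (auto simp: O_fin_def SpecZ_def prime_places_def)

lemma O_fin_zero: "0 \<in> O_fin n V"
  by (simp add: O_fin_def)

lemma O_fin_add: "x \<in> O_fin n V \<Longrightarrow> y \<in> O_fin n V \<Longrightarrow> x + y \<in> O_fin n V"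
  using vp_add[where m = "- n _"] unfolding O_fin_def
  by (cases "x = 0"; cases "y = 0") (auto, smt (verit, ccfv_threshold))

lemma O_fin_mult: "x \<in> O_fin n V \<Longrightarrow> y \<in> O_fin n' V \<Longrightarrow> x * y \<in> O_fin (\<lambda>p. n p + n' p) V"
  unfolding O_fin_def by (auto simp: vp_mult) (smt (verit))

lemma O_fin_mono: "V \<subseteq> U \<Longrightarrow> O_fin n U \<subseteq> O_fin n V"
  by (auto simp: O_fin_def)


section \<open>Open sets\<close>

text \<open>Since the generic point lies in all non-empty open sets, any two of them meet; this is
  why a section is determined by its value at the generic point.\<close>

lemma open_generic: "is_open U \<Longrightarrow> U \<noteq> {} \<Longrightarrow> Pt 0 \<in> U"
  by (auto simp: is_open_def SpecZ_bar_def SpecZ_def prime_places_def)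

lemma open_Int:
  assumes "is_open U" "is_open V" shows "is_open (U \<inter> V)"
proof (cases "U = {} \<or> V = {}")
  case True
  then show ?thesis by (auto simp: is_open_def)
next
  case False
  then obtain P Q where P: "finite P" "P \<subseteq> prime_places" "U = SpecZ_bar - P \<or> U = SpecZ_bar - P - {Infty}"
    and Q: "finite Q" "Q \<subseteq> prime_places" "V = SpecZ_bar - Q \<or> V = SpecZ_bar - Q - {Infty}"
    using assms by (auto simp: is_open_def)
  have "U \<inter> V = SpecZ_bar - (P \<union> Q) \<or> U \<inter> V = SpecZ_bar - (P \<union> Q) - {Infty}"
    using P(3) Q(3) by auto
  then show ?thesis unfolding is_open_def using P Q by (metis finite_UnI Un_least)
qed

lemma open_remove_primes:
  assumes "is_open U" "finite P" "P \<subseteq> prime_places" shows "is_open (U - P)"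
proof (cases "U = {}")
  case False
  have "is_open (SpecZ_bar - P)" using assms by (auto simp: is_open_def)
  from open_Int[OF assms(1) this] show ?thesis
    using assms(1) by (elim back_subst[of is_open]) (auto simp: is_open_def)
qed (simp add: is_open_def)

lemma open_remove_Infty:
  assumes "is_open U" shows "is_open (U - {Infty})"
proof -
  have "is_open (SpecZ_bar - {} - {Infty})" unfolding is_open_def by blast
  from open_Int[OF assms this] show ?thesis
    using assms by (elim back_subst[of is_open]) (auto simp: is_open_def)
qed

lemma open_SpecZ: "is_open SpecZ"
proof -
  have "SpecZ = SpecZ_bar - {} - {Infty}" by (auto simp: SpecZ_bar_def SpecZ_def prime_places_def)
  then show ?thesis unfolding is_open_def by blast
qed

text \<open>The divisors and the non-zero elements of Q involve only finitely many primes. Removing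
  these keeps \<open>Infty\<close> and makes the divisors trivial and those elements units, so near
  \<open>Infty\<close> only the norm constrains finitely many given rationals.\<close>

lemma shrink_open:
  assumes U: "is_open U" and x: "Infty \<in> U" and Q: "finite Q"
    and n: "finite {p. n p \<noteq> 0}" and n': "finite {p. n' p \<noteq> 0}"
  obtains W where "is_open W" "W \<subseteq> U" "Infty \<in> W" "Q \<subseteq> O_fin n W" "Q \<subseteq> O_fin n' W" "Q \<subseteq> O_fin (\<lambda>_. 0) W"
proof
  define B where "B = {p. prime p \<and> n p \<noteq> 0} \<union> {p. prime p \<and> n' p \<noteq> 0} \<union>
    (\<Union>q\<in>Q - {0}. {p. prime p \<and> vp p q \<noteq> 0})"
  have "finite B" unfolding B_def using Q finite_vp_support n n' by auto
  then show "is_open (U - Pt ` B)"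
    by (intro open_remove_primes U) (auto simp: B_def prime_places_def)
  show "Infty \<in> U - Pt ` B" using x by auto
  show "U - Pt ` B \<subseteq> U" by blast
  have *: "n p = 0" "n' p = 0" "\<And>q. q \<in> Q \<Longrightarrow> q \<noteq> 0 \<Longrightarrow> vp p q = 0" if "prime p" "Pt p \<in> U - Pt ` B" for p
    using that by (auto simp: B_def)
  then show "Q \<subseteq> O_fin n (U - Pt ` B)" "Q \<subseteq> O_fin n' (U - Pt ` B)" "Q \<subseteq> O_fin (\<lambda>_. 0) (U - Pt ` B)"
    unfolding O_fin_def by auto
qed


section \<open>Isomorphisms of sheaves of modules\<close>

text \<open>\<open>iso_modules\<close> compares operations without asserting that they stay inside
  the carriers. This closure is what allows the compatibilities of an isomorphism to be transferred
  to its inverse.\<close>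

definition module_closed :: "'r alg_presheaf \<Rightarrow> ('r, 'a) mod_presheaf \<Rightarrow> bool" where
  "module_closed \<O> M \<longleftrightarrow> (\<forall>U. is_open U \<longrightarrow>
     (\<forall>n. pt (mval M U) n \<in> el (mval M U) n) \<and>
     (\<forall>n m. \<forall>f\<in>pmaps n m. \<forall>x\<in>el (mval M U) n. mp (mval M U) n m f x \<in> el (mval M U) m) \<and>
     (\<forall>k n. \<forall>a\<in>el (aval \<O> U) k. \<forall>x\<in>el (mval M U) n. lact (mval M U) k n a x \<in> el (mval M U) (k * n)) \<and>
     (\<forall>V n. is_open V \<and> V \<subseteq> U \<longrightarrow> (\<forall>x\<in>el (mval M U) n. mres M U V n x \<in> el (mval M V) n)))"

lemma iso_modules_sym:
  assumes cl: "module_closed \<O> M" and iso: "iso_modules \<O> M N"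
  shows "iso_modules \<O> N M"
proof -
  from iso obtain \<phi> where \<phi>: "\<And>U. is_open U \<Longrightarrow>
     (\<forall>n. bij_betw (\<phi> U n) (el (mval M U) n) (el (mval N U) n) \<and>
          \<phi> U n (pt (mval M U) n) = pt (mval N U) n) \<and>
     (\<forall>n m. \<forall>f\<in>pmaps n m. \<forall>x\<in>el (mval M U) n.
          \<phi> U m (mp (mval M U) n m f x) = mp (mval N U) n m f (\<phi> U n x)) \<and>
     (\<forall>k n. \<forall>a\<in>el (aval \<O> U) k. \<forall>x\<in>el (mval M U) n.
          \<phi> U (k * n) (lact (mval M U) k n a x) = lact (mval N U) k n a (\<phi> U n x)) \<and>
     (\<forall>V n. is_open V \<and> V \<subseteq> U \<longrightarrow> (\<forall>x\<in>el (mval M U) n.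
          \<phi> V n (mres M U V n x) = mres N U V n (\<phi> U n x)))"
    unfolding iso_modules_def by metis
  define \<psi> where "\<psi> U n = inv_into (el (mval M U) n) (\<phi> U n)" for U n
  have \<psi>: "\<psi> U n (\<phi> U n x) = x" if "is_open U" "x \<in> el (mval M U) n" for U n x
    unfolding \<psi>_def using \<phi>[OF that(1)] that(2) by (intro inv_into_f_f) (auto simp: bij_betw_def)
  have ex: "\<exists>x\<in>el (mval M U) n. y = \<phi> U n x" if "is_open U" "y \<in> el (mval N U) n" for U n y
    using \<phi>[OF that(1)] that(2) by (auto simp: bij_betw_def image_iff set_eq_iff)
  show ?thesis unfolding iso_modules_def
  proof (intro exI[of _ \<psi>] allI impI conjI ballI)
    fix U n assume U: "is_open U"
    show "bij_betw (\<psi> U n) (el (mval N U) n) (el (mval M U) n)"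
      unfolding \<psi>_def using \<phi>[OF U] by (intro bij_betw_inv_into) blast
    show "\<psi> U n (pt (mval N U) n) = pt (mval M U) n"
      using \<psi>[OF U, of "pt (mval M U) n" n] \<phi>[OF U] cl U by (simp add: module_closed_def)
  next
    fix U n m f y assume *: "is_open U" "f \<in> pmaps n m" "y \<in> el (mval N U) n"
    then obtain x where "x \<in> el (mval M U) n" "y = \<phi> U n x" using ex by blast
    then show "\<psi> U m (mp (mval N U) n m f y) = mp (mval M U) n m f (\<psi> U n y)"
      using \<psi>[OF *(1), of "mp (mval M U) n m f x" m] \<psi>[OF *(1)] \<phi>[OF *(1)] cl * by (simp add: module_closed_def)
  next
    fix U k n a y assume *: "is_open U" "a \<in> el (aval \<O> U) k" "y \<in> el (mval N U) n"
    then obtain x where "x \<in> el (mval M U) n" "y = \<phi> U n x" using ex by blast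
    then show "\<psi> U (k * n) (lact (mval N U) k n a y) = lact (mval M U) k n a (\<psi> U n y)"
      using \<psi>[OF *(1), of "lact (mval M U) k n a x" "k * n"] \<psi>[OF *(1)] \<phi>[OF *(1)] cl * by (simp add: module_closed_def)
  next
    fix U V n y assume *: "is_open U" "is_open V \<and> V \<subseteq> U" "y \<in> el (mval N U) n"
    then obtain x where "x \<in> el (mval M U) n" "y = \<phi> U n x" using ex by blast
    then show "\<psi> V n (mres N U V n y) = mres M U V n (\<psi> U n y)"
      using \<psi>[of V "mres M U V n x" n] \<psi>[OF *(1)] \<phi>[OF *(1)] cl * by (simp add: module_closed_def)
  qed
qed

lemma iso_modules_trans:
  assumes "iso_modules \<O> L M" "iso_modules \<O> M N"
  shows "iso_modules \<O> L N"
proof -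
  let ?iso = "\<lambda>L M \<phi>. \<forall>U. is_open U \<longrightarrow>
     (\<forall>n. bij_betw (\<phi> U n) (el (mval L U) n) (el (mval M U) n) \<and>
          \<phi> U n (pt (mval L U) n) = pt (mval M U) n) \<and>
     (\<forall>n m. \<forall>f\<in>pmaps n m. \<forall>x\<in>el (mval L U) n.
          \<phi> U m (mp (mval L U) n m f x) = mp (mval M U) n m f (\<phi> U n x)) \<and>
     (\<forall>k n. \<forall>a\<in>el (aval \<O> U) k. \<forall>x\<in>el (mval L U) n.
          \<phi> U (k * n) (lact (mval L U) k n a x) = lact (mval M U) k n a (\<phi> U n x)) \<and>
     (\<forall>V n. is_open V \<and> V \<subseteq> U \<longrightarrow> (\<forall>x\<in>el (mval L U) n.
          \<phi> V n (mres L U V n x) = mres M U V n (\<phi> U n x)))"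
  obtain \<phi> \<psi> where \<phi>: "?iso L M \<phi>" and \<psi>: "?iso M N \<psi>"
    using assms unfolding iso_modules_def by (elim exE)
  have bij: "bij_betw (\<phi> U n) (el (mval L U) n) (el (mval M U) n)"
    "bij_betw (\<psi> U n) (el (mval M U) n) (el (mval N U) n)" if "is_open U" for U n
    using \<phi>[rule_format, OF that] \<psi>[rule_format, OF that] by simp_all
  have mem: "\<phi> U n x \<in> el (mval M U) n" if "is_open U" "x \<in> el (mval L U) n" for U n x
    using bij(1)[OF that(1)] that(2) by (rule bij_betw_apply)
  show ?thesis unfolding iso_modules_def
  proof (intro exI[of _ "\<lambda>U n. \<psi> U n \<circ> \<phi> U n"] allI impI conjI ballI)
    fix U n assume "is_open U"
    then show "bij_betw (\<psi> U n \<circ> \<phi> U n) (el (mval L U) n) (el (mval N U) n)"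
      using bij_betw_trans[OF bij] by blast
  qed (use \<phi> \<psi> mem in simp_all)
qed


section \<open>Sheaves associated to locally injective presheaves over \<open>H\<rat>\<close>\<close>

text \<open>Here \<theta> is a map from P to the constant sheaf H Q that is injective on germs
  (\<open>inj_P\<close>), and T consists of the vectors locally in its image (\<open>T_iff\<close>).
  These data identify the sheaf associated to P with T. The empty set is left out because its value
  is fixed separately.\<close>

locale H_presheaf =
  fixes S T :: "place set \<Rightarrow> nat \<Rightarrow> (nat \<Rightarrow> rat) set"
    and P :: "(nat \<Rightarrow> rat, 'e) mod_presheaf"
    and \<theta> :: "place set \<Rightarrow> nat \<Rightarrow> 'e \<Rightarrow> nat \<Rightarrow> rat"
  assumes S_mono: "is_open U \<Longrightarrow> is_open V \<Longrightarrow> V \<subseteq> U \<Longrightarrow> V \<noteq> {} \<Longrightarrow> S U k \<subseteq> S V k"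
    and pt_P: "is_open U \<Longrightarrow> U \<noteq> {} \<Longrightarrow> pt (mval P U) n \<in> el (mval P U) n \<and> \<theta> U n (pt (mval P U) n) = (\<lambda>_. 0)"
    and mp_P: "is_open U \<Longrightarrow> U \<noteq> {} \<Longrightarrow> f \<in> pmaps n m \<Longrightarrow> s \<in> el (mval P U) n \<Longrightarrow>
      mp (mval P U) n m f s \<in> el (mval P U) m \<and> \<theta> U m (mp (mval P U) n m f s) = H_map n m f (\<theta> U n s)"
    and lact_P: "is_open U \<Longrightarrow> U \<noteq> {} \<Longrightarrow> a \<in> S U k \<Longrightarrow> s \<in> el (mval P U) n \<Longrightarrow>
      lact (mval P U) k n a s \<in> el (mval P U) (k * n) \<and>
      \<theta> U (k * n) (lact (mval P U) k n a s) = H_mult k n a (\<theta> U n s)"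
    and res_P: "is_open U \<Longrightarrow> is_open V \<Longrightarrow> V \<subseteq> U \<Longrightarrow> V \<noteq> {} \<Longrightarrow> s \<in> el (mval P U) n \<Longrightarrow>
      mres P U V n s \<in> el (mval P V) n \<and> \<theta> V n (mres P U V n s) = \<theta> U n s"
    and res_res_P: "is_open U \<Longrightarrow> is_open V \<Longrightarrow> is_open W \<Longrightarrow> V \<subseteq> U \<Longrightarrow> W \<subseteq> V \<Longrightarrow> W \<noteq> {} \<Longrightarrow> s \<in> el (mval P U) n \<Longrightarrow>
      mres P V W n (mres P U V n s) = mres P U W n s"
    and inj_P: "is_open U \<Longrightarrow> x \<in> U \<Longrightarrow> s \<in> el (mval P U) n \<Longrightarrow> t \<in> el (mval P U) n \<Longrightarrow> \<theta> U n s = \<theta> U n t \<Longrightarrow>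
      \<exists>W. is_open W \<and> x \<in> W \<and> W \<subseteq> U \<and> mres P U W n s = mres P U W n t"
    and T_iff: "is_open U \<Longrightarrow> U \<noteq> {} \<Longrightarrow> z \<in> T U n \<longleftrightarrow>
      (\<forall>x\<in>U. \<exists>V s. is_open V \<and> x \<in> V \<and> V \<subseteq> U \<and> s \<in> el (mval P V) n \<and> \<theta> V n s = z)"
begin

section \<open>Stability of the local image\<close>

lemma T_E:
  assumes "is_open U" "z \<in> T U n" "x \<in> U"
  obtains V s where "is_open V" "x \<in> V" "V \<subseteq> U" "s \<in> el (mval P V) n" "\<theta> V n s = z"
  using assms T_iff[of U z n] by auto

lemma T_I:
  assumes "is_open U" "U \<noteq> {}"
    and "\<And>x. x \<in> U \<Longrightarrow> \<exists>V s. is_open V \<and> x \<in> V \<and> V \<subseteq> U \<and> s \<in> el (mval P V) n \<and> \<theta> V n s = z"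
  shows "z \<in> T U n"
  using assms T_iff[of U z n] by auto

lemma T_zero: "is_open U \<Longrightarrow> U \<noteq> {} \<Longrightarrow> (\<lambda>_. 0) \<in> T U n"
  using pt_P by (intro T_I) blast+

lemma T_map:
  assumes "is_open U" "f \<in> pmaps n m" "z \<in> T U n" "U \<noteq> {}"
  shows "H_map n m f z \<in> T U m"
proof (intro T_I assms)
  fix x assume x: "x \<in> U"
  obtain V s where V: "is_open V" "x \<in> V" "V \<subseteq> U" "s \<in> el (mval P V) n" "\<theta> V n s = z"
    using T_E[OF assms(1,3) x] .
  then show "\<exists>V s. is_open V \<and> x \<in> V \<and> V \<subseteq> U \<and> s \<in> el (mval P V) m \<and> \<theta> V m s = H_map n m f z"
    using mp_P[OF V(1) _ assms(2) V(4)] by blast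
qed

lemma T_mult:
  assumes "is_open U" "a \<in> S U k" "z \<in> T U n" "U \<noteq> {}"
  shows "H_mult k n a z \<in> T U (k * n)"
proof (intro T_I assms)
  fix x assume x: "x \<in> U"
  obtain V s where V: "is_open V" "x \<in> V" "V \<subseteq> U" "s \<in> el (mval P V) n" "\<theta> V n s = z"
    using T_E[OF assms(1,3) x] .
  then have "a \<in> S V k" using S_mono[OF assms(1) V(1,3)] assms(2) by blast
  then show "\<exists>V s. is_open V \<and> x \<in> V \<and> V \<subseteq> U \<and> s \<in> el (mval P V) (k * n) \<and> \<theta> V (k * n) s = H_mult k n a z"
    using lact_P[OF V(1) _ _ V(4)] V by blast
qed

lemma T_mono:
  assumes "is_open U" "is_open V" "V \<subseteq> U" "V \<noteq> {}" "z \<in> T U n"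
  shows "z \<in> T V n"
proof (intro T_I assms)
  fix x assume x: "x \<in> V"
  obtain W s where W: "is_open W" "x \<in> W" "W \<subseteq> U" "s \<in> el (mval P W) n" "\<theta> W n s = z"
    using T_E[OF assms(1,5)] x assms(3) by blast
  have "is_open (W \<inter> V)" by (intro open_Int W assms)
  from res_P[OF W(1) this _ _ W(4)] x W
  show "\<exists>W s. is_open W \<and> x \<in> W \<and> W \<subseteq> V \<and> s \<in> el (mval P W) n \<and> \<theta> W n s = z"
    using \<open>is_open (W \<inter> V)\<close> by (intro exI[of _ "W \<inter> V"]) auto
qed

lemma closed_T: "module_closed (HQ_subalg S) (HQ_submod T)"
  unfolding module_closed_def HQ_subalg_def HQ_submod_def
  by (auto simp: T_zero T_map T_mult HQ_res_def intro: T_mono)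

definition fibre :: "place \<Rightarrow> nat \<Rightarrow> (nat \<Rightarrow> rat) \<Rightarrow> 'e germ" where
  "fibre x n z = {(V, t). is_open V \<and> x \<in> V \<and> t \<in> el (mval P V) n \<and> \<theta> V n t = z}"

text \<open>Local sections at x with equal values agree after shrinking by \<open>inj_P\<close>, and
  restriction preserves values; hence a germ is determined by its value and consists of all local
  sections with that value.\<close>

lemma germ_eq_fibre:
  assumes U: "is_open U" "x \<in> U" and s: "s \<in> el (mval P U) n"
  shows "germ P x n U s = fibre x n (\<theta> U n s)"
proof -
  have "(\<exists>W. is_open W \<and> x \<in> W \<and> W \<subseteq> U \<inter> V \<and> mres P U W n s = mres P V W n t) \<longleftrightarrow> \<theta> V n t = \<theta> U n s"
    if V: "is_open V" "x \<in> V" and t: "t \<in> el (mval P V) n" for V t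
  proof
    assume "\<exists>W. is_open W \<and> x \<in> W \<and> W \<subseteq> U \<inter> V \<and> mres P U W n s = mres P V W n t"
    then obtain W where "is_open W" "x \<in> W" "W \<subseteq> U" "W \<subseteq> V" "mres P U W n s = mres P V W n t" by blast
    then show "\<theta> V n t = \<theta> U n s" using res_P U V s t by (metis empty_iff)
  next
    assume eq: "\<theta> V n t = \<theta> U n s"
    let ?I = "U \<inter> V"
    have I: "is_open ?I" "x \<in> ?I" "?I \<subseteq> U" "?I \<subseteq> V" "?I \<noteq> {}" using U V open_Int by auto
    have rs: "mres P U ?I n s \<in> el (mval P ?I) n \<and> \<theta> ?I n (mres P U ?I n s) = \<theta> U n s"
      by (rule res_P[OF U(1) I(1,3,5) s])
    have rt: "mres P V ?I n t \<in> el (mval P ?I) n \<and> \<theta> ?I n (mres P V ?I n t) = \<theta> V n t"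
      by (rule res_P[OF V(1) I(1,4,5) t])
    obtain W where W: "is_open W" "x \<in> W" "W \<subseteq> ?I"
      "mres P ?I W n (mres P U ?I n s) = mres P ?I W n (mres P V ?I n t)"
      using inj_P[OF I(1,2) conjunct1[OF rs] conjunct1[OF rt]] rs rt eq by auto
    have "W \<noteq> {}" using W by blast
    then have "mres P U W n s = mres P V W n t"
      using W(4) res_res_P[OF U(1) I(1) W(1) I(3) W(3) _ s] res_res_P[OF V(1) I(1) W(1) I(4) W(3) _ t] by simp
    then show "\<exists>W. is_open W \<and> x \<in> W \<and> W \<subseteq> U \<inter> V \<and> mres P U W n s = mres P V W n t"
      using W by blast
  qed
  then show ?thesis unfolding germ_def fibre_def by auto
qed

lemma fibre_nonempty: "is_open U \<Longrightarrow> z \<in> T U n \<Longrightarrow> x \<in> U \<Longrightarrow> \<exists>V t. (V, t) \<in> fibre x n z"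
  by (erule T_E, assumption+) (auto simp: fibre_def)

text \<open>The member (V, t) excludes the empty fibre, which would carry no information on
  z.\<close>

lemma fibre_inj: "(V, t) \<in> fibre x n z \<Longrightarrow> fibre x n z = fibre x n z' \<Longrightarrow> z = z'"
  unfolding fibre_def by auto

lemma UN_fibre:
  assumes "is_open U" "z \<in> T U n" "x \<in> U"
    and "\<And>V t. (V, t) \<in> fibre x n z \<Longrightarrow> X V t = Y"
  shows "(\<Union>(V, t)\<in>fibre x n z. X V t) = Y"
proof -
  obtain V t where "(V, t) \<in> fibre x n z" using fibre_nonempty[OF assms(1-3)] by blast
  then show ?thesis using assms(4) by (intro UN_constant_eq[of "(V, t)"]) auto
qed

abbreviation sec where "sec \<equiv> \<lambda>U n z. (\<lambda>x\<in>U. fibre x n z)"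

text \<open>Locally a section is a family of fibres over one fixed vector. Every such neighbourhood
  contains the generic point, so all these vectors equal the one read off there, which is therefore
  locally in the image.\<close>

lemma mem_sheafify:
  assumes U: "is_open U" "U \<noteq> {}"
  shows "\<sigma> \<in> el (mval (sheafify \<O> P) U) n \<longleftrightarrow> \<sigma> \<in> sec U n ` T U n"
proof
  assume "\<sigma> \<in> sec U n ` T U n"
  then obtain z where z: "z \<in> T U n" "\<sigma> = sec U n z" by blast
  have "\<exists>V s. is_open V \<and> x \<in> V \<and> V \<subseteq> U \<and> s \<in> el (mval P V) n \<and> (\<forall>y\<in>V. \<sigma> y = germ P y n V s)"
    if x: "x \<in> U" for x
  proof -
    obtain V s where "is_open V" "x \<in> V" "V \<subseteq> U" "s \<in> el (mval P V) n" "\<theta> V n s = z"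
      using T_E[OF U(1) z(1) x] .
    then show ?thesis by (intro exI[of _ V] exI[of _ s]) (auto simp: z germ_eq_fibre)
  qed
  then show "\<sigma> \<in> el (mval (sheafify \<O> P) U) n" using z by (simp add: sheafify_def)
next
  assume \<sigma>: "\<sigma> \<in> el (mval (sheafify \<O> P) U) n"
  have ex: "\<forall>x\<in>U. \<exists>V s. is_open V \<and> x \<in> V \<and> V \<subseteq> U \<and> s \<in> el (mval P V) n \<and> (\<forall>y\<in>V. \<sigma> y = germ P y n V s)"
    using \<sigma> unfolding sheafify_def mod_presheaf.simps gamma.simps mem_Collect_eq by (rule conjunct2)
  have loc: "\<exists>V s. is_open V \<and> x \<in> V \<and> V \<subseteq> U \<and> s \<in> el (mval P V) n \<and> (\<forall>y\<in>V. \<sigma> y = fibre y n (\<theta> V n s))"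
    if x: "x \<in> U" for x
  proof -
    obtain V s where "is_open V" "x \<in> V" "V \<subseteq> U" "s \<in> el (mval P V) n" "\<forall>y\<in>V. \<sigma> y = germ P y n V s"
      using bspec[OF ex x] by (elim exE conjE)
    then show ?thesis using germ_eq_fibre by (intro exI[of _ V] exI[of _ s]) auto
  qed
  obtain V0 s0 where V0: "is_open V0" "Pt 0 \<in> V0" "s0 \<in> el (mval P V0) n" "\<sigma> (Pt 0) = fibre (Pt 0) n (\<theta> V0 n s0)"
    using loc[OF open_generic[OF U]] by blast
  let ?z = "\<theta> V0 n s0"
  have loc': "\<exists>V s. is_open V \<and> x \<in> V \<and> V \<subseteq> U \<and> s \<in> el (mval P V) n \<and> \<theta> V n s = ?z \<and> \<sigma> x = fibre x n ?z"
    if x: "x \<in> U" for x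
  proof -
    obtain V s where V: "is_open V" "x \<in> V" "V \<subseteq> U" "s \<in> el (mval P V) n" "\<forall>y\<in>V. \<sigma> y = fibre y n (\<theta> V n s)"
      using loc[OF x] by blast
    then have "Pt 0 \<in> V" using open_generic by blast
    moreover have "(V0, s0) \<in> fibre (Pt 0) n ?z" using V0 by (simp add: fibre_def)
    ultimately have "\<theta> V n s = ?z" using V V0(4) fibre_inj by metis
    then show ?thesis using V by auto
  qed
  then have "?z \<in> T U n" by (intro T_I U) blast
  moreover have "\<sigma> = sec U n ?z"
  proof
    fix x show "\<sigma> x = sec U n ?z x"
      using loc'[of x] \<sigma> by (cases "x \<in> U") (auto simp: sheafify_def extensional_def)
  qed
  ultimately show "\<sigma> \<in> sec U n ` T U n" by blast
qed

lemma iso_sheafify: "iso_modules (HQ_subalg S) (HQ_submod T) (sheafify (HQ_subalg S) P)"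
  unfolding iso_modules_def
proof (intro exI[of _ sec] allI impI)
  fix U assume U: "is_open U"
  let ?F = "sheafify (HQ_subalg S) P" and ?M = "HQ_submod T"
  show "(\<forall>n. bij_betw (sec U n) (el (mval ?M U) n) (el (mval ?F U) n) \<and> sec U n (pt (mval ?M U) n) = pt (mval ?F U) n) \<and>
    (\<forall>n m. \<forall>f\<in>pmaps n m. \<forall>z\<in>el (mval ?M U) n. sec U m (mp (mval ?M U) n m f z) = mp (mval ?F U) n m f (sec U n z)) \<and>
    (\<forall>k n. \<forall>a\<in>el (aval (HQ_subalg S) U) k. \<forall>z\<in>el (mval ?M U) n.
      sec U (k * n) (lact (mval ?M U) k n a z) = lact (mval ?F U) k n a (sec U n z)) \<and>
    (\<forall>V n. is_open V \<and> V \<subseteq> U \<longrightarrow> (\<forall>z\<in>el (mval ?M U) n. sec V n (mres ?M U V n z) = mres ?F U V n (sec U n z)))"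
  proof (cases "U = {}")
    case True
    \<comment> \<open>Over the empty set there is exactly one family of germs, the function with
      empty domain, which matches the one-point value of \<open>HQ_submod\<close>.\<close>
    have "el (mval ?F {}) n = {sec {} n (\<lambda>_. 0)}" for n
      by (auto simp: sheafify_def)
    then show ?thesis unfolding True
      by (auto simp: HQ_submod_def sheafify_def bij_betw_def)
  next
    case False
    have M: "mval ?M U = H_mod (T U)" "aval (HQ_subalg S) U = H_alg (S U)"
      using False by (simp_all add: HQ_submod_def HQ_subalg_def)
    show ?thesis unfolding M H_mod_simps
    proof (intro conjI allI impI ballI)
      fix n
      have "inj_on (sec U n) (T U n)"
      proof (rule inj_onI)
        fix z z' assume z: "z \<in> T U n" "z' \<in> T U n" "sec U n z = sec U n z'"
        have g: "Pt 0 \<in> U" by (rule open_generic[OF U False])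
        have "fibre (Pt 0) n z = fibre (Pt 0) n z'" using fun_cong[OF z(3), of "Pt 0"] g by simp
        then show "z = z'" using fibre_nonempty[OF U z(1) g] fibre_inj by blast
      qed
      then show "bij_betw (sec U n) (T U n) (el (mval ?F U) n)"
        unfolding bij_betw_def using mem_sheafify[OF U False] by blast
      show "sec U n (\<lambda>_. 0) = pt (mval ?F U) n"
        using pt_P[OF U False, of n] germ_eq_fibre[OF U, of _ "pt (mval P U) n" n]
        by (auto simp: sheafify_def intro: restrict_ext)
    next
      fix n m f z assume f: "f \<in> pmaps n m" and z: "z \<in> T U n"
      have mp: "mp (mval ?F U) n m f \<sigma> = (\<lambda>x\<in>U. \<Union>(V, s)\<in>\<sigma> x. germ P x m V (mp (mval P V) n m f s))" for \<sigma>
        by (simp add: sheafify_def)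
      show "sec U m (H_map n m f z) = mp (mval ?F U) n m f (sec U n z)"
        unfolding mp
      proof (rule restrict_ext)
        fix x assume x: "x \<in> U"
        have "(\<Union>(V, s)\<in>fibre x n z. germ P x m V (mp (mval P V) n m f s)) = fibre x m (H_map n m f z)"
        proof (rule UN_fibre[OF U z x])
          fix V s assume "(V, s) \<in> fibre x n z"
          then have V: "is_open V" "x \<in> V" "s \<in> el (mval P V) n" "\<theta> V n s = z" by (auto simp: fibre_def)
          then show "germ P x m V (mp (mval P V) n m f s) = fibre x m (H_map n m f z)"
            using mp_P[OF V(1) _ f V(3)] germ_eq_fibre[OF V(1,2)] by (metis empty_iff)
        qed
        then show "fibre x m (H_map n m f z) = (\<Union>(V, s)\<in>sec U n z x. germ P x m V (mp (mval P V) n m f s))"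
          using x by simp
      qed
    next
      fix k n a z assume a: "a \<in> S U k" and z: "z \<in> T U n"
      let ?X = "\<lambda>x V s. germ P x (k * n) (U \<inter> V) (lact (mval P (U \<inter> V)) k n (ares (HQ_subalg S) U (U \<inter> V) k a) (mres P V (U \<inter> V) n s))"
      have lact: "lact (mval ?F U) k n a \<sigma> = (\<lambda>x\<in>U. \<Union>(V, s)\<in>\<sigma> x. ?X x V s)" for \<sigma>
        by (simp add: sheafify_def)
      show "sec U (k * n) (H_mult k n a z) = lact (mval ?F U) k n a (sec U n z)"
        unfolding lact
      proof (rule restrict_ext)
        fix x assume x: "x \<in> U"
        have "(\<Union>(V, s)\<in>fibre x n z. ?X x V s) = fibre x (k * n) (H_mult k n a z)"
        proof (rule UN_fibre[OF U z x])
          fix V s assume "(V, s) \<in> fibre x n z"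
          then have V: "is_open V" "x \<in> V" "s \<in> el (mval P V) n" "\<theta> V n s = z" by (auto simp: fibre_def)
          \<comment> \<open>The action on a germ first restricts both scalar and section to the
            common neighbourhood; neither value changes there.\<close>
          have I: "is_open (U \<inter> V)" "U \<inter> V \<noteq> {}" "x \<in> U \<inter> V" using open_Int[OF U V(1)] x V(2) by auto
          have aI: "a \<in> S (U \<inter> V) k" using S_mono[OF U I(1) _ I(2)] a by blast
          have r: "mres P V (U \<inter> V) n s \<in> el (mval P (U \<inter> V)) n \<and> \<theta> (U \<inter> V) n (mres P V (U \<inter> V) n s) = z"
            using res_P[OF V(1) I(1) _ I(2) V(3)] V(4) by simp
          have "ares (HQ_subalg S) U (U \<inter> V) k a = a" using I(2) by (simp add: HQ_subalg_def HQ_res_def)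
          then show "?X x V s = fibre x (k * n) (H_mult k n a z)"
            using lact_P[OF I(1,2) aI conjunct1[OF r]] r germ_eq_fibre[OF I(1,3)] by simp
        qed
        then show "fibre x (k * n) (H_mult k n a z) = (\<Union>(V, s)\<in>sec U n z x. ?X x V s)"
          using x by simp
      qed
    next
      fix V n z assume "is_open V \<and> V \<subseteq> U" "z \<in> T U n"
      then show "sec V n (mres ?M U V n z) = mres ?F U V n (sec U n z)"
        by (cases "V = {}") (auto simp: sheafify_def HQ_submod_def HQ_res_def restrict_def fun_eq_iff subset_iff)
    qed
  qed
qed

lemma iso_sheafify': "iso_modules (HQ_subalg S) (sheafify (HQ_subalg S) P) (HQ_submod T)"
  by (rule iso_modules_sym[OF closed_T iso_sheafify])

end


section \<open>Sections of bounded norm\<close>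

text \<open>I is the set of permitted norms, so closed balls, open balls and modules without a bound
  away from \<open>Infty\<close> are treated together.\<close>

definition bounded_sections :: "(nat \<Rightarrow> int) \<Rightarrow> real set \<Rightarrow> place set \<Rightarrow> nat \<Rightarrow> (nat \<Rightarrow> rat) set" where
  "bounded_sections n I U k = {x \<in> H_el (O_fin n U) k. Infty \<in> U \<longrightarrow> l1_norm k x \<in> I}"

text \<open>Norms can only drop under pushforward and under scalars from the unit ball, so this
  property of I makes the bounded sections a module.\<close>

definition downset :: "real set \<Rightarrow> bool" where
  "downset I \<longleftrightarrow> 0 \<in> I \<and> (\<forall>s\<in>I. \<forall>t. 0 \<le> t \<and> t \<le> s \<longrightarrow> t \<in> I)"

text \<open>The element of H E(1_+) = E given by c, placed at index 1 since 0 is the base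
  point.\<close>

definition scal :: "'a::semiring_1 \<Rightarrow> nat \<Rightarrow> 'a" where
  "scal c = (\<lambda>i. if i = 1 then c else 0)"

lemma downset_atMost: "0 < r \<Longrightarrow> downset {..r}" and downset_lessThan: "0 < r \<Longrightarrow> downset {..<r}"
  by (auto simp: downset_def)

lemma O_bar_eq: "O_bar = HQ_subalg (bounded_sections (\<lambda>_. 0) {..1})"
  unfolding O_bar_def
  by (intro arg_cong[of _ _ HQ_subalg] ext)
     (auto simp: bounded_sections_def H_le_def O_SpecZ_eq O_fin_SpecZ)

lemma O_div_eq: "O_div D = HQ_submod (bounded_sections (fst D) {..exp (snd D)})"
  unfolding O_div_def
  by (intro arg_cong[of _ _ HQ_submod] ext) (auto simp: bounded_sections_def H_le_def O_fin_SpecZ)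

lemma O_eps_eq: "O_eps = HQ_submod (bounded_sections (\<lambda>_. 0) {..<1})"
  unfolding O_eps_def
  by (intro arg_cong[of _ _ HQ_submod] ext)
     (auto simp: bounded_sections_def H_less_def O_SpecZ_eq O_fin_SpecZ)

lemma bounded_sections_mono: "V \<subseteq> U \<Longrightarrow> bounded_sections n I U k \<subseteq> bounded_sections n I V k"
  using O_fin_mono[of V U n] by (auto simp: bounded_sections_def H_el_def)

lemma l1_norm_zero: "l1_norm k (\<lambda>_. 0) = 0"
  by (simp add: l1_norm_def)

text \<open>The norm of a rational vector is rational. Hence an irrational bound is never attained,
  and the norm itself can serve as normalizing scalar.\<close>

lemma of_rat_l1_norm: "l1_norm k x = of_rat (\<Sum>i\<in>{1..k}. \<bar>x i\<bar>)"
  by (simp add: l1_norm_def of_rat_sum)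

lemma l1_norm_scale: "l1_norm k (\<lambda>i. c * x i) = \<bar>of_rat c\<bar> * l1_norm k x"
  by (simp add: l1_norm_def of_rat_mult abs_mult sum_distrib_left)

lemma l1_norm_divide: "l1_norm k (\<lambda>i. x i / c) = l1_norm k x / \<bar>of_rat c\<bar>"
  by (simp add: l1_norm_def of_rat_divide abs_divide sum_divide_distrib)

lemma l1_norm_eq_0: "x \<in> H_el UNIV k \<Longrightarrow> (\<Sum>i\<in>{1..k}. \<bar>x i :: rat\<bar>) = 0 \<Longrightarrow> x i = 0"
  by (cases "i \<in> {1..k}") (auto simp: H_el_def sum_nonneg_eq_0_iff)

lemma l1_norm_scal: "l1_norm 1 (scal c) = \<bar>of_rat c\<bar>"
  by (simp add: l1_norm_def scal_def)

lemma scal_mem: "scal c \<in> bounded_sections n I U 1 \<longleftrightarrow> c \<in> O_fin n U \<and> (Infty \<in> U \<longrightarrow> \<bar>of_rat c\<bar> \<in> I)"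
proof -
  have "scal c \<in> H_el (O_fin n U) 1 \<longleftrightarrow> c \<in> O_fin n U" by (auto simp: H_el_def scal_def)
  then show ?thesis using l1_norm_scal[of c] by (simp add: bounded_sections_def)
qed

lemma scal_H_el: "scal c \<in> H_el UNIV 1"
  by (auto simp: H_el_def scal_def)

lemma scal_of_H_el: "x \<in> H_el E 1 \<Longrightarrow> x = scal (x 1)"
  by (auto simp: H_el_def scal_def)

lemma scal_inject: "scal c = scal d \<longleftrightarrow> c = d"
  by (auto simp: scal_def fun_eq_iff)

lemma H_mult_scal:
  assumes "x \<in> H_el UNIV k" shows "H_mult 1 k (scal c) x = (\<lambda>i. c * x i)"
proof
  fix z
  have "sm_fst k z = 1 \<and> sm_snd k z = z" if "z \<in> {1..k}"
    using that sm_fst_pair[of 1 z k] sm_snd_pair[of 1 z k] by (simp add: sm_pair_def)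
  then show "H_mult 1 k (scal c) x z = c * x z"
    using assms by (auto simp: H_mult_def scal_def H_el_def)
qed

lemma H_mult_scal_scal: "H_mult 1 1 (scal c) (scal d) = scal (c * d)"
  by (subst H_mult_scal[OF scal_H_el]) (auto simp: scal_def)

lemma H_mult_divide: "H_mult k l (\<lambda>i. x i / c) y = (\<lambda>i. H_mult k l x y i / (c :: rat))"
  by (auto simp: H_mult_def)

lemma H_map_divide: "H_map k l f (\<lambda>i. x i / c) = (\<lambda>i. H_map k l f x i / (c :: rat))"
  by (auto simp: H_map_def sum_divide_distrib)

section \<open>Stability of bounded sections\<close>

lemma bounded_sections_map:
  assumes "downset I" "f \<in> pmaps k l" "x \<in> bounded_sections n I U k"
  shows "H_map k l f x \<in> bounded_sections n I U l"
  using assms l1_norm_map[OF assms(2), of x] l1_norm_nonneg[of l "H_map k l f x"]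
    H_map_el[of "O_fin n U" x k l f]
  by (auto simp: bounded_sections_def downset_def O_fin_zero O_fin_add)

lemma bounded_sections_mult:
  assumes "downset I" "a \<in> bounded_sections (\<lambda>_. 0) {..1} U k" "x \<in> bounded_sections n I U l"
  shows "H_mult k l a x \<in> bounded_sections n I U (k * l)"
proof -
  have "H_mult k l a x \<in> H_el (O_fin n U) (k * l)"
    using assms(2,3) O_fin_mult[of _ "\<lambda>_. 0" U _ n]
    by (intro H_mult_el[of "O_fin (\<lambda>_. 0) U"]) (auto simp: bounded_sections_def)
  moreover have "l1_norm k a * l1_norm l x \<in> I" if "Infty \<in> U"
  proof -
    have "l1_norm k a * l1_norm l x \<le> l1_norm l x"
      using assms(2) that l1_norm_nonneg by (intro mult_left_le_one_le) (auto simp: bounded_sections_def)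
    then show ?thesis using assms(1,3) that l1_norm_nonneg by (auto simp: downset_def bounded_sections_def)
  qed
  ultimately show ?thesis by (simp add: bounded_sections_def l1_norm_mult)
qed

lemma H_smash_bounded_sections:
  assumes "downset I" "downset J"
  shows "H_smash (bounded_sections (\<lambda>_. 0) {..1} U) (bounded_sections n I U) (bounded_sections n' J U)"
proof
  have 1: "downset {..1}" by (simp add: downset_atMost)
  show "(\<lambda>_. 0) \<in> bounded_sections n I U k" "(\<lambda>_. 0) \<in> bounded_sections n' J U k" for k
    using assms by (auto simp: bounded_sections_def H_el_def O_fin_zero l1_norm_zero downset_def)
qed (auto simp: bounded_sections_map bounded_sections_mult assms downset_atMost,
     auto simp: bounded_sections_def H_el_def)


section \<open>The smash product of sheaves of bounded sections\<close>

text \<open>By \<open>K_iff\<close> the rational norms allowed in the target are exactly the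
  products of rational norms allowed in the factors. All cases of part (i) are instances that differ
  in I, J, K.\<close>

locale smash_sections =
  fixes n n' :: "nat \<Rightarrow> int" and I J K :: "real set"
  assumes n: "finite {p. n p \<noteq> 0}" "\<And>p. n p \<noteq> 0 \<Longrightarrow> prime p"
    and n': "finite {p. n' p \<noteq> 0}" "\<And>p. n' p \<noteq> 0 \<Longrightarrow> prime p"
    and down: "downset I" "downset J" "downset K"
    and K_iff: "0 \<le> s \<Longrightarrow> of_rat s \<in> K \<longleftrightarrow>
      (\<exists>c d. 0 \<le> c \<and> 0 \<le> d \<and> of_rat c \<in> I \<and> of_rat d \<in> J \<and> s = c * d)"
begin

abbreviation S where "S \<equiv> bounded_sections (\<lambda>_. 0) {..1}"
abbreviation M where "M \<equiv> bounded_sections n I"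
abbreviation N where "N \<equiv> bounded_sections n' J"
abbreviation T where "T \<equiv> bounded_sections (\<lambda>p. n p + n' p) K"
abbreviation P where "P \<equiv> smash_presheaf (HQ_subalg S) (HQ_submod M) (HQ_submod N)"

interpretation HS: H_smash "S U" "M U" "N U" for U
  by (rule H_smash_bounded_sections[OF down(1,2)])

abbreviation reps where "reps U \<equiv> day_reps (H_mod (M U)) (H_mod (N U))"
abbreviation cls where "cls U \<equiv> smash_class (H_alg (S U)) (H_mod (M U)) (H_mod (N U))"

text \<open>The multiplication map on classes; by \<open>val_cls\<close> the chosen representative
  does not matter.\<close>

definition val where
  "val U m C = smash_value m (SOME r. r \<in> reps U m \<and> C = cls U m r)"

lemma val_cls:
  assumes "r \<in> reps U m" shows "val U m (cls U m r) = smash_value m r"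
proof -
  let ?r = "SOME r'. r' \<in> reps U m \<and> cls U m r = cls U m r'"
  have "?r \<in> reps U m \<and> cls U m r = cls U m ?r" by (rule someI[of _ r]) (simp add: assms)
  then show ?thesis unfolding val_def using HS.smash_value_invariant[OF assms, of ?r] by simp
qed

lemma mval_P: "U \<noteq> {} \<Longrightarrow> mval P U = smash_over (H_alg (S U)) (H_mod (M U)) (H_mod (N U))"
  by (simp add: smash_presheaf_def HQ_subalg_def HQ_submod_def)

lemma el_P: "U \<noteq> {} \<Longrightarrow> el (mval P U) m = cls U m ` reps U m"
  by (subst mval_P, assumption) (rule HS.el_smash_over)

lemma el_PE:
  assumes "s \<in> el (mval P U) m" "U \<noteq> {}"
  obtains k l v x y where "(k, l, v, x, y) \<in> reps U m" "s = cls U m (k, l, v, x, y)"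
proof -
  obtain r where "r \<in> reps U m" "s = cls U m r" using assms(1) unfolding el_P[OF assms(2)] by (elim imageE)
  then show ?thesis by (cases r) (simp add: that)
qed

lemma reps_mono:
  assumes "V \<subseteq> U" shows "reps U m \<subseteq> reps V m"
  using subsetD[OF bounded_sections_mono[OF assms]] by (clarsimp simp: day_reps_def)

text \<open>The inclusions of sections over U into those over V respect the Day relations and the
  movement of scalars, so restriction keeps the representative.\<close>

lemma mres_P:
  assumes "V \<subseteq> U" "V \<noteq> {}" "r \<in> reps U m"
  shows "mres P U V m (cls U m r) = cls V m r"
proof -
  have U: "U \<noteq> {}" using assms by blast
  have "mres P U V m C = (\<Union>B\<in>C. \<Union>r\<in>B. cls V m r)" for C
    using U assms(2) by (simp add: smash_presheaf_def HQ_subalg_def HQ_submod_def HQ_res_def)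
  moreover have "(\<Union>B\<in>cls U m r. \<Union>r\<in>B. cls V m r) = cls V m r"
  proof (rule HS.cls_UN[OF assms(3)])
    fix s s' assume "(s, s') \<in> day_gen (H_mod (M U)) (H_mod (N U)) m"
    then show "cls V m s = cls V m s'"
    proof (cases rule: HS.gensE)
      case (map k l k' l' v f g s t)
      then have "s \<in> M V k" "t \<in> N V l"
        using subsetD[OF bounded_sections_mono[OF assms(1)]] by (simp_all only:)
      then show ?thesis unfolding map(1,2) by (intro HS.cls_gens HS.gens_mapI map(3-5))
    next
      case (pt k l v s t k' l' v' s' t')
      have "(k, l, v, s, t) \<in> reps V m" "(k', l', v', s', t') \<in> reps V m"
        using subsetD[OF reps_mono[OF assms(1)]] pt(1-4) by (simp_all only:)
      then show ?thesis unfolding pt(1,2) by (intro HS.cls_gens HS.gens_ptI pt(5,6))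
    qed
  next
    fix k l j v x a y assume "v \<in> pmaps (k * l * j) m" "x \<in> M U k" "a \<in> S U l" "y \<in> N U j"
    then show "cls V m (k * l, j, v, H_mult k l x a, y) = cls V m (k, l * j, v, x, H_mult l j a y)"
      by (intro HS.cls_scalar subsetD[OF bounded_sections_mono[OF assms(1)]])
  qed
  ultimately show ?thesis by simp
qed

text \<open>Valuations add under products, the norm of a tensor is the product of the norms, and
  pushing forward along \<open>v\<close> can only lower it.\<close>

lemma smash_value_mem:
  assumes "r \<in> reps U m" shows "smash_value m r \<in> T U m"
proof -
  obtain k l v x y where r: "r = (k, l, v, x, y)" "v \<in> pmaps (k * l) m" "x \<in> M U k" "y \<in> N U l"
    using assms by (auto simp: day_reps_def)
  have "H_mult k l x y \<in> H_el (O_fin (\<lambda>p. n p + n' p) U) (k * l)"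
  proof -
    have *: "H_mult k l x y z \<in> O_fin (\<lambda>p. n p + n' p) U" if z: "z \<in> {1..k * l}" for z
    proof -
      obtain i j where "i \<in> {1..k}" "j \<in> {1..l}" "z = sm_pair l i j" using sm_pairE[OF z] .
      then show ?thesis using r z
        by (auto simp: H_mult_def H_el_def bounded_sections_def sm_fst_pair sm_snd_pair intro!: O_fin_mult)
    qed
    show ?thesis unfolding H_el_def using * by (auto simp: H_mult_def)
  qed
  moreover have "l1_norm (k * l) (H_mult k l x y) \<in> K" if "Infty \<in> U"
  proof -
    let ?c = "\<Sum>i\<in>{1..k}. \<bar>x i\<bar>" and ?d = "\<Sum>i\<in>{1..l}. \<bar>y i\<bar>"
    have nn: "0 \<le> ?c" "0 \<le> ?d" by (intro sum_nonneg; simp)+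
    have "of_rat ?c \<in> I" "of_rat ?d \<in> J"
      using r that unfolding of_rat_l1_norm[symmetric] by (auto simp: bounded_sections_def)
    then have "of_rat (?c * ?d) \<in> K" using K_iff[of "?c * ?d"] nn by (metis mult_nonneg_nonneg)
    then show ?thesis
      unfolding l1_norm_mult of_rat_l1_norm[of k x] of_rat_l1_norm[of l y] of_rat_mult .
  qed
  ultimately have "H_mult k l x y \<in> T U (k * l)" by (simp add: bounded_sections_def)
  then show ?thesis using bounded_sections_map[OF down(3) r(2)] by (simp add: r smash_value_def)
qed

text \<open>The last hypothesis says that z vanishes when c = 0; for other c it is
  automatic.\<close>

lemma pure_tensor:
  assumes "scal c \<in> M U 1" "(\<lambda>i. z i / c) \<in> N U m" "z \<in> H_el UNIV m" "\<And>i. z i = c * (z i / c)"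
  shows "(1, m, pid m, scal c, \<lambda>i. z i / c) \<in> reps U m"
    and "smash_value m (1, m, pid m, scal c, \<lambda>i. z i / c) = z"
proof -
  show "(1, m, pid m, scal c, \<lambda>i. z i / c) \<in> reps U m"
    using assms(1,2) pid_pmaps[of m] by (simp add: day_reps_def)
  have "(\<lambda>i. z i / c) \<in> H_el UNIV m" using assms(2) by (auto simp: bounded_sections_def H_el_def)
  then have "H_mult 1 m (scal c) (\<lambda>i. z i / c) = z"
    using assms(4) by (subst H_mult_scal) (auto simp: fun_eq_iff)
  then show "smash_value m (1, m, pid m, scal c, \<lambda>i. z i / c) = z"
    unfolding smash_value_def prod.case by (simp add: H_map_id[OF assms(3)])
qed

text \<open>Factor x as c times a = x / c, move a across to y, and push the result forward along
  \<open>v\<close>. By linearity the second factor becomes the value divided by c.\<close>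

lemma normal_form:
  assumes r: "(k, l, v, x, y) \<in> reps U m" and c: "scal c \<in> M U 1" and a: "(\<lambda>i. x i / c) \<in> S U k"
    and x: "\<And>i. x i = c * (x i / c)"
  shows "cls U m (k, l, v, x, y) = cls U m (1, m, pid m, scal c, \<lambda>i. smash_value m (k, l, v, x, y) i / c)"
    and "(\<lambda>i. smash_value m (k, l, v, x, y) i / c) \<in> N U m"
proof -
  let ?a = "\<lambda>i. x i / c"
  have r': "v \<in> pmaps (k * l) m" "x \<in> M U k" "y \<in> N U l" using r by (auto simp: day_reps_def)
  have "?a \<in> H_el UNIV k" using HS.supp(1)[of U k] a by blast
  then have "H_mult 1 k (scal c) ?a = x" using x by (subst H_mult_scal) (auto simp: fun_eq_iff)
  then have 1: "cls U m (k, l, v, x, y) = cls U m (1, k * l, v, scal c, H_mult k l ?a y)"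
    using HS.cls_scalar[of v 1 k l m "scal c" U ?a y] r' c a by simp
  have ay: "H_mult k l ?a y \<in> N U (k * l)" using HS.mult_mem(2)[OF a r'(3)] .
  have pid_m: "pid m \<in> pmaps (1 * m) m" using pid_pmaps[of m] by simp
  \<comment> \<open>A Day relation with the identity on the first factor and \<open>v\<close> on the
    second absorbs \<open>v\<close> into the second factor.\<close>
  have "((1, k * l, pcomp (1 * (k * l)) (pid m) (psmash 1 (k * l) m (pid 1) v), scal c, H_mult k l ?a y),
      (1, m, pid m, H_map 1 1 (pid 1) (scal c), H_map (k * l) m v (H_mult k l ?a y)))
      \<in> day_gen (H_mod (M U)) (H_mod (N U)) m"
    by (rule HS.gens_mapI[OF pid_pmaps r'(1) pid_m c ay])
  then have "((1, k * l, v, scal c, H_mult k l ?a y),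
      (1, m, pid m, scal c, H_map (k * l) m v (H_mult k l ?a y))) \<in> day_gen (H_mod (M U)) (H_mod (N U)) m"
    by (simp only: psmash_one_left[OF r'(1)] mult_1 pcomp_pid[OF r'(1)] H_map_id[OF scal_H_el])
  moreover have eq: "H_map (k * l) m v (H_mult k l ?a y) = (\<lambda>i. smash_value m (k, l, v, x, y) i / c)"
    by (simp add: smash_value_def H_mult_divide H_map_divide)
  ultimately show "cls U m (k, l, v, x, y) = cls U m (1, m, pid m, scal c, \<lambda>i. smash_value m (k, l, v, x, y) i / c)"
    using 1 HS.cls_gens by metis
  show "(\<lambda>i. smash_value m (k, l, v, x, y) i / c) \<in> N U m"
    using HS.map_mem(2)[OF r'(1) ay] unfolding eq .
qed

text \<open>Used with a quotient of two normalizing scalars as q, to compare normal forms with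
  different first factors.\<close>

lemma slide:
  assumes "scal c \<in> M U 1" "scal q \<in> S U 1" "w \<in> N U m"
  shows "cls U m (1, m, pid m, scal (c * q), w) = cls U m (1, m, pid m, scal c, \<lambda>i. q * w i)"
proof -
  have "w \<in> H_el UNIV m" using HS.supp(3)[of U m] assms(3) by blast
  moreover have "pid m \<in> pmaps (1 * 1 * m) m" using pid_pmaps[of m] by simp
  from HS.cls_scalar[OF this assms]
  have "cls U m (1, m, pid m, H_mult 1 1 (scal c) (scal q), w) = cls U m (1, m, pid m, scal c, H_mult 1 m (scal q) w)"
    by (simp only: mult_1)
  ultimately show ?thesis by (simp only: H_mult_scal_scal H_mult_scal)
qed

text \<open>Away from \<open>Infty\<close> there is no norm bound, so one generator c of the
  fractional ideal normalizes all classes simultaneously, and the normal form depends only on the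
  value.\<close>

lemma inj_finite:
  assumes U: "Infty \<notin> U" and r: "r \<in> reps U m" "r' \<in> reps U m" and eq: "smash_value m r = smash_value m r'"
  shows "cls U m r = cls U m r'"
proof -
  obtain c where c: "c \<noteq> 0" "\<And>p. prime p \<Longrightarrow> vp p c = - n p" using ex_generator[OF n] by blast
  have sc: "scal c \<in> M U 1" using U c by (simp only: scal_mem) (simp add: O_fin_def)
  have "cls U m r = cls U m (1, m, pid m, scal c, \<lambda>i. smash_value m r i / c)" if "r \<in> reps U m" for r
  proof -
    obtain k l v x y where r: "r = (k, l, v, x, y)" by (cases r)
    have "(\<lambda>i. x i / c) \<in> S U k" using that U c
      by (auto simp: r day_reps_def bounded_sections_def H_el_def O_fin_def vp_quotient)
    then show ?thesis using normal_form(1)[OF _ sc] that c unfolding r by simp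
  qed
  then show ?thesis using r eq by simp
qed

text \<open>Near \<open>\<infinity>\<close> a class is normalized with \<open>c\<close> the norm of its first factor; two normal forms with
  the same value are then compared through the scalar \<open>c / c'\<close> of absolute value at most one. If \<open>x = 0\<close> then \<open>c = 0\<close>, and \<open>z / c = 0\<close> is
  still correct since division by zero gives zero.\<close>

lemma inj_Infty:
  assumes U: "is_open U" "Infty \<in> U" and r: "(k, l, v, x, y) \<in> reps U m" "(k', l', v', x', y') \<in> reps U m"
    and eq: "smash_value m (k, l, v, x, y) = smash_value m (k', l', v', x', y')"
    and le: "(\<Sum>i\<in>{1..k}. \<bar>x i\<bar>) \<le> (\<Sum>i\<in>{1..k'}. \<bar>x' i\<bar>)"
  shows "\<exists>W. is_open W \<and> Infty \<in> W \<and> W \<subseteq> U \<and> cls W m (k, l, v, x, y) = cls W m (k', l', v', x', y')"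
proof -
  define c c' where "c = (\<Sum>i\<in>{1..k}. \<bar>x i\<bar>)" and "c' = (\<Sum>i\<in>{1..k'}. \<bar>x' i\<bar>)"
  define z where "z = smash_value m (k, l, v, x, y)"
  \<comment> \<open>Over W the finitely many scalars occurring in both normal forms and in their
    comparison satisfy all valuation conditions.\<close>
  obtain W where W: "is_open W" "W \<subseteq> U" "Infty \<in> W"
    and Q: "{c, c', c / c'} \<union> (\<lambda>i. x i / c) ` {1..k} \<union> (\<lambda>i. x' i / c') ` {1..k'} \<subseteq> O_fin n W"
      "{c, c', c / c'} \<union> (\<lambda>i. x i / c) ` {1..k} \<union> (\<lambda>i. x' i / c') ` {1..k'} \<subseteq> O_fin (\<lambda>_. 0) W"
    by (rule shrink_open[OF U _ n(1) n'(1),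
        of "{c, c', c / c'} \<union> (\<lambda>i. x i / c) ` {1..k} \<union> (\<lambda>i. x' i / c') ` {1..k'}"]) auto
  have rW: "(k, l, v, x, y) \<in> reps W m" "(k', l', v', x', y') \<in> reps W m"
    using r reps_mono[OF W(2)] by blast+
  have nn: "0 \<le> c" "0 \<le> c'" unfolding c_def c'_def by (intro sum_nonneg; simp)+
  have xs: "x \<in> M U k" "x' \<in> M U k'" using r by (auto simp: day_reps_def)
  have xH: "x \<in> H_el UNIV k" "x' \<in> H_el UNIV k'" using xs HS.supp(2) by blast+
  have lc: "l1_norm k x = of_rat c" "l1_norm k' x' = of_rat c'" by (simp_all add: of_rat_l1_norm c_def c'_def)
  have sc: "scal c \<in> M W 1" "scal c' \<in> M W 1"
    using xs U(2) W Q(1) nn lc by (simp_all only: scal_mem) (simp_all add: bounded_sections_def)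
  have "l1_norm k (\<lambda>i. x i / c) \<le> 1" "l1_norm k' (\<lambda>i. x' i / c') \<le> 1"
    using nn by (simp_all add: l1_norm_divide lc)
  then have a: "(\<lambda>i. x i / c) \<in> S W k" "(\<lambda>i. x' i / c') \<in> S W k'"
    using Q(2) xH by (auto simp: bounded_sections_def H_el_def)
  have x0: "c = 0 \<Longrightarrow> x i = 0" "c' = 0 \<Longrightarrow> x' i = 0" for i
    using l1_norm_eq_0 xH by (auto simp: c_def c'_def)
  then have x: "x i = c * (x i / c)" "x' i = c' * (x' i / c')" for i by auto
  have c0: "c' = 0 \<Longrightarrow> c = 0" using le nn unfolding c_def[symmetric] c'_def[symmetric] by simp
  have z0: "z i = 0" if "c = 0" for i
  proof -
    have "x = (\<lambda>_. 0)" using x0 that by auto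
    then show ?thesis by (simp add: z_def smash_value_def)
  qed
  have q: "scal (c / c') \<in> S W 1"
  proof -
    have "0 \<le> c / c'" "c / c' \<le> 1"
      using nn le unfolding c_def[symmetric] c'_def[symmetric] by (auto simp: divide_le_eq_1)
    then show ?thesis using Q(2) nn by (simp only: scal_mem) simp
  qed
  have "cls W m (k, l, v, x, y) = cls W m (1, m, pid m, scal c, \<lambda>i. z i / c)"
    using normal_form(1)[OF rW(1) sc(1) a(1) x(1)] by (simp add: z_def)
  \<comment> \<open>For c' = 0 this holds as well, because then c = 0 by the ordering of the two
    norms.\<close>
  also have "c = c' * (c / c')" using c0 by auto
  then have "cls W m (1, m, pid m, scal c, \<lambda>i. z i / c) = cls W m (1, m, pid m, scal (c' * (c / c')), \<lambda>i. z i / c)"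
    by simp
  also have "\<dots> = cls W m (1, m, pid m, scal c', \<lambda>i. c / c' * (z i / c))"
    using normal_form(2)[OF rW(1) sc(1) a(1) x(1)] by (intro slide sc q) (simp add: z_def)
  also have "(\<lambda>i. c / c' * (z i / c)) = (\<lambda>i. z i / c')" using z0 by (cases "c = 0") auto
  also have "cls W m (1, m, pid m, scal c', \<lambda>i. z i / c') = cls W m (k', l', v', x', y')"
    using normal_form(1)[OF rW(2) sc(2) a(2) x(2)] by (simp add: z_def eq)
  finally show ?thesis using W by blast
qed

text \<open>Away from \<open>Infty\<close> a generator of the first fractional ideal splits off. At
  \<open>Infty\<close> the norm of z is written as c d by \<open>K_iff\<close>, and z / c then has
  norm d, or 0 if c = 0.\<close>

lemma T_locally_generated:
  assumes U: "is_open U" "x \<in> U" and z: "z \<in> T U m"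
  shows "\<exists>V c. is_open V \<and> x \<in> V \<and> V \<subseteq> U \<and> scal c \<in> M V 1 \<and> (\<lambda>i. z i / c) \<in> N V m \<and> (\<forall>i. z i = c * (z i / c))"
proof (cases "x = Infty")
  case False
  obtain c where c: "c \<noteq> 0" "\<And>p. prime p \<Longrightarrow> vp p c = - n p" using ex_generator[OF n] by blast
  let ?V = "U - {Infty}"
  have "scal c \<in> M ?V 1" using c by (simp only: scal_mem) (simp add: O_fin_def)
  moreover have "z i / c \<in> O_fin n' ?V" if "i \<in> {1..m}" for i
  proof (cases "z i = 0")
    case nz: False
    have "vp p (z i / c) + n' p \<ge> 0" if p: "prime p" "Pt p \<in> U" for p
    proof -
      have "z i \<in> O_fin (\<lambda>p. n p + n' p) U" using z \<open>i \<in> {1..m}\<close> by (simp add: bounded_sections_def H_el_def)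
      then show ?thesis using p nz c by (simp add: O_fin_def vp_quotient add.assoc)
    qed
    then show ?thesis by (simp add: O_fin_def)
  qed (simp add: O_fin_zero)
  then have "(\<lambda>i. z i / c) \<in> N ?V m" using z by (simp add: bounded_sections_def H_el_def)
  ultimately show ?thesis using c False U open_remove_Infty[OF U(1)]
    by (intro exI[of _ ?V] exI[of _ c]) auto
next
  case True
  let ?s = "\<Sum>i\<in>{1..m}. \<bar>z i\<bar>"
  have s: "l1_norm m z = of_rat ?s" by (rule of_rat_l1_norm)
  have "0 \<le> ?s" by (simp add: sum_nonneg)
  moreover have "of_rat ?s \<in> K" using z U True unfolding s[symmetric] by (simp add: bounded_sections_def)
  ultimately obtain c d where cd: "0 \<le> c" "0 \<le> d" "of_rat c \<in> I" "of_rat d \<in> J" "?s = c * d"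
    using K_iff[of ?s] by blast
  have zH: "z \<in> H_el UNIV m" using z by (auto simp: bounded_sections_def H_el_def)
  have z0: "z i = 0" if "c = 0" for i by (rule l1_norm_eq_0[OF zH]) (simp only: cd(5) that mult_zero_left)
  obtain W where W: "is_open W" "W \<subseteq> U" "Infty \<in> W"
    and Q: "insert c ((\<lambda>i. z i / c) ` {1..m}) \<subseteq> O_fin n W" "insert c ((\<lambda>i. z i / c) ` {1..m}) \<subseteq> O_fin n' W"
    by (rule shrink_open[OF U(1) _ _ n(1) n'(1), of "insert c ((\<lambda>i. z i / c) ` {1..m})"])
       (use U(2) True in simp_all)
  have "scal c \<in> M W 1" using Q cd by (simp only: scal_mem) simp
  \<comment> \<open>For c = 0 division by zero makes z / c the zero vector, whose norm 0 lies in the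
    downset J.\<close>
  moreover have "l1_norm m (\<lambda>i. z i / c) \<in> J"
  proof (cases "c = 0")
    case True
    then show ?thesis using down(2) by (simp add: l1_norm_zero downset_def)
  next
    case False
    then show ?thesis using cd by (simp add: l1_norm_divide s of_rat_mult)
  qed
  then have "(\<lambda>i. z i / c) \<in> N W m" using Q zH by (auto simp: bounded_sections_def H_el_def)
  ultimately show ?thesis using W True z0 by (intro exI[of _ W] exI[of _ c]) auto
qed

sublocale H_presheaf S T P val
proof
  fix U V :: "place set" and k assume "V \<subseteq> U"
  then show "S U k \<subseteq> S V k" by (rule bounded_sections_mono)
next
  fix U :: "place set" and m assume U: "U \<noteq> {}"
  have r: "(0, 0, pid 0, \<lambda>_. 0, \<lambda>_. 0) \<in> reps U m"
    using HS.zero_mem[of U 0] by (auto simp: day_reps_def pmaps_def pid_def)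
  have "pt (mval P U) m = cls U m (0, 0, pid 0, \<lambda>_. 0, \<lambda>_. 0)"
    using HS.pt_smash_over[of U m] mval_P[OF U] by simp
  then show "pt (mval P U) m \<in> el (mval P U) m \<and> val U m (pt (mval P U) m) = (\<lambda>_. 0)"
    using val_cls[OF r] r el_P[OF U] by (simp add: smash_value_def)
next
  fix U :: "place set" and f m j s assume U: "U \<noteq> {}" and f: "f \<in> pmaps m j" and s: "s \<in> el (mval P U) m"
  obtain k l v x y where r: "(k, l, v, x, y) \<in> reps U m" and s: "s = cls U m (k, l, v, x, y)"
    using el_PE[OF s U] .
  have r': "(k, l, pcomp (k * l) f v, x, y) \<in> reps U j"
    using r f by (auto simp: day_reps_def intro: pcomp_pmaps)
  have "mp (mval P U) m j f s = cls U j (k, l, pcomp (k * l) f v, x, y)"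
    unfolding mval_P[OF U] s by (rule HS.mp_smash_over[OF f r])
  then show "mp (mval P U) m j f s \<in> el (mval P U) j \<and> val U j (mp (mval P U) m j f s) = H_map m j f (val U m s)"
    using r r' el_P[OF U] HS.smash_value_map[OF f r] by (simp add: s val_cls)
next
  fix U :: "place set" and a j m s assume U: "U \<noteq> {}" and a: "a \<in> S U j" and s: "s \<in> el (mval P U) m"
  obtain k l v x y where r: "(k, l, v, x, y) \<in> reps U m" and s: "s = cls U m (k, l, v, x, y)"
    using el_PE[OF s U] .
  have r': "(j * k, l, psmash j (k * l) m (pid j) v, H_mult j k a x, y) \<in> reps U (j * m)"
    using r psmash_pmaps[OF pid_pmaps, of v "k * l" m j] HS.mult_mem(1)[OF a, of x k]
    by (simp add: day_reps_def mult.assoc)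
  have "lact (mval P U) j m a s = cls U (j * m) (j * k, l, psmash j (k * l) m (pid j) v, H_mult j k a x, y)"
    unfolding mval_P[OF U] s by (rule HS.lact_smash_over[OF a r])
  then show "lact (mval P U) j m a s \<in> el (mval P U) (j * m) \<and>
      val U (j * m) (lact (mval P U) j m a s) = H_mult j m a (val U m s)"
    using r r' el_P[OF U] HS.smash_value_lact[OF a r] by (simp add: s val_cls)
next
  fix U V :: "place set" and s m assume V: "V \<subseteq> U" "V \<noteq> {}" and s: "s \<in> el (mval P U) m"
  then obtain r where r: "r \<in> reps U m" "s = cls U m r" using el_P[of U m] by blast
  then have "r \<in> reps V m" using reps_mono[OF V(1)] by blast
  then show "mres P U V m s \<in> el (mval P V) m \<and> val V m (mres P U V m s) = val U m s"
    using r el_P[OF V(2)] by (simp add: mres_P[OF V] val_cls)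
next
  fix U V W :: "place set" and s m
  assume V: "V \<subseteq> U" and W: "W \<subseteq> V" "W \<noteq> {}" and s: "s \<in> el (mval P U) m"
  then obtain r where r: "r \<in> reps U m" "s = cls U m r" using el_P[of U m] by blast
  then have "r \<in> reps V m" using reps_mono[OF V] by blast
  moreover have "W \<subseteq> U" "V \<noteq> {}" using V W by auto
  ultimately show "mres P V W m (mres P U V m s) = mres P U W m s"
    using r V W by (simp add: mres_P)
next
  fix U x s t m assume U: "is_open U" "x \<in> U" and s: "s \<in> el (mval P U) m" and t: "t \<in> el (mval P U) m"
    and eq: "val U m s = val U m t"
  have ne: "U \<noteq> {}" using U by blast
  obtain k l v a b where r: "(k, l, v, a, b) \<in> reps U m" and s: "s = cls U m (k, l, v, a, b)"
    using el_PE[OF s ne] .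
  obtain k' l' v' a' b' where r': "(k', l', v', a', b') \<in> reps U m" and t: "t = cls U m (k', l', v', a', b')"
    using el_PE[OF t ne] .
  have eq': "smash_value m (k, l, v, a, b) = smash_value m (k', l', v', a', b')"
    using eq r r' by (simp add: s t val_cls)
  have "\<exists>W. is_open W \<and> x \<in> W \<and> W \<subseteq> U \<and> cls W m (k, l, v, a, b) = cls W m (k', l', v', a', b')"
  proof (cases "x = Infty")
    case True
    \<comment> \<open>The comparison slides the scalar from the smaller norm to the larger one, so
      the two representatives are ordered first.\<close>
    show ?thesis
    proof (cases "(\<Sum>i\<in>{1..k}. \<bar>a i\<bar>) \<le> (\<Sum>i\<in>{1..k'}. \<bar>a' i\<bar>)")
      case le: True
      show ?thesis using inj_Infty[OF U(1) _ r r' eq' le] U(2) True by simp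
    next
      case False
      then have "(\<Sum>i\<in>{1..k'}. \<bar>a' i\<bar>) \<le> (\<Sum>i\<in>{1..k}. \<bar>a i\<bar>)" by simp
      from inj_Infty[OF U(1) _ r' r eq'[symmetric] this] show ?thesis using U(2) True by metis
    qed
  next
    case False
    \<comment> \<open>At a point other than \<open>Infty\<close> the set U without
      \<open>Infty\<close> is still a neighbourhood, and no norm condition is left.\<close>
    have "cls (U - {Infty}) m (k, l, v, a, b) = cls (U - {Infty}) m (k', l', v', a', b')"
      using r r' reps_mono[of "U - {Infty}" U m] by (intro inj_finite eq') auto
    then show ?thesis using open_remove_Infty[OF U(1)] U(2) False by (intro exI[of _ "U - {Infty}"]) auto
  qed
  then obtain W where W: "is_open W" "x \<in> W" "W \<subseteq> U"
    "cls W m (k, l, v, a, b) = cls W m (k', l', v', a', b')" by blast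
  then have "W \<noteq> {}" by blast
  then show "\<exists>W. is_open W \<and> x \<in> W \<and> W \<subseteq> U \<and> mres P U W m s = mres P U W m t"
    using W by (intro exI[of _ W]) (simp add: s t mres_P r r')
next
  fix U :: "place set" and z m assume U: "is_open U" "U \<noteq> {}"
  show "z \<in> T U m \<longleftrightarrow> (\<forall>x\<in>U. \<exists>V s. is_open V \<and> x \<in> V \<and> V \<subseteq> U \<and> s \<in> el (mval P V) m \<and> val V m s = z)"
  proof (intro iffI ballI)
    fix x assume z: "z \<in> T U m" and x: "x \<in> U"
    obtain V c where V: "is_open V" "x \<in> V" "V \<subseteq> U"
      and c: "scal c \<in> M V 1" "(\<lambda>i. z i / c) \<in> N V m" "\<And>i. z i = c * (z i / c)"
      using T_locally_generated[OF U(1) x z] by blast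
    have "z \<in> H_el UNIV m" using z by (auto simp: bounded_sections_def H_el_def)
    from pure_tensor[OF c(1,2) this c(3)]
    have "cls V m (1, m, pid m, scal c, \<lambda>i. z i / c) \<in> el (mval P V) m"
      "val V m (cls V m (1, m, pid m, scal c, \<lambda>i. z i / c)) = z"
      using el_P[of V m] V(2) by (auto simp: val_cls)
    then show "\<exists>V s. is_open V \<and> x \<in> V \<and> V \<subseteq> U \<and> s \<in> el (mval P V) m \<and> val V m s = z"
      using V by blast
  next
    assume loc: "\<forall>x\<in>U. \<exists>V s. is_open V \<and> x \<in> V \<and> V \<subseteq> U \<and> s \<in> el (mval P V) m \<and> val V m s = z"
    \<comment> \<open>Membership in T is a condition at each prime of U and, if present, at
      \<open>Infty\<close>, so it may be verified on neighbourhoods of the individual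
      points.\<close>
    have z: "\<exists>V. x \<in> V \<and> z \<in> T V m" if x: "x \<in> U" for x
    proof -
      obtain V s where V: "x \<in> V" "s \<in> el (mval P V) m" "val V m s = z" using loc x by blast
      then obtain r where r: "r \<in> reps V m" "s = cls V m r" using el_P[of V m] by blast
      then show ?thesis using V smash_value_mem[OF r(1)] val_cls[OF r(1)] by auto
    qed
    have "z i = 0" if "i \<notin> {1..m}" for i
      using z[OF open_generic[OF U]] that by (auto simp: bounded_sections_def H_el_def)
    moreover have "z i \<in> O_fin (\<lambda>p. n p + n' p) U" if i: "i \<in> {1..m}" for i
    proof -
      have "0 \<le> vp p (z i) + (n p + n' p)" if nz: "z i \<noteq> 0" and p: "prime p" "Pt p \<in> U" for p
      proof -
        obtain V where "Pt p \<in> V" "z \<in> T V m" using z[OF p(2)] by blast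
        then show ?thesis using nz p i by (auto simp: bounded_sections_def H_el_def O_fin_def)
      qed
      then show ?thesis by (auto simp: O_fin_def)
    qed
    moreover have "l1_norm m z \<in> K" if "Infty \<in> U"
      using z[OF that] by (auto simp: bounded_sections_def)
    ultimately show "z \<in> T U m" by (simp add: bounded_sections_def H_el_def)
  qed
qed

lemma iso_smash: "iso_modules O_bar (smash_sheaf O_bar (HQ_submod M) (HQ_submod N)) (HQ_submod T)"
  "iso_modules O_bar (HQ_submod T) (smash_sheaf O_bar (HQ_submod M) (HQ_submod N))"
  unfolding O_bar_eq smash_sheaf_def by (rule iso_sheafify' iso_sheafify)+

end


section \<open>Products of bounds\<close>

text \<open>Density of the rationals gives c strictly between s / r' and r; then d = s / c is below
  r'.\<close>

lemma ex_rat_factors: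
  fixes r r' :: real
  assumes "0 < r" "0 < r'" "0 \<le> s" "of_rat s < r * r'"
  shows "\<exists>c d. 0 \<le> c \<and> 0 \<le> d \<and> of_rat c < r \<and> of_rat d < r' \<and> s = c * (d :: rat)"
proof -
  have "of_rat s / r' < r" using assms by (simp add: divide_less_eq)
  then obtain c :: rat where c: "of_rat s / r' < of_rat c" "of_rat c < r" using of_rat_dense by blast
  have "0 \<le> of_rat s / r'" using assms by simp
  then have c0: "0 < c" using c(1) by (metis le_less_trans zero_less_of_rat_iff)
  have "of_rat s < of_rat c * r'" using c(1) assms(2) by (simp add: divide_less_eq)
  then have "of_rat (s / c) < r'" using c0 by (simp add: of_rat_divide divide_less_eq mult.commute)
  then show ?thesis using c c0 assms by (intro exI[of _ c] exI[of _ "s / c"]) auto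
qed

text \<open>Below the bound density suffices. At s = r r' the product is rational, so outside the
  exceptional case one bound is rational, hence the other too, and the bounds themselves are the
  factors.\<close>

lemma factors_le:
  fixes r r' :: real
  assumes r: "0 < r" "0 < r'" and s: "0 \<le> s" and ne: "\<not> (r \<notin> \<rat> \<and> r' \<notin> \<rat> \<and> r * r' \<in> \<rat>)"
  shows "of_rat s \<in> {..r * r'} \<longleftrightarrow>
    (\<exists>c d. 0 \<le> c \<and> 0 \<le> d \<and> of_rat c \<in> {..r} \<and> of_rat d \<in> {..r'} \<and> s = c * (d :: rat))"
proof
  assume "of_rat s \<in> {..r * r'}"
  then consider "of_rat s < r * r'" | "of_rat s = r * r'" by fastforce
  then show "\<exists>c d. 0 \<le> c \<and> 0 \<le> d \<and> of_rat c \<in> {..r} \<and> of_rat d \<in> {..r'} \<and> s = c * (d :: rat)"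
  proof cases
    case 1
    obtain c d where "0 \<le> c" "0 \<le> d" "of_rat c < r" "of_rat d < r'" "s = c * d"
      using ex_rat_factors[OF r s 1] by blast
    then show ?thesis by (intro exI[of _ c] exI[of _ d]) auto
  next
    case 2
    then have "r * r' \<in> \<rat>" by (metis Rats_of_rat)
    then have "r \<in> \<rat> \<or> r' \<in> \<rat>" using ne by blast
    then have "r \<in> \<rat> \<and> r' \<in> \<rat>"
    proof
      assume "r \<in> \<rat>"
      moreover have "r' = r * r' / r" using r by simp
      ultimately show ?thesis using \<open>r * r' \<in> \<rat>\<close> by (metis Rats_divide)
    next
      assume "r' \<in> \<rat>"
      moreover have "r = r * r' / r'" using r by simp
      ultimately show ?thesis using \<open>r * r' \<in> \<rat>\<close> by (metis Rats_divide)
    qed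
    then obtain c d :: rat where cd: "r = of_rat c" "r' = of_rat d" by (auto elim!: Rats_cases)
    then have "of_rat s = (of_rat (c * d) :: real)" using 2 by (simp add: of_rat_mult)
    then have "s = c * d" by (simp only: of_rat_eq_iff)
    then show ?thesis using cd r by (intro exI[of _ c] exI[of _ d]) auto
  qed
next
  assume "\<exists>c d. 0 \<le> c \<and> 0 \<le> d \<and> of_rat c \<in> {..r} \<and> of_rat d \<in> {..r'} \<and> s = c * (d :: rat)"
  then show "of_rat s \<in> {..r * r'}" using r by (auto simp: of_rat_mult intro!: mult_mono)
qed

text \<open>If one factor always stays strictly below its bound, the product never reaches r r'. The
  disjunction covers irrational bounds as well as an open ball on either side.\<close>

lemma factors_less:
  fixes r r' :: real
  assumes r: "0 < r" "0 < r'" and s: "0 \<le> s"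
    and I: "{..<r} \<subseteq> I" "I \<subseteq> {..r}" and J: "{..<r'} \<subseteq> J" "J \<subseteq> {..r'}"
    and ne: "(\<forall>c. of_rat c \<in> I \<longrightarrow> of_rat c < r) \<or> (\<forall>d. of_rat d \<in> J \<longrightarrow> of_rat d < r')"
  shows "of_rat s \<in> {..<r * r'} \<longleftrightarrow>
    (\<exists>c d. 0 \<le> c \<and> 0 \<le> d \<and> of_rat c \<in> I \<and> of_rat d \<in> J \<and> s = c * (d :: rat))"
proof
  assume "of_rat s \<in> {..<r * r'}"
  then have "of_rat s < r * r'" by simp
  then obtain c d where "0 \<le> c" "0 \<le> d" "of_rat c < r" "of_rat d < r'" "s = c * d"
    using ex_rat_factors[OF r s] by blast
  then show "\<exists>c d. 0 \<le> c \<and> 0 \<le> d \<and> of_rat c \<in> I \<and> of_rat d \<in> J \<and> s = c * (d :: rat)"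
    using I J by (intro exI[of _ c] exI[of _ d]) auto
next
  assume "\<exists>c d. 0 \<le> c \<and> 0 \<le> d \<and> of_rat c \<in> I \<and> of_rat d \<in> J \<and> s = c * (d :: rat)"
  then obtain c d where cd: "0 \<le> c" "0 \<le> d" "of_rat c \<in> I" "of_rat d \<in> J" "s = c * d" by blast
  have le: "of_rat c \<le> r" "of_rat d \<le> r'" using cd I J by auto
  have "of_rat c * of_rat d < r * r'" using ne
  proof
    assume "\<forall>c. of_rat c \<in> I \<longrightarrow> of_rat c < r"
    then have "of_rat c < r" using cd by blast
    have "of_rat c * of_rat d \<le> of_rat c * r'" using cd le by (intro mult_left_mono) auto
    also have "\<dots> < r * r'" using \<open>of_rat c < r\<close> r by simp
    finally show ?thesis .
  next
    assume "\<forall>d. of_rat d \<in> J \<longrightarrow> of_rat d < r'"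
    then have "of_rat d < r'" using cd by blast
    have "of_rat c * of_rat d \<le> r * of_rat d" using cd le by (intro mult_right_mono) auto
    also have "\<dots> < r * r'" using \<open>of_rat d < r'\<close> r by simp
    finally show ?thesis .
  qed
  then show "of_rat s \<in> {..<r * r'}" using cd by (simp add: of_rat_mult)
qed


section \<open>Principal divisors and isomorphisms\<close>

lemma bounded_sections_scale:
  assumes q: "q \<noteq> 0" and n: "\<And>p. prime p \<Longrightarrow> n p = n' p + vp p q" and r: "r' = \<bar>of_rat q\<bar> * r"
    and x: "x \<in> bounded_sections n {..r} U k"
  shows "(\<lambda>i. q * x i) \<in> bounded_sections n' {..r'} U k"
proof -
  have "q * x i \<in> O_fin n' U" if "x i \<in> O_fin n U" for i
    using that q n by (auto simp: O_fin_def vp_mult)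
  then show ?thesis using x r
    by (auto simp: bounded_sections_def H_el_def l1_norm_scale intro: mult_left_mono)
qed

text \<open>Multiplication by q shifts valuations by those of q and norms by its absolute value;
  multiplication by 1 / q is the inverse.\<close>

lemma iso_bounded_sections:
  assumes q: "q \<noteq> 0" and n: "\<And>p. prime p \<Longrightarrow> n p = n' p + vp p q" and r: "r' = \<bar>of_rat q\<bar> * r"
  shows "iso_modules \<O> (HQ_submod (bounded_sections n {..r})) (HQ_submod (bounded_sections n' {..r'}))"
proof -
  have n': "n' p = n p + vp p (inverse q)" if "prime p" for p using n[OF that] q that by (simp add: vp_inverse)
  have r': "r = \<bar>of_rat (inverse q)\<bar> * r'" using q r by (simp add: of_rat_inverse)
  have bij: "bij_betw (\<lambda>x i. q * x i) (bounded_sections n {..r} U k) (bounded_sections n' {..r'} U k)" for U k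
  proof (rule bij_betw_byWitness[where f' = "\<lambda>x i. inverse q * x i"])
    show "(\<lambda>x i. q * x i) ` bounded_sections n {..r} U k \<subseteq> bounded_sections n' {..r'} U k"
      using bounded_sections_scale[where n = n and n' = n', OF q n r] by blast
    show "(\<lambda>x i. inverse q * x i) ` bounded_sections n' {..r'} U k \<subseteq> bounded_sections n {..r} U k"
      using bounded_sections_scale[where n = n' and n' = n, OF _ n' r'] q by auto
  qed (use q in \<open>auto simp: field_simps\<close>)
  have "(\<lambda>i. q * H_map k l f x i) = H_map k l f (\<lambda>i. q * x i)" for k l f x
    by (auto simp: H_map_def sum_distrib_left)
  moreover have "(\<lambda>i. q * H_mult k l a x i) = H_mult k l a (\<lambda>i. q * x i)" for k l a x
    by (auto simp: H_mult_def)
  moreover have "bij_betw (\<lambda>x i. q * x i) {\<lambda>_. 0} {\<lambda>_::nat. 0}" by (auto simp: bij_betw_def)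
  ultimately show ?thesis unfolding iso_modules_def
    by (intro exI[of _ "\<lambda>U k x i. q * x i"]) (auto simp: HQ_submod_def HQ_res_def bij)
qed

text \<open>Level 1_+ alone suffices to recover q: linearity over the integers away from
  \<open>Infty\<close> forces multiplication by a rational. Generators of the two ideals then
  determine its valuations, and sections near \<open>Infty\<close> its absolute value.\<close>

lemma iso_bounded_sectionsD:
  assumes n: "finite {p. n p \<noteq> 0}" "\<And>p. n p \<noteq> 0 \<Longrightarrow> prime p"
    and n': "finite {p. n' p \<noteq> 0}" "\<And>p. n' p \<noteq> 0 \<Longrightarrow> prime p"
    and r: "0 < r" "0 < r'"
    and iso: "iso_modules O_bar (HQ_submod (bounded_sections n {..r})) (HQ_submod (bounded_sections n' {..r'}))"
  obtains q where "q \<noteq> 0" "\<And>p. prime p \<Longrightarrow> n p = n' p + vp p q" "r' = \<bar>of_rat q\<bar> * r"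
proof -
  let ?M = "bounded_sections n {..r}" and ?N = "bounded_sections n' {..r'}" and ?S = "bounded_sections (\<lambda>_. 0) {..1}"
  let ?HM = "HQ_submod ?M" and ?HN = "HQ_submod ?N"
  obtain \<phi> where \<phi>: "\<forall>U. is_open U \<longrightarrow>
     (\<forall>k. bij_betw (\<phi> U k) (el (mval ?HM U) k) (el (mval ?HN U) k) \<and> \<phi> U k (pt (mval ?HM U) k) = pt (mval ?HN U) k) \<and>
     (\<forall>k l. \<forall>f\<in>pmaps k l. \<forall>x\<in>el (mval ?HM U) k. \<phi> U l (mp (mval ?HM U) k l f x) = mp (mval ?HN U) k l f (\<phi> U k x)) \<and>
     (\<forall>k l. \<forall>a\<in>el (aval O_bar U) k. \<forall>x\<in>el (mval ?HM U) l.
          \<phi> U (k * l) (lact (mval ?HM U) k l a x) = lact (mval ?HN U) k l a (\<phi> U l x)) \<and>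
     (\<forall>V k. is_open V \<and> V \<subseteq> U \<longrightarrow> (\<forall>x\<in>el (mval ?HM U) k. \<phi> V k (mres ?HM U V k x) = mres ?HN U V k (\<phi> U k x)))"
    using iso unfolding iso_modules_def by (elim exE)
  have M: "mval ?HM U = H_mod (?M U)" "mval ?HN U = H_mod (?N U)" "aval O_bar U = H_alg (?S U)" if "U \<noteq> {}" for U
    using that by (simp_all add: HQ_submod_def HQ_subalg_def O_bar_eq)
  have bij: "bij_betw (\<phi> U 1) (?M U 1) (?N U 1)" and zero: "\<phi> U 1 (\<lambda>_. 0) = (\<lambda>_. 0)" if U: "is_open U" "U \<noteq> {}" for U
    using \<phi>[rule_format, OF U(1)] unfolding M[OF U(2)] by simp_all
  have lin: "\<phi> U 1 (H_mult 1 1 a x) = H_mult 1 1 a (\<phi> U 1 x)" if U: "is_open U" "U \<noteq> {}" "a \<in> ?S U 1" "x \<in> ?M U 1" for U a x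
  proof -
    have "\<forall>k l. \<forall>a\<in>?S U k. \<forall>x\<in>?M U l. \<phi> U (k * l) (H_mult k l a x) = H_mult k l a (\<phi> U l x)"
      using \<phi>[rule_format, OF U(1)] unfolding M[OF U(2)] H_mod_simps by (elim conjE)
    from this[rule_format, OF U(3,4)] show ?thesis by (simp only: mult_1)
  qed
  have res: "\<phi> V 1 x = \<phi> U 1 x" if U: "is_open U" "is_open V" "V \<subseteq> U" "V \<noteq> {}" "x \<in> ?M U 1" for U V x
  proof -
    have ne: "U \<noteq> {}" using U by blast
    have "\<forall>V k. is_open V \<and> V \<subseteq> U \<longrightarrow> (\<forall>x\<in>?M U k. \<phi> V k (mres ?HM U V k x) = mres ?HN U V k (\<phi> U k x))"
      using \<phi>[rule_format, OF U(1)] unfolding M[OF ne] H_mod_simps by (elim conjE)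
    from this[rule_format, of V x 1] show ?thesis using U by (simp add: HQ_submod_def HQ_res_def)
  qed
  define g where "g U e = \<phi> U 1 (scal e) 1" for U e
  have g: "\<phi> U 1 (scal e) = scal (g U e)" if "is_open U" "U \<noteq> {}" "scal e \<in> ?M U 1" for U e
  proof -
    have "\<phi> U 1 (scal e) \<in> ?N U 1" using bij_betwE[OF bij[OF that(1,2)]] that(3) by blast
    then show ?thesis unfolding g_def by (intro scal_of_H_el[of _ "O_fin n' U"]) (simp add: bounded_sections_def)
  qed
  have ne: "SpecZ \<noteq> {}" "Infty \<notin> SpecZ" by (auto simp: SpecZ_def prime_places_def)
  obtain c where c: "c \<noteq> 0" "\<And>p. prime p \<Longrightarrow> vp p c = - n p" using ex_generator[OF n] by blast
  obtain c' where c': "c' \<noteq> 0" "\<And>p. prime p \<Longrightarrow> vp p c' = - n' p" using ex_generator[OF n'] by blast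
  have sc: "scal c \<in> ?M SpecZ 1" using c ne by (simp only: scal_mem) (simp add: O_fin_def)
  have sc': "scal c' \<in> ?N SpecZ 1" using c' ne by (simp only: scal_mem) (simp add: O_fin_def)
  define q where "q = g SpecZ c / c"
  \<comment> \<open>Without \<open>Infty\<close> there is no norm bound, so every integer acts; in
    the unit ball only -1, 0 and 1 would.\<close>
  have int_mem: "scal (of_int m) \<in> ?S U 1" if "Infty \<notin> U" for U m
    using that by (cases "m = 0") (auto simp: scal_mem O_fin_def vp_of_int simp del: One_nat_def)
  have gq: "g U e = q * e" if U: "is_open U" "U \<noteq> {}" and e: "scal e \<in> ?M U 1" for U e
  proof (cases "e = 0")
    case True
    then have "scal e = (\<lambda>_. 0)" by (auto simp: scal_def)
    then show ?thesis using zero[OF U] True by (simp add: g_def)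
  next
    case False
    \<comment> \<open>Both e and the generator c restrict to W, where integers act, so their images
      can be compared.\<close>
    define W where "W = U \<inter> SpecZ"
    have W: "is_open W" "W \<subseteq> U" "W \<subseteq> SpecZ" "W \<noteq> {}" "Infty \<notin> W"
      using open_Int[OF U(1) open_SpecZ] open_generic[OF U] open_generic[OF open_SpecZ ne(1)] ne(2) by (auto simp: W_def)
    have mem: "scal e \<in> ?M W 1" "scal c \<in> ?M W 1"
      using e sc bounded_sections_mono W by blast+
    have gW: "g W e = g U e" "g W c = g SpecZ c"
      using res[OF U(1) W(1,2,4) e] res[OF open_SpecZ W(1,3,4) sc] by (simp_all add: g_def)
    obtain a b where ab: "a \<noteq> 0" "b \<noteq> 0" "e / c = of_int a / of_int b"
      using rat_fractionE[of "e / c"] False c by auto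
    have lin': "g W (of_int m * d) = of_int m * g W d" if "scal d \<in> ?M W 1" for m d
    proof -
      have "scal (of_int m * d) = H_mult 1 1 (scal (of_int m)) (scal d)" by (simp only: H_mult_scal_scal)
      then have "\<phi> W 1 (scal (of_int m * d)) = H_mult 1 1 (scal (of_int m)) (scal (g W d))"
        using lin[OF W(1,4) int_mem[OF W(5)] that] g[OF W(1,4) that] by (simp only:)
      then show ?thesis unfolding g_def[of W "of_int m * d"] H_mult_scal_scal by (simp add: scal_def)
    qed
    \<comment> \<open>Clearing the denominator of e / c relates e to c by integers, which commute
      with the isomorphism.\<close>
    have "of_int b * e = of_int a * c" using ab c by (simp add: field_simps)
    then have "of_int b * g W e = of_int a * g W c" using lin'[OF mem(1), of b] lin'[OF mem(2), of a] by simp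
    then have "g W e = of_int a / of_int b * g W c" using ab by (simp add: field_simps)
    then show ?thesis unfolding gW ab(3)[symmetric] by (simp add: q_def)
  qed
  have \<phi>_scal: "\<phi> U 1 (scal e) = scal (q * e)" if "is_open U" "U \<noteq> {}" "scal e \<in> ?M U 1" for U e
    using g[OF that] gq[OF that] by simp
  have into: "scal (q * e) \<in> ?N U 1" if "is_open U" "U \<noteq> {}" "scal e \<in> ?M U 1" for U e
    using bij_betwE[OF bij[OF that(1,2)]] that(3) \<phi>_scal[OF that] by metis
  have onto: "\<exists>e. scal e \<in> ?M U 1 \<and> q * e = e'" if U: "is_open U" "U \<noteq> {}" "scal e' \<in> ?N U 1" for U e'
  proof -
    have "scal e' \<in> \<phi> U 1 ` ?M U 1" using bij_betw_imp_surj_on[OF bij[OF U(1,2)]] U(3) by simp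
    then obtain x where x: "x \<in> ?M U 1" "\<phi> U 1 x = scal e'" by (elim imageE) metis
    have "x = scal (x 1)" using x(1) by (intro scal_of_H_el[of _ "O_fin n U"]) (simp add: bounded_sections_def)
    then show ?thesis using x \<phi>_scal[OF U(1,2), of "x 1"] scal_inject by metis
  qed
  have q: "q \<noteq> 0" using onto[OF open_SpecZ ne(1) sc'] c'(1) by auto
  \<comment> \<open>The generators c and c' have the least permitted valuations. The preimage of c'
    gives one inequality, the image of c the other.\<close>
  have fin: "n p = n' p + vp p q" if p: "prime p" for p
  proof (rule antisym)
    have pS: "Pt p \<in> SpecZ" using p by (simp add: SpecZ_def prime_places_def)
    obtain e where e: "scal e \<in> ?M SpecZ 1" "q * e = c'" using onto[OF open_SpecZ ne(1) sc'] by blast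
    have e0: "e \<noteq> 0" using e c' by auto
    have "e \<in> O_fin n SpecZ" using e(1) by (simp only: scal_mem)
    then have "0 \<le> vp p e + n p" using e0 p pS by (simp add: O_fin_def)
    moreover have "vp p q + vp p e = - n' p" using c'(2)[OF p] vp_mult[OF p q e0] e(2) by simp
    ultimately show "n' p + vp p q \<le> n p" by simp
    have "q * c \<in> O_fin n' SpecZ" using into[OF open_SpecZ ne(1) sc] by (simp only: scal_mem)
    then have "0 \<le> vp p (q * c) + n' p" using q c p pS by (simp add: O_fin_def)
    then show "n p \<le> n' p + vp p q" using vp_mult[OF p q c(1)] c(2)[OF p] by simp
  qed
  have near: "\<exists>W. is_open W \<and> W \<noteq> {} \<and> Infty \<in> W \<and> e \<in> O_fin n W \<and> e \<in> O_fin n' W" for e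
  proof -
    have "is_open SpecZ_bar" "Infty \<in> SpecZ_bar" unfolding is_open_def by (auto simp: SpecZ_bar_def)
    then obtain W where "is_open W" "Infty \<in> W" "{e} \<subseteq> O_fin n W" "{e} \<subseteq> O_fin n' W"
      using shrink_open[of SpecZ_bar "{e}" n n'] n(1) n'(1) by auto
    then show ?thesis by blast
  qed
  have q': "0 < \<bar>of_rat q :: real\<bar>" using q by simp
  \<comment> \<open>Otherwise a rational e between r' / |q| and r is a section of the source near
    \<open>Infty\<close> whose image exceeds r'.\<close>
  have "\<not> r' < \<bar>of_rat q\<bar> * r"
  proof
    assume "r' < \<bar>of_rat q\<bar> * r"
    then have "r' / \<bar>of_rat q\<bar> < r" using q' by (simp add: divide_less_eq mult.commute)
    then obtain e where e: "r' / \<bar>of_rat q\<bar> < of_rat e" "of_rat e < r" using of_rat_dense by blast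
    have "0 < r' / \<bar>of_rat q\<bar>" using r q' by simp
    then have e0: "0 < real_of_rat e" using e(1) by linarith
    obtain W where W: "is_open W" "W \<noteq> {}" "Infty \<in> W" "e \<in> O_fin n W" using near by blast
    have "scal e \<in> ?M W 1" using W e e0 by (simp only: scal_mem) simp
    from into[OF W(1,2) this] have "\<bar>of_rat (q * e)\<bar> \<le> r'" using W(3) by (simp only: scal_mem) simp
    then have "\<bar>of_rat q\<bar> * of_rat e \<le> r'" using e0 by (simp add: of_rat_mult abs_mult)
    then show False using e(1) q' by (simp add: divide_less_eq mult.commute)
  qed
  \<comment> \<open>Otherwise a rational between |q| r and r' is a section of the target near
    \<open>Infty\<close> whose preimage would have norm above r.\<close>
  moreover have "\<not> \<bar>of_rat q\<bar> * r < r'"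
  proof
    assume "\<bar>of_rat q\<bar> * r < r'"
    then obtain e' where e': "\<bar>of_rat q\<bar> * r < of_rat e'" "of_rat e' < r'" using of_rat_dense by blast
    have "0 \<le> \<bar>of_rat q\<bar> * r" using r by simp
    then have e0: "0 < real_of_rat e'" using e'(1) by linarith
    obtain W where W: "is_open W" "W \<noteq> {}" "Infty \<in> W" "e' \<in> O_fin n' W" using near by blast
    have "scal e' \<in> ?N W 1" using W e' e0 by (simp only: scal_mem) simp
    from onto[OF W(1,2) this] obtain e where e: "scal e \<in> ?M W 1" "q * e = e'" by blast
    have "\<bar>of_rat e\<bar> \<le> r" using e(1) W(3) by (simp only: scal_mem) simp
    then have "\<bar>of_rat q\<bar> * \<bar>of_rat e\<bar> \<le> \<bar>of_rat q\<bar> * r" by (intro mult_left_mono) auto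
    moreover have "\<bar>of_rat q\<bar> * \<bar>of_rat e\<bar> = real_of_rat e'"
      using e0 abs_mult[of "real_of_rat q" "real_of_rat e"] unfolding e(2)[symmetric] of_rat_mult by linarith
    ultimately show False using e'(1) by linarith
  qed
  ultimately have "r' = \<bar>of_rat q\<bar> * r" by linarith
  with q fin show ?thesis by (rule that)
qed

theorem proposition6p4:
  fixes D D' :: arakelov
  assumes "arakelov_divisor D" and "arakelov_divisor D'"
  shows "(let exceptional = (exp (snd D) \<notin> \<rat> \<and> exp (snd D') \<notin> \<rat> \<and> exp (snd D) * exp (snd D') \<in> \<rat>)
          in (\<not> exceptional \<longrightarrow>
                iso_modules O_bar (smash_sheaf O_bar (O_div D) (O_div D')) (O_div (div_add D D'))) \<and>
             (exceptional \<longrightarrow>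
                iso_modules O_bar (smash_sheaf O_bar (O_div D) (O_div D'))
                  (smash_sheaf O_bar O_eps (O_div (div_add D D'))) \<and>
                iso_modules O_bar (smash_sheaf O_bar O_eps (O_div (div_add D D')))
                  (smash_sheaf O_bar (O_div (div_add D D')) O_eps))) \<and>
         (div_equiv D D' \<longleftrightarrow> iso_modules O_bar (O_div D) (O_div D'))"
proof -
  define n a n' a' where "n = fst D" and "a = snd D" and "n' = fst D'" and "a' = snd D'"
  have n: "finite {p. n p \<noteq> 0}" "\<And>p. n p \<noteq> 0 \<Longrightarrow> prime p"
    and n': "finite {p. n' p \<noteq> 0}" "\<And>p. n' p \<noteq> 0 \<Longrightarrow> prime p"
    using assms by (auto simp: arakelov_divisor_def n_def n'_def)
  let ?m = "\<lambda>p. n p + n' p" and ?r = "exp a" and ?r' = "exp a'"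
  have m: "finite {p. ?m p \<noteq> 0}" "\<And>p. ?m p \<noteq> 0 \<Longrightarrow> prime p"
  proof -
    have "{p. ?m p \<noteq> 0} \<subseteq> {p. n p \<noteq> 0} \<union> {p. n' p \<noteq> 0}" by auto
    then show "finite {p. ?m p \<noteq> 0}" by (rule finite_subset) (simp add: n n')
    show "prime p" if "?m p \<noteq> 0" for p using that n(2)[of p] n'(2)[of p] by (cases "n p = 0") auto
  qed
  have D: "O_div D = HQ_submod (bounded_sections n {..?r})" "O_div D' = HQ_submod (bounded_sections n' {..?r'})"
    "O_div (div_add D D') = HQ_submod (bounded_sections ?m {..?r * ?r'})"
    by (simp_all add: O_div_eq div_add_def exp_add n_def n'_def a_def a'_def)
  have rr: "0 < ?r * ?r'" by simp
  note downs = downset_atMost[OF exp_gt_zero] downset_atMost[OF rr] downset_lessThan[OF rr] downset_lessThan[OF zero_less_one]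
  have regular: "iso_modules O_bar (smash_sheaf O_bar (O_div D) (O_div D')) (O_div (div_add D D'))"
    if ne: "\<not> (?r \<notin> \<rat> \<and> ?r' \<notin> \<rat> \<and> ?r * ?r' \<in> \<rat>)"
  proof -
    have K: "of_rat s \<in> {..?r * ?r'} \<longleftrightarrow>
        (\<exists>c d. 0 \<le> c \<and> 0 \<le> d \<and> of_rat c \<in> {..?r} \<and> of_rat d \<in> {..?r'} \<and> s = c * d)" if "0 \<le> s" for s
      using factors_le[OF exp_gt_zero exp_gt_zero that ne] .
    interpret smash_sections n n' "{..?r}" "{..?r'}" "{..?r * ?r'}"
      by (rule smash_sections.intro[OF n n' downs(1,1,2) K])
    show ?thesis unfolding D by (rule iso_smash(1))
  qed
  have exceptional: "iso_modules O_bar (smash_sheaf O_bar (O_div D) (O_div D')) (smash_sheaf O_bar O_eps (O_div (div_add D D'))) \<and>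
      iso_modules O_bar (smash_sheaf O_bar O_eps (O_div (div_add D D'))) (smash_sheaf O_bar (O_div (div_add D D')) O_eps)"
    if irr: "?r \<notin> \<rat>" "?r' \<notin> \<rat>"
  proof -
    \<comment> \<open>This sheaf with strict bound is the common value of the three smash
      products.\<close>
    let ?X = "HQ_submod (bounded_sections ?m {..<?r * ?r'})"
    \<comment> \<open>No rational equals the irrational bound, so the closed ball behaves like the
      open one.\<close>
    have lt: "\<forall>c. of_rat c \<in> {..?r} \<longrightarrow> of_rat c < ?r" using irr(1) by (metis Rats_of_rat atMost_iff order_le_less)
    let ?K = "\<lambda>I J s. \<exists>c d. 0 \<le> c \<and> 0 \<le> d \<and> real_of_rat c \<in> I \<and> real_of_rat d \<in> J \<and> s = c * d"
    have K: "of_rat s \<in> {..<?r * ?r'} \<longleftrightarrow> ?K {..?r} {..?r'} s"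
      "of_rat s \<in> {..<?r * ?r'} \<longleftrightarrow> ?K {..<1} {..?r * ?r'} s"
      "of_rat s \<in> {..<?r * ?r'} \<longleftrightarrow> ?K {..?r * ?r'} {..<1} s" if s: "0 \<le> s" for s
    proof -
      show "of_rat s \<in> {..<?r * ?r'} \<longleftrightarrow> ?K {..?r} {..?r'} s"
        by (rule factors_less[OF exp_gt_zero exp_gt_zero s]) (use lt in auto)
      show "of_rat s \<in> {..<?r * ?r'} \<longleftrightarrow> ?K {..<1} {..?r * ?r'} s"
        by (rule factors_less[OF zero_less_one rr s, unfolded mult_1_left]) auto
      show "of_rat s \<in> {..<?r * ?r'} \<longleftrightarrow> ?K {..?r * ?r'} {..<1} s"
        by (rule factors_less[OF rr zero_less_one s, unfolded mult_1_right]) auto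
    qed
    have o: "finite {p::nat. (0::int) \<noteq> 0}" "\<And>p::nat. (0::int) \<noteq> 0 \<Longrightarrow> prime p" by simp_all
    interpret A: smash_sections n n' "{..?r}" "{..?r'}" "{..<?r * ?r'}"
      by (rule smash_sections.intro[OF n n' downs(1,1,3) K(1)])
    interpret B: smash_sections "\<lambda>_. 0" ?m "{..<1}" "{..?r * ?r'}" "{..<?r * ?r'}"
      by (rule smash_sections.intro[OF o m downs(4,2,3) K(2)])
    interpret C: smash_sections ?m "\<lambda>_. 0" "{..?r * ?r'}" "{..<1}" "{..<?r * ?r'}"
      by (rule smash_sections.intro[OF m o downs(2,4,3) K(3)])
    have A: "iso_modules O_bar (smash_sheaf O_bar (O_div D) (O_div D')) ?X" unfolding D by (rule A.iso_smash(1))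
    have B: "iso_modules O_bar ?X (smash_sheaf O_bar O_eps (O_div (div_add D D')))"
      "iso_modules O_bar (smash_sheaf O_bar O_eps (O_div (div_add D D'))) ?X"
      using B.iso_smash unfolding D O_eps_eq by simp_all
    have C: "iso_modules O_bar ?X (smash_sheaf O_bar (O_div (div_add D D')) O_eps)"
      using C.iso_smash unfolding D O_eps_eq by simp
    show ?thesis using iso_modules_trans[OF A B(1)] iso_modules_trans[OF B(2) C] ..
  qed
  have "div_equiv D D' \<longleftrightarrow> (\<exists>q. q \<noteq> 0 \<and> (\<forall>p. prime p \<longrightarrow> n p = n' p + vp p q) \<and> ?r' = \<bar>of_rat q\<bar> * ?r)"
  proof -
    have "D = div_add D' (principal q) \<longleftrightarrow> (\<forall>p. prime p \<longrightarrow> n p = n' p + vp p q) \<and> ?r' = \<bar>of_rat q\<bar> * ?r"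
      if q: "q \<noteq> 0" for q
    proof -
      \<comment> \<open>The infinite part of D = D' + (q) reads a = a' - ln |q|; exponentiated, it
        says that q carries the radius of D to that of D'.\<close>
      have "?r' = \<bar>of_rat q\<bar> * ?r \<longleftrightarrow> exp a' = exp (ln \<bar>of_rat q\<bar> + a)" using q by (simp add: exp_add)
      then have inf: "?r' = \<bar>of_rat q\<bar> * ?r \<longleftrightarrow> a = a' - ln \<bar>of_rat q\<bar>" by auto
      have "n p = n' p" if "\<not> prime p" for p using n(2)[of p] n'(2)[of p] that by force
      then have "n = (\<lambda>p. n' p + (if prime p then vp p q else 0)) \<longleftrightarrow> (\<forall>p. prime p \<longrightarrow> n p = n' p + vp p q)"
        by (auto simp: fun_eq_iff)
      then show ?thesis unfolding inf
        by (simp add: div_add_def principal_def prod_eq_iff n_def n'_def a_def a'_def)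
    qed
    then show ?thesis unfolding div_equiv_def by blast
  qed
  also have "\<dots> \<longleftrightarrow> iso_modules O_bar (O_div D) (O_div D')"
  proof
    assume "\<exists>q. q \<noteq> 0 \<and> (\<forall>p. prime p \<longrightarrow> n p = n' p + vp p q) \<and> ?r' = \<bar>of_rat q\<bar> * ?r"
    then show "iso_modules O_bar (O_div D) (O_div D')" unfolding D by (blast intro: iso_bounded_sections)
  next
    assume "iso_modules O_bar (O_div D) (O_div D')"
    from iso_bounded_sectionsD[OF n n' exp_gt_zero exp_gt_zero this[unfolded D]]
    show "\<exists>q. q \<noteq> 0 \<and> (\<forall>p. prime p \<longrightarrow> n p = n' p + vp p q) \<and> ?r' = \<bar>of_rat q\<bar> * ?r" by metis
  qed
  finally show ?thesis using regular exceptional unfolding a_def a'_def Let_def by blast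
qed

end
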